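(* Let $k$ be a field and let $\mathcal B$ be a skeletally small, Krull–Schmidt, $k$-linear exact category with enough projectives and enough injectives, containing a twin cotorsion pair $(\mathcal S,\mathcal T),(\mathcal T,\mathcal V)$. Let $R$ denote the class of morphisms which are both monomorphic and epimorphic in $\mathcal B/\mathcal T$, and let $(\mathcal B/\mathcal T)_R$ denote the (Gabriel–Zisman) localisation of $\mathcal B/\mathcal T$ at $R$. Then there is an equivalence of categories $$(\mathcal B/\mathcal T)_R\simeq \mathrm{mod}(\Omega\mathcal S/\mathcal P).$$
   Context: Exact category is meant in the sense of Quillen (the class of short exact sequences is closed under isomorphisms, direct sums and direct summands); $X\rightarrowtail Y\twoheadrightarrow Z$ denotes a short exact sequence of the exact structure. $\mathcal P$ is the full subcategory of projective objects of $\mathcal B$. Cotorsion pair: a pair $(\mathcal U,\mathcal V)$ of full additive subcategories of $\mathcal B$, closed under direct summands, such that $\mathrm{Ext}^1_{\mathcal B}(U,V)=0$ for all $U\in\mathcal U,V\in\mathcal V$ and every $B\in\mathcal B$ admits short exact sequences $V_B\rightarrowtail U_B\twoheadrightarrow B$ and $B\rightarrowtail V^B\twoheadrightarrow U^B$ with $U_B,U^B\in\mathcal U$, $V_B,V^B\in\mathcal V$. A twin cotorsion pair $(\mathcal S,\mathcal T),(\mathcal T,\mathcal V)$ means that $(\mathcal S,\mathcal T)$ and $(\mathcal T,\mathcal V)$ are cotorsion pairs with $\mathcal S\subseteq\mathcal T$. $\mathcal B/\mathcal T$ is the additive quotient category (morphisms modulo those factoring through an object of $\mathcal T$). $\Omega\mathcal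 S$ is the full subcategory of $\mathcal B$ consisting of the objects $\Omega S$ for which there is a short exact sequence $\Omega S\rightarrowtail P\twoheadrightarrow S$ with $P\in\mathcal P$, $S\in\mathcal S$; it contains $\mathcal P$, and $\Omega\mathcal S/\mathcal P$ is its quotient by the morphisms factoring through objects of $\mathcal P$. For an additive $k$-linear category $\mathcal C$, $\mathrm{mod}\,\mathcal C$ is the full subcategory of the category of contravariant additive functors from $\mathcal C$ to $k$-modules consisting of the functors $A$ admitting an exact sequence $\mathrm{Hom}_{\mathcal C}(-,C_1)\to\mathrm{Hom}_{\mathcal C}(-,C_0)\to A\to 0$ with $C_0,C_1\in\mathcal C$ (finitely presented functors). *)

theory Defs
  imports "HOL-Algebra.Module"
begin

section \<open>Categories, functors and equivalences\<close>

text \<open>The collection of objects of a category is a set over a type \<open>'o\<close> and each \<open>Hom\<close> is a set over a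
  type \<open>'m\<close>. Hence every category below is small relative to the universe of the logic, and
  skeletal smallness needs no separate hypothesis.\<close>

record ('o, 'm) cat =
  Obj :: "'o set"
  Arr :: "'m set"
  Dom :: "'m \<Rightarrow> 'o"
  Cod :: "'m \<Rightarrow> 'o"
  Idn :: "'o \<Rightarrow> 'm"
  Cmp :: "'m \<Rightarrow> 'm \<Rightarrow> 'm"  (infixr \<open>\<cdot>\<index>\<close> 75)

definition Hom :: "('o, 'm, 'z) cat_scheme \<Rightarrow> 'o \<Rightarrow> 'o \<Rightarrow> 'm set" where
  "Hom C X Y = {f \<in> Arr C. Dom C f = X \<and> Cod C f = Y}"

locale category =
  fixes C :: "('o, 'm, 'z) cat_scheme" (structure)
  assumes Dom_in: "f \<in> Arr C \<Longrightarrow> Dom C f \<in> Obj C"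
    and Cod_in: "f \<in> Arr C \<Longrightarrow> Cod C f \<in> Obj C"
    and Idn_in: "X \<in> Obj C \<Longrightarrow> Idn C X \<in> Hom C X X"
    and Cmp_in: "\<lbrakk>f \<in> Hom C X Y; g \<in> Hom C Y Z\<rbrakk> \<Longrightarrow> g \<cdot> f \<in> Hom C X Z"
    and Cmp_assoc: "\<lbrakk>f \<in> Hom C W X; g \<in> Hom C X Y; h \<in> Hom C Y Z\<rbrakk> \<Longrightarrow> h \<cdot> (g \<cdot> f) = (h \<cdot> g) \<cdot> f"
    and Idn_left: "f \<in> Hom C X Y \<Longrightarrow> Idn C Y \<cdot> f = f"
    and Idn_right: "f \<in> Hom C X Y \<Longrightarrow> f \<cdot> Idn C X = f"

definition is_iso :: "('o, 'm, 'z) cat_scheme \<Rightarrow> 'm \<Rightarrow> bool" where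
  "is_iso C f \<longleftrightarrow> f \<in> Arr C \<and>
     (\<exists>g \<in> Hom C (Cod C f) (Dom C f). g \<cdot>\<^bsub>C\<^esub> f = Idn C (Dom C f) \<and> f \<cdot>\<^bsub>C\<^esub> g = Idn C (Cod C f))"

definition is_mono :: "('o, 'm, 'z) cat_scheme \<Rightarrow> 'm \<Rightarrow> bool" where
  "is_mono C f \<longleftrightarrow> f \<in> Arr C \<and>
     (\<forall>W \<in> Obj C. \<forall>g \<in> Hom C W (Dom C f). \<forall>h \<in> Hom C W (Dom C f). f \<cdot>\<^bsub>C\<^esub> g = f \<cdot>\<^bsub>C\<^esub> h \<longrightarrow> g = h)"

definition is_epi :: "('o, 'm, 'z) cat_scheme \<Rightarrow> 'm \<Rightarrow> bool" where
  "is_epi C f \<longleftrightarrow> f \<in> Arr C \<and>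
     (\<forall>W \<in> Obj C. \<forall>g \<in> Hom C (Cod C f) W. \<forall>h \<in> Hom C (Cod C f) W. g \<cdot>\<^bsub>C\<^esub> f = h \<cdot>\<^bsub>C\<^esub> f \<longrightarrow> g = h)"

definition mono_epis :: "('o, 'm, 'z) cat_scheme \<Rightarrow> 'm set" where
  "mono_epis C = {f. is_mono C f \<and> is_epi C f}"

definition full_sub :: "('o, 'm, 'z) cat_scheme \<Rightarrow> 'o set \<Rightarrow> ('o, 'm, 'z) cat_scheme" where
  "full_sub C U = C\<lparr>Obj := U, Arr := {f \<in> Arr C. Dom C f \<in> U \<and> Cod C f \<in> U}\<rparr>"

record ('o, 'm, 'p, 'n) func =
  FO :: "'o \<Rightarrow> 'p"
  FA :: "'m \<Rightarrow> 'n"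

definition is_functor ::
    "('o, 'm, 'y) cat_scheme \<Rightarrow> ('p, 'n, 'z) cat_scheme \<Rightarrow> ('o, 'm, 'p, 'n) func \<Rightarrow> bool" where
  "is_functor C D F \<longleftrightarrow>
     (\<forall>X \<in> Obj C. FO F X \<in> Obj D \<and> FA F (Idn C X) = Idn D (FO F X)) \<and>
     (\<forall>f \<in> Arr C. FA F f \<in> Hom D (FO F (Dom C f)) (FO F (Cod C f))) \<and>
     (\<forall>f \<in> Arr C. \<forall>g \<in> Arr C. Cod C f = Dom C g \<longrightarrow> FA F (g \<cdot>\<^bsub>C\<^esub> f) = FA F g \<cdot>\<^bsub>D\<^esub> FA F f)"

definition is_nat_trans ::
    "('o, 'm, 'y) cat_scheme \<Rightarrow> ('p, 'n, 'z) cat_scheme \<Rightarrow>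
     ('o, 'm, 'p, 'n) func \<Rightarrow> ('o, 'm, 'p, 'n) func \<Rightarrow> ('o \<Rightarrow> 'n) \<Rightarrow> bool" where
  "is_nat_trans C D F G \<eta> \<longleftrightarrow>
     (\<forall>X \<in> Obj C. \<eta> X \<in> Hom D (FO F X) (FO G X)) \<and>
     (\<forall>f \<in> Arr C. \<eta> (Cod C f) \<cdot>\<^bsub>D\<^esub> FA F f = FA G f \<cdot>\<^bsub>D\<^esub> \<eta> (Dom C f))"

definition nat_isomorphic ::
    "('o, 'm, 'y) cat_scheme \<Rightarrow> ('p, 'n, 'z) cat_scheme \<Rightarrow>
     ('o, 'm, 'p, 'n) func \<Rightarrow> ('o, 'm, 'p, 'n) func \<Rightarrow> bool" where
  "nat_isomorphic C D F G \<longleftrightarrow>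
     (\<exists>\<eta>. is_nat_trans C D F G \<eta> \<and> (\<forall>X \<in> Obj C. is_iso D (\<eta> X)))"

definition id_func :: "('o, 'm, 'o, 'm) func" where
  "id_func = \<lparr>FO = id, FA = id\<rparr>"

definition comp_func ::
    "('p, 'n, 'q, 'l) func \<Rightarrow> ('o, 'm, 'p, 'n) func \<Rightarrow> ('o, 'm, 'q, 'l) func" where
  "comp_func G F = \<lparr>FO = FO G \<circ> FO F, FA = FA G \<circ> FA F\<rparr>"

definition equivalent_categories ::
    "('o, 'm, 'y) cat_scheme \<Rightarrow> ('p, 'n, 'z) cat_scheme \<Rightarrow> bool" where
  "equivalent_categories C D \<longleftrightarrow> category C \<and> category D \<and>
     (\<exists>F G. is_functor C D F \<and> is_functor D C G \<and>
        nat_isomorphic C C (comp_func G F) id_func \<and> nat_isomorphic D D (comp_func F G) id_func)"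


section \<open>Gabriel--Zisman localisation\<close>

text \<open>Morphisms of the localisation are zigzags, read from left to right as paths in the quiver that
  has an arrow \<open>Fwd f : Dom f \<rightarrow> Cod f\<close> for each morphism \<open>f\<close> and an arrow \<open>Bwd r : Cod r \<rightarrow> Dom r\<close> for
  each \<open>r \<in> R\<close>, modulo the least congruence that makes \<open>Fwd\<close> functorial and \<open>Bwd r\<close> inverse to \<open>Fwd r\<close>.\<close>

datatype 'm step = Fwd 'm | Bwd 'm

fun zz_path :: "('o, 'm, 'z) cat_scheme \<Rightarrow> 'm set \<Rightarrow> 'o \<Rightarrow> 'm step list \<Rightarrow> 'o \<Rightarrow> bool" where
  "zz_path C R X [] Y \<longleftrightarrow> X \<in> Obj C \<and> X = Y"
| "zz_path C R X (Fwd f # w) Y \<longleftrightarrow> f \<in> Arr C \<and> Dom C f = X \<and> zz_path C R (Cod C f) w Y"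
| "zz_path C R X (Bwd r # w) Y \<longleftrightarrow> r \<in> R \<and> r \<in> Arr C \<and> Cod C r = X \<and> zz_path C R (Dom C r) w Y"

inductive zz_eq ::
    "('o, 'm, 'z) cat_scheme \<Rightarrow> 'm set \<Rightarrow> 'o \<Rightarrow> 'o \<Rightarrow> 'm step list \<Rightarrow> 'm step list \<Rightarrow> bool"
  for C :: "('o, 'm, 'z) cat_scheme" and R :: "'m set" where
  zz_refl: "zz_path C R X w Y \<Longrightarrow> zz_eq C R X Y w w"
| zz_sym: "zz_eq C R X Y v w \<Longrightarrow> zz_eq C R X Y w v"
| zz_trans: "\<lbrakk>zz_eq C R X Y u v; zz_eq C R X Y v w\<rbrakk> \<Longrightarrow> zz_eq C R X Y u w"
| zz_append: "\<lbrakk>zz_eq C R X Y v w; zz_eq C R Y Z v' w'\<rbrakk> \<Longrightarrow> zz_eq C R X Z (v @ v') (w @ w')"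
| zz_identity: "X \<in> Obj C \<Longrightarrow> zz_eq C R X X [Fwd (Idn C X)] []"
| zz_comp: "\<lbrakk>f \<in> Hom C X Y; g \<in> Hom C Y Z\<rbrakk> \<Longrightarrow> zz_eq C R X Z [Fwd f, Fwd g] [Fwd (g \<cdot>\<^bsub>C\<^esub> f)]"
| zz_inv_left: "\<lbrakk>r \<in> R; r \<in> Hom C X Y\<rbrakk> \<Longrightarrow> zz_eq C R X X [Fwd r, Bwd r] []"
| zz_inv_right: "\<lbrakk>r \<in> R; r \<in> Hom C X Y\<rbrakk> \<Longrightarrow> zz_eq C R Y Y [Bwd r, Fwd r] []"

definition zz_rel ::
    "('o, 'm, 'z) cat_scheme \<Rightarrow> 'm set \<Rightarrow> 'o \<Rightarrow> 'o \<Rightarrow> ('m step list \<times> 'm step list) set" where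
  "zz_rel C R X Y = {(v, w). zz_eq C R X Y v w}"

definition localisation ::
    "('o, 'm, 'z) cat_scheme \<Rightarrow> 'm set \<Rightarrow> ('o, 'o \<times> 'm step list set \<times> 'o) cat" where
  "localisation C R =
     \<lparr>Obj = Obj C,
      Arr = {(X, c, Y). X \<in> Obj C \<and> Y \<in> Obj C \<and> c \<in> {w. zz_path C R X w Y} // zz_rel C R X Y},
      Dom = (\<lambda>(X, c, Y). X),
      Cod = (\<lambda>(X, c, Y). Y),
      Idn = (\<lambda>X. (X, zz_rel C R X X `` {[]}, X)),
      Cmp = (\<lambda>(Y', d, Z) (X, c, Y). (X, \<Union>v \<in> c. \<Union>w \<in> d. zz_rel C R X Z `` {v @ w}, Z))\<rparr>"


section \<open>Linear and additive categories\<close>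

record ('o, 'm, 'k) lincat = "('o, 'm) cat" +
  Zero :: "'o \<Rightarrow> 'o \<Rightarrow> 'm"
  Add :: "'m \<Rightarrow> 'm \<Rightarrow> 'm"
  Scal :: "'k \<Rightarrow> 'm \<Rightarrow> 'm"

text \<open>The record type of modules extends that of rings; its fields \<open>mult\<close> and \<open>one\<close> play no role in
  the locale \<open>module\<close>.\<close>

definition hom_module :: "('o, 'm, 'k, 'z) lincat_scheme \<Rightarrow> 'o \<Rightarrow> 'o \<Rightarrow> ('k, 'm) module" where
  "hom_module C X Y = \<lparr>carrier = Hom C X Y, mult = undefined, one = undefined,
     zero = Zero C X Y, add = Add C, smult = Scal C\<rparr>"

locale linear_category = category C + K?: field K
  for K :: "('k, 'r) ring_scheme" (structure) and C :: "('o, 'm, 'k, 'z) lincat_scheme" (structure) +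
  assumes hom_module: "\<lbrakk>X \<in> Obj C; Y \<in> Obj C\<rbrakk> \<Longrightarrow> module K (hom_module C X Y)"
    and Cmp_Add_left: "\<lbrakk>f \<in> Hom C X Y; g \<in> Hom C Y Z; h \<in> Hom C Y Z\<rbrakk>
      \<Longrightarrow> Add C g h \<cdot>\<^bsub>C\<^esub> f = Add C (g \<cdot>\<^bsub>C\<^esub> f) (h \<cdot>\<^bsub>C\<^esub> f)"
    and Cmp_Add_right: "\<lbrakk>f \<in> Hom C X Y; g \<in> Hom C X Y; h \<in> Hom C Y Z\<rbrakk>
      \<Longrightarrow> h \<cdot>\<^bsub>C\<^esub> Add C f g = Add C (h \<cdot>\<^bsub>C\<^esub> f) (h \<cdot>\<^bsub>C\<^esub> g)"
    and Cmp_Scal_left: "\<lbrakk>a \<in> carrier K; f \<in> Hom C X Y; g \<in> Hom C Y Z\<rbrakk>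
      \<Longrightarrow> Scal C a g \<cdot>\<^bsub>C\<^esub> f = Scal C a (g \<cdot>\<^bsub>C\<^esub> f)"
    and Cmp_Scal_right: "\<lbrakk>a \<in> carrier K; f \<in> Hom C X Y; g \<in> Hom C Y Z\<rbrakk>
      \<Longrightarrow> g \<cdot>\<^bsub>C\<^esub> Scal C a f = Scal C a (g \<cdot>\<^bsub>C\<^esub> f)"

definition zero_object :: "('o, 'm, 'z) cat_scheme \<Rightarrow> 'o \<Rightarrow> bool" where
  "zero_object C Z \<longleftrightarrow> Z \<in> Obj C \<and> (\<forall>X \<in> Obj C. (\<exists>!f. f \<in> Hom C X Z) \<and> (\<exists>!f. f \<in> Hom C Z X))"

definition biproduct ::
    "('o, 'm, 'k, 'z) lincat_scheme \<Rightarrow> 'o \<Rightarrow> 'o \<Rightarrow> 'o \<Rightarrow> 'm \<Rightarrow> 'm \<Rightarrow> 'm \<Rightarrow> 'm \<Rightarrow> bool" where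
  "biproduct C X Y Z i j p q \<longleftrightarrow>
     i \<in> Hom C X Z \<and> j \<in> Hom C Y Z \<and> p \<in> Hom C Z X \<and> q \<in> Hom C Z Y \<and>
     p \<cdot>\<^bsub>C\<^esub> i = Idn C X \<and> q \<cdot>\<^bsub>C\<^esub> j = Idn C Y \<and> q \<cdot>\<^bsub>C\<^esub> i = Zero C X Y \<and> p \<cdot>\<^bsub>C\<^esub> j = Zero C Y X \<and>
     Add C (i \<cdot>\<^bsub>C\<^esub> p) (j \<cdot>\<^bsub>C\<^esub> q) = Idn C Z"

locale additive_category = linear_category K C
  for K :: "('k, 'r) ring_scheme" (structure) and C :: "('o, 'm, 'k, 'z) lincat_scheme" (structure) +
  assumes ex_zero_object: "\<exists>Z. zero_object C Z"
    and ex_biproduct: "\<lbrakk>X \<in> Obj C; Y \<in> Obj C\<rbrakk> \<Longrightarrow> \<exists>Z i j p q. biproduct C X Y Z i j p q"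

definition finite_direct_sum ::
    "('o, 'm, 'k, 'z) lincat_scheme \<Rightarrow> nat \<Rightarrow> (nat \<Rightarrow> 'o) \<Rightarrow> 'o \<Rightarrow> (nat \<Rightarrow> 'm) \<Rightarrow> (nat \<Rightarrow> 'm) \<Rightarrow> bool" where
  "finite_direct_sum C n X Z \<iota> \<pi> \<longleftrightarrow> Z \<in> Obj C \<and>
     (\<forall>i < n. \<iota> i \<in> Hom C (X i) Z \<and> \<pi> i \<in> Hom C Z (X i)) \<and>
     (\<forall>i < n. \<forall>j < n. \<pi> j \<cdot>\<^bsub>C\<^esub> \<iota> i = (if i = j then Idn C (X i) else Zero C (X i) (X j))) \<and>
     (\<Oplus>\<^bsub>hom_module C Z Z\<^esub> i \<in> {..<n}. \<iota> i \<cdot>\<^bsub>C\<^esub> \<pi> i) = Idn C Z"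

definition endo_ring :: "('o, 'm, 'k, 'z) lincat_scheme \<Rightarrow> 'o \<Rightarrow> 'm ring" where
  "endo_ring C X = \<lparr>carrier = Hom C X X, mult = Cmp C, one = Idn C X, zero = Zero C X X, add = Add C\<rparr>"

definition local_ring :: "('a, 'b) ring_scheme \<Rightarrow> bool" where
  "local_ring R \<longleftrightarrow> ring R \<and> \<one>\<^bsub>R\<^esub> \<noteq> \<zero>\<^bsub>R\<^esub> \<and>
     (\<forall>a \<in> carrier R - Units R. \<forall>b \<in> carrier R - Units R. a \<oplus>\<^bsub>R\<^esub> b \<notin> Units R)"

definition krull_schmidt :: "('o, 'm, 'k, 'z) lincat_scheme \<Rightarrow> bool" where
  "krull_schmidt C \<longleftrightarrow> (\<forall>Z \<in> Obj C. \<exists>n X \<iota> \<pi>. finite_direct_sum C n X Z \<iota> \<pi> \<and>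
     (\<forall>i < n. X i \<in> Obj C \<and> local_ring (endo_ring C (X i))))"

definition factors_through :: "('o, 'm, 'z) cat_scheme \<Rightarrow> 'o set \<Rightarrow> 'm \<Rightarrow> bool" where
  "factors_through C U f \<longleftrightarrow>
     (\<exists>W \<in> U. \<exists>a \<in> Hom C (Dom C f) W. \<exists>b \<in> Hom C W (Cod C f). f = b \<cdot>\<^bsub>C\<^esub> a)"

definition quot_rel :: "('o, 'm, 'k, 'z) lincat_scheme \<Rightarrow> 'o set \<Rightarrow> ('m \<times> 'm) set" where
  "quot_rel C U = {(f, g). f \<in> Arr C \<and> g \<in> Hom C (Dom C f) (Cod C f) \<and>
     factors_through C U (f \<ominus>\<^bsub>hom_module C (Dom C f) (Cod C f)\<^esub> g)}"

definition quot_cat :: "('o, 'm, 'k, 'z) lincat_scheme \<Rightarrow> 'o set \<Rightarrow> ('o, 'm set, 'k) lincat" where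
  "quot_cat C U =
     \<lparr>Obj = Obj C,
      Arr = Arr C // quot_rel C U,
      Dom = (\<lambda>c. the_elem (Dom C ` c)),
      Cod = (\<lambda>c. the_elem (Cod C ` c)),
      Idn = (\<lambda>X. quot_rel C U `` {Idn C X}),
      Cmp = (\<lambda>d c. \<Union>g \<in> d. \<Union>f \<in> c. quot_rel C U `` {g \<cdot>\<^bsub>C\<^esub> f}),
      Zero = (\<lambda>X Y. quot_rel C U `` {Zero C X Y}),
      Add = (\<lambda>c d. \<Union>f \<in> c. \<Union>g \<in> d. quot_rel C U `` {Add C f g}),
      Scal = (\<lambda>a c. \<Union>f \<in> c. quot_rel C U `` {Scal C a f})\<rparr>"


section \<open>Exact categories\<close>

definition is_kernel :: "('o, 'm, 'k, 'z) lincat_scheme \<Rightarrow> 'm \<Rightarrow> 'm \<Rightarrow> bool" where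
  "is_kernel C i p \<longleftrightarrow> i \<in> Arr C \<and> p \<in> Arr C \<and> Cod C i = Dom C p \<and>
     p \<cdot>\<^bsub>C\<^esub> i = Zero C (Dom C i) (Cod C p) \<and>
     (\<forall>W \<in> Obj C. \<forall>f \<in> Hom C W (Dom C p). p \<cdot>\<^bsub>C\<^esub> f = Zero C W (Cod C p) \<longrightarrow>
        (\<exists>!g. g \<in> Hom C W (Dom C i) \<and> i \<cdot>\<^bsub>C\<^esub> g = f))"

definition is_cokernel :: "('o, 'm, 'k, 'z) lincat_scheme \<Rightarrow> 'm \<Rightarrow> 'm \<Rightarrow> bool" where
  "is_cokernel C p i \<longleftrightarrow> i \<in> Arr C \<and> p \<in> Arr C \<and> Cod C i = Dom C p \<and>
     p \<cdot>\<^bsub>C\<^esub> i = Zero C (Dom C i) (Cod C p) \<and>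
     (\<forall>W \<in> Obj C. \<forall>f \<in> Hom C (Cod C i) W. f \<cdot>\<^bsub>C\<^esub> i = Zero C (Dom C i) W \<longrightarrow>
        (\<exists>!g. g \<in> Hom C (Cod C p) W \<and> g \<cdot>\<^bsub>C\<^esub> p = f))"

text \<open>In \<open>is_pushout C i f i' f'\<close> the morphism \<open>i'\<close> is opposite to \<open>i\<close> and \<open>f'\<close> is opposite to \<open>f\<close>;
  likewise for pullbacks.\<close>

definition is_pushout :: "('o, 'm, 'z) cat_scheme \<Rightarrow> 'm \<Rightarrow> 'm \<Rightarrow> 'm \<Rightarrow> 'm \<Rightarrow> bool" where
  "is_pushout C i f i' f' \<longleftrightarrow> i \<in> Arr C \<and> f \<in> Arr C \<and> i' \<in> Arr C \<and> f' \<in> Arr C \<and>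
     Dom C i = Dom C f \<and> Dom C i' = Cod C f \<and> Dom C f' = Cod C i \<and> Cod C i' = Cod C f' \<and>
     i' \<cdot>\<^bsub>C\<^esub> f = f' \<cdot>\<^bsub>C\<^esub> i \<and>
     (\<forall>W \<in> Obj C. \<forall>g \<in> Hom C (Cod C f) W. \<forall>h \<in> Hom C (Cod C i) W. g \<cdot>\<^bsub>C\<^esub> f = h \<cdot>\<^bsub>C\<^esub> i \<longrightarrow>
        (\<exists>!u. u \<in> Hom C (Cod C i') W \<and> u \<cdot>\<^bsub>C\<^esub> i' = g \<and> u \<cdot>\<^bsub>C\<^esub> f' = h))"

definition is_pullback :: "('o, 'm, 'z) cat_scheme \<Rightarrow> 'm \<Rightarrow> 'm \<Rightarrow> 'm \<Rightarrow> 'm \<Rightarrow> bool" where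
  "is_pullback C p f p' f' \<longleftrightarrow> p \<in> Arr C \<and> f \<in> Arr C \<and> p' \<in> Arr C \<and> f' \<in> Arr C \<and>
     Cod C p = Cod C f \<and> Cod C p' = Dom C f \<and> Cod C f' = Dom C p \<and> Dom C p' = Dom C f' \<and>
     f \<cdot>\<^bsub>C\<^esub> p' = p \<cdot>\<^bsub>C\<^esub> f' \<and>
     (\<forall>W \<in> Obj C. \<forall>g \<in> Hom C W (Dom C f). \<forall>h \<in> Hom C W (Dom C p). f \<cdot>\<^bsub>C\<^esub> g = p \<cdot>\<^bsub>C\<^esub> h \<longrightarrow>
        (\<exists>!u. u \<in> Hom C W (Dom C p') \<and> p' \<cdot>\<^bsub>C\<^esub> u = g \<and> f' \<cdot>\<^bsub>C\<^esub> u = h))"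

definition ses_iso :: "('o, 'm, 'z) cat_scheme \<Rightarrow> 'm \<times> 'm \<Rightarrow> 'm \<times> 'm \<Rightarrow> bool" where
  "ses_iso C = (\<lambda>(i, p) (i', p').
     i \<in> Arr C \<and> p \<in> Arr C \<and> i' \<in> Arr C \<and> p' \<in> Arr C \<and> Cod C i = Dom C p \<and> Cod C i' = Dom C p' \<and>
     (\<exists>a \<in> Hom C (Dom C i) (Dom C i'). \<exists>b \<in> Hom C (Cod C i) (Cod C i'). \<exists>c \<in> Hom C (Cod C p) (Cod C p').
        is_iso C a \<and> is_iso C b \<and> is_iso C c \<and> b \<cdot>\<^bsub>C\<^esub> i = i' \<cdot>\<^bsub>C\<^esub> a \<and> c \<cdot>\<^bsub>C\<^esub> p = p' \<cdot>\<^bsub>C\<^esub> b))"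

definition ses_sum ::
    "('o, 'm, 'k, 'z) lincat_scheme \<Rightarrow> 'm \<times> 'm \<Rightarrow> 'm \<times> 'm \<Rightarrow> 'm \<times> 'm \<Rightarrow> bool" where
  "ses_sum C = (\<lambda>(i\<^sub>1, p\<^sub>1) (i\<^sub>2, p\<^sub>2) (i, p).
     i\<^sub>1 \<in> Arr C \<and> p\<^sub>1 \<in> Arr C \<and> Cod C i\<^sub>1 = Dom C p\<^sub>1 \<and>
     i\<^sub>2 \<in> Arr C \<and> p\<^sub>2 \<in> Arr C \<and> Cod C i\<^sub>2 = Dom C p\<^sub>2 \<and>
     i \<in> Arr C \<and> p \<in> Arr C \<and> Cod C i = Dom C p \<and>
     (\<exists>a\<^sub>1 a\<^sub>2 r\<^sub>1 r\<^sub>2 b\<^sub>1 b\<^sub>2 s\<^sub>1 s\<^sub>2 c\<^sub>1 c\<^sub>2 t\<^sub>1 t\<^sub>2.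
        biproduct C (Dom C i\<^sub>1) (Dom C i\<^sub>2) (Dom C i) a\<^sub>1 a\<^sub>2 r\<^sub>1 r\<^sub>2 \<and>
        biproduct C (Cod C i\<^sub>1) (Cod C i\<^sub>2) (Cod C i) b\<^sub>1 b\<^sub>2 s\<^sub>1 s\<^sub>2 \<and>
        biproduct C (Cod C p\<^sub>1) (Cod C p\<^sub>2) (Cod C p) c\<^sub>1 c\<^sub>2 t\<^sub>1 t\<^sub>2 \<and>
        i \<cdot>\<^bsub>C\<^esub> a\<^sub>1 = b\<^sub>1 \<cdot>\<^bsub>C\<^esub> i\<^sub>1 \<and> i \<cdot>\<^bsub>C\<^esub> a\<^sub>2 = b\<^sub>2 \<cdot>\<^bsub>C\<^esub> i\<^sub>2 \<and>
        p \<cdot>\<^bsub>C\<^esub> b\<^sub>1 = c\<^sub>1 \<cdot>\<^bsub>C\<^esub> p\<^sub>1 \<and> p \<cdot>\<^bsub>C\<^esub> b\<^sub>2 = c\<^sub>2 \<cdot>\<^bsub>C\<^esub> p\<^sub>2))"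

text \<open>\<open>(i, p) \<in> E\<close> means that \<open>i\<close> followed by \<open>p\<close> is one of the chosen short exact sequences, so
  \<open>Domain E\<close> and \<open>Range E\<close> are the admissible monomorphisms and admissible epimorphisms. Quillen's
  further axiom on admissible morphisms is a consequence of those below. The axioms on direct sums
  and direct summands are also consequences, but are customarily listed.\<close>

locale exact_category = additive_category K C
  for K :: "('k, 'r) ring_scheme" (structure) and C :: "('o, 'm, 'k, 'z) lincat_scheme" (structure) +
  fixes E :: "('m \<times> 'm) set"
  assumes kernel_cokernel: "(i, p) \<in> E \<Longrightarrow> is_kernel C i p \<and> is_cokernel C p i"
    and iso_closed: "\<lbrakk>s \<in> E; ses_iso C s t\<rbrakk> \<Longrightarrow> t \<in> E"
    and sum_closed: "\<lbrakk>s \<in> E; s' \<in> E; ses_sum C s s' t\<rbrakk> \<Longrightarrow> t \<in> E"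
    and summand_closed: "\<lbrakk>t \<in> E; ses_sum C s s' t\<rbrakk> \<Longrightarrow> s \<in> E"
    and split_exact: "biproduct C X Y Z i j p q \<Longrightarrow> (i, q) \<in> E"
    and mono_comp: "\<lbrakk>i \<in> Domain E; j \<in> Domain E; Cod C i = Dom C j\<rbrakk> \<Longrightarrow> j \<cdot>\<^bsub>C\<^esub> i \<in> Domain E"
    and epi_comp: "\<lbrakk>p \<in> Range E; q \<in> Range E; Cod C p = Dom C q\<rbrakk> \<Longrightarrow> q \<cdot>\<^bsub>C\<^esub> p \<in> Range E"
    and mono_pushout: "\<lbrakk>i \<in> Domain E; f \<in> Arr C; Dom C f = Dom C i\<rbrakk>
      \<Longrightarrow> \<exists>i' f'. is_pushout C i f i' f' \<and> i' \<in> Domain E"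
    and epi_pullback: "\<lbrakk>p \<in> Range E; f \<in> Arr C; Cod C f = Cod C p\<rbrakk>
      \<Longrightarrow> \<exists>p' f'. is_pullback C p f p' f' \<and> p' \<in> Range E"

definition ses :: "('o, 'm, 'z) cat_scheme \<Rightarrow> ('m \<times> 'm) set \<Rightarrow> 'o \<Rightarrow> 'o \<Rightarrow> 'o \<Rightarrow> bool" where
  "ses C E X Y Z \<longleftrightarrow> (\<exists>i \<in> Hom C X Y. \<exists>p \<in> Hom C Y Z. (i, p) \<in> E)"

definition projectives :: "('o, 'm, 'z) cat_scheme \<Rightarrow> ('m \<times> 'm) set \<Rightarrow> 'o set" where
  "projectives C E = {P \<in> Obj C. \<forall>p \<in> Range E. \<forall>f \<in> Hom C P (Cod C p).
     \<exists>g \<in> Hom C P (Dom C p). p \<cdot>\<^bsub>C\<^esub> g = f}"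

definition injectives :: "('o, 'm, 'z) cat_scheme \<Rightarrow> ('m \<times> 'm) set \<Rightarrow> 'o set" where
  "injectives C E = {I \<in> Obj C. \<forall>i \<in> Domain E. \<forall>f \<in> Hom C (Dom C i) I.
     \<exists>g \<in> Hom C (Cod C i) I. g \<cdot>\<^bsub>C\<^esub> i = f}"

definition enough_projectives :: "('o, 'm, 'z) cat_scheme \<Rightarrow> ('m \<times> 'm) set \<Rightarrow> bool" where
  "enough_projectives C E \<longleftrightarrow> (\<forall>X \<in> Obj C. \<exists>P \<in> projectives C E. \<exists>p \<in> Hom C P X. p \<in> Range E)"

definition enough_injectives :: "('o, 'm, 'z) cat_scheme \<Rightarrow> ('m \<times> 'm) set \<Rightarrow> bool" where
  "enough_injectives C E \<longleftrightarrow> (\<forall>X \<in> Obj C. \<exists>I \<in> injectives C E. \<exists>i \<in> Hom C X I. i \<in> Domain E)"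

definition extensions :: "('o, 'm, 'z) cat_scheme \<Rightarrow> ('m \<times> 'm) set \<Rightarrow> 'o \<Rightarrow> 'o \<Rightarrow> ('m \<times> 'm) set" where
  "extensions C E U V = {(i, p) \<in> E. Dom C i = V \<and> Cod C p = U}"

definition ext_rel ::
    "('o, 'm, 'z) cat_scheme \<Rightarrow> ('m \<times> 'm) set \<Rightarrow> 'o \<Rightarrow> 'o \<Rightarrow> (('m \<times> 'm) \<times> ('m \<times> 'm)) set" where
  "ext_rel C E U V = {((i, p), (i', p')).
     (i, p) \<in> extensions C E U V \<and> (i', p') \<in> extensions C E U V \<and>
     (\<exists>e \<in> Hom C (Cod C i) (Cod C i'). is_iso C e \<and> e \<cdot>\<^bsub>C\<^esub> i = i' \<and> p' \<cdot>\<^bsub>C\<^esub> e = p)}"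

definition Ext1 :: "('o, 'm, 'z) cat_scheme \<Rightarrow> ('m \<times> 'm) set \<Rightarrow> 'o \<Rightarrow> 'o \<Rightarrow> ('m \<times> 'm) set set" where
  "Ext1 C E U V = extensions C E U V // ext_rel C E U V"

text \<open>The split extensions form a single equivalence class, the zero element of the group \<open>Ext1\<close>.\<close>

definition split_extensions ::
    "('o, 'm, 'k, 'z) lincat_scheme \<Rightarrow> ('m \<times> 'm) set \<Rightarrow> 'o \<Rightarrow> 'o \<Rightarrow> ('m \<times> 'm) set" where
  "split_extensions C E U V =
     {(i, p) \<in> extensions C E U V. \<exists>j q. biproduct C V U (Cod C i) i j q p}"

definition additive_summand_closed :: "('o, 'm, 'k, 'z) lincat_scheme \<Rightarrow> 'o set \<Rightarrow> bool" where
  "additive_summand_closed C U \<longleftrightarrow> U \<subseteq> Obj C \<and> (\<exists>Z \<in> U. zero_object C Z) \<and>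
     (\<forall>X Y Z i j p q. biproduct C X Y Z i j p q \<longrightarrow> (X \<in> U \<and> Y \<in> U \<longleftrightarrow> Z \<in> U))"

definition cotorsion_pair ::
    "('o, 'm, 'k, 'z) lincat_scheme \<Rightarrow> ('m \<times> 'm) set \<Rightarrow> 'o set \<Rightarrow> 'o set \<Rightarrow> bool" where
  "cotorsion_pair C E U V \<longleftrightarrow> additive_summand_closed C U \<and> additive_summand_closed C V \<and>
     (\<forall>X \<in> U. \<forall>Y \<in> V. Ext1 C E X Y = {split_extensions C E X Y}) \<and>
     (\<forall>B \<in> Obj C. (\<exists>V' \<in> V. \<exists>U' \<in> U. ses C E V' U' B) \<and> (\<exists>V' \<in> V. \<exists>U' \<in> U. ses C E B V' U'))"

definition twin_cotorsion_pair ::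
    "('o, 'm, 'k, 'z) lincat_scheme \<Rightarrow> ('m \<times> 'm) set \<Rightarrow> 'o set \<Rightarrow> 'o set \<Rightarrow> 'o set \<Rightarrow> bool" where
  "twin_cotorsion_pair C E S T V \<longleftrightarrow> cotorsion_pair C E S T \<and> cotorsion_pair C E T V \<and> S \<subseteq> T"

definition syzygies :: "('o, 'm, 'z) cat_scheme \<Rightarrow> ('m \<times> 'm) set \<Rightarrow> 'o set \<Rightarrow> 'o set" where
  "syzygies C E S = {X \<in> Obj C. \<exists>P \<in> projectives C E. \<exists>Y \<in> S. ses C E X P Y}"


section \<open>Finitely presented functors\<close>

definition op_lincat :: "('o, 'm, 'k, 'z) lincat_scheme \<Rightarrow> ('o, 'm, 'k, 'z) lincat_scheme" where
  "op_lincat C = C\<lparr>Dom := Cod C, Cod := Dom C, Cmp := (\<lambda>g f. f \<cdot>\<^bsub>C\<^esub> g), Zero := (\<lambda>X Y. Zero C Y X)\<rparr>"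

definition module_maps ::
    "('k, 'r) ring_scheme \<Rightarrow> ('k, 'v) module \<Rightarrow> ('k, 'w) module \<Rightarrow> ('v \<Rightarrow> 'w) set" where
  "module_maps K M N = {h \<in> carrier M \<rightarrow> carrier N.
     (\<forall>x \<in> carrier M. \<forall>y \<in> carrier M. h (x \<oplus>\<^bsub>M\<^esub> y) = h x \<oplus>\<^bsub>N\<^esub> h y) \<and>
     (\<forall>a \<in> carrier K. \<forall>x \<in> carrier M. h (a \<odot>\<^bsub>M\<^esub> x) = a \<odot>\<^bsub>N\<^esub> h x)}"

type_synonym ('k, 'v) module_arr = "('k, 'v) module \<times> ('v \<Rightarrow> 'v) \<times> ('k, 'v) module"

abbreviation arr_map :: "('k, 'v) module_arr \<Rightarrow> 'v \<Rightarrow> 'v" where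
  "arr_map \<phi> \<equiv> fst (snd \<phi>)"

text \<open>The category of modules whose underlying sets lie in the universe \<open>'v\<close>.\<close>

definition module_cat ::
    "'v itself \<Rightarrow> ('k, 'r) ring_scheme \<Rightarrow> (('k, 'v) module, ('k, 'v) module_arr, 'k) lincat" where
  "module_cat _ K =
     \<lparr>Obj = {M. module K M},
      Arr = {(M, h, N). module K M \<and> module K N \<and> h \<in> module_maps K M N \<inter> extensional (carrier M)},
      Dom = (\<lambda>(M, h, N). M),
      Cod = (\<lambda>(M, h, N). N),
      Idn = (\<lambda>M. (M, restrict id (carrier M), M)),
      Cmp = (\<lambda>(N', g, P) (M, h, N). (M, compose (carrier M) g h, P)),
      Zero = (\<lambda>M N. (M, \<lambda>x \<in> carrier M. \<zero>\<^bsub>N\<^esub>, N)),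
      Add = (\<lambda>(M, g, N) (M', h, N'). (M, \<lambda>x \<in> carrier M. g x \<oplus>\<^bsub>N\<^esub> h x, N)),
      Scal = (\<lambda>a (M, h, N). (M, \<lambda>x \<in> carrier M. a \<odot>\<^bsub>N\<^esub> h x, N))\<rparr>"

definition is_additive_functor ::
    "('o, 'm, 'k, 'y) lincat_scheme \<Rightarrow> ('p, 'n, 'l, 'z) lincat_scheme \<Rightarrow> ('o, 'm, 'p, 'n) func \<Rightarrow> bool" where
  "is_additive_functor C D F \<longleftrightarrow> is_functor C D F \<and>
     (\<forall>X \<in> Obj C. \<forall>Y \<in> Obj C. \<forall>f \<in> Hom C X Y. \<forall>g \<in> Hom C X Y.
        FA F (Add C f g) = Add D (FA F f) (FA F g))"

definition additive_functor_cat ::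
    "('o, 'm, 'k, 'y) lincat_scheme \<Rightarrow> ('p, 'n, 'l, 'z) lincat_scheme \<Rightarrow>
     (('o, 'm, 'p, 'n) func, ('o, 'm, 'p, 'n) func \<times> ('o \<Rightarrow> 'n) \<times> ('o, 'm, 'p, 'n) func) cat" where
  "additive_functor_cat C D =
     \<lparr>Obj = {F. is_additive_functor C D F},
      Arr = {(F, \<eta>, G). is_additive_functor C D F \<and> is_additive_functor C D G \<and>
               is_nat_trans C D F G \<eta> \<and> \<eta> \<in> extensional (Obj C)},
      Dom = (\<lambda>(F, \<eta>, G). F),
      Cod = (\<lambda>(F, \<eta>, G). G),
      Idn = (\<lambda>F. (F, \<lambda>X \<in> Obj C. Idn D (FO F X), F)),
      Cmp = (\<lambda>(G', \<theta>, H) (F, \<eta>, G). (F, \<lambda>X \<in> Obj C. \<theta> X \<cdot>\<^bsub>D\<^esub> \<eta> X, H))\<rparr>"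

definition hom_functor ::
    "('o, 'm, 'k, 'z) lincat_scheme \<Rightarrow> 'o \<Rightarrow> ('o, 'm, ('k, 'm) module, ('k, 'm) module_arr) func" where
  "hom_functor C X =
     \<lparr>FO = (\<lambda>Y. hom_module C Y X),
      FA = (\<lambda>f. (hom_module C (Cod C f) X, \<lambda>g \<in> Hom C (Cod C f) X. g \<cdot>\<^bsub>C\<^esub> f, hom_module C (Dom C f) X))\<rparr>"

text \<open>Natural transformations between contravariant module-valued functors whose values may lie in
  different universes, as is the case for \<open>hom_functor C X\<close> and an arbitrary functor.\<close>

definition module_nat_trans ::
    "('k, 'r) ring_scheme \<Rightarrow> ('o, 'm, 'z) cat_scheme \<Rightarrow>
     ('o, 'm, ('k, 'v) module, ('k, 'v) module_arr) func \<Rightarrow>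
     ('o, 'm, ('k, 'w) module, ('k, 'w) module_arr) func \<Rightarrow> ('o \<Rightarrow> 'v \<Rightarrow> 'w) \<Rightarrow> bool" where
  "module_nat_trans K C F G \<eta> \<longleftrightarrow>
     (\<forall>X \<in> Obj C. \<eta> X \<in> module_maps K (FO F X) (FO G X)) \<and>
     (\<forall>f \<in> Arr C. \<forall>x \<in> carrier (FO F (Cod C f)).
        \<eta> (Dom C f) (arr_map (FA F f) x) = arr_map (FA G f) (\<eta> (Cod C f) x))"

definition finitely_presented ::
    "('k, 'r) ring_scheme \<Rightarrow> ('o, 'm, 'k, 'z) lincat_scheme \<Rightarrow>
     ('o, 'm, ('k, 'v) module, ('k, 'v) module_arr) func \<Rightarrow> bool" where
  "finitely_presented K C A \<longleftrightarrow> (\<exists>C\<^sub>0 \<in> Obj C. \<exists>C\<^sub>1 \<in> Obj C. \<exists>\<eta> \<theta>.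
     module_nat_trans K C (hom_functor C C\<^sub>1) (hom_functor C C\<^sub>0) \<eta> \<and>
     module_nat_trans K C (hom_functor C C\<^sub>0) A \<theta> \<and>
     (\<forall>X \<in> Obj C. \<eta> X ` Hom C X C\<^sub>1 = {g \<in> Hom C X C\<^sub>0. \<theta> X g = \<zero>\<^bsub>FO A X\<^esub>} \<and>
        \<theta> X ` Hom C X C\<^sub>0 = carrier (FO A X)))"

text \<open>If \<open>'m\<close> embeds into \<open>'v\<close>, then the values of every finitely presented functor have, up to
  isomorphism, underlying sets in \<open>'v\<close>, being quotients of \<open>Hom\<close> sets.\<close>

definition fp_modules ::
    "'v itself \<Rightarrow> ('k, 'r) ring_scheme \<Rightarrow> ('o, 'm, 'k, 'z) lincat_scheme \<Rightarrow>
     (('o, 'm, ('k, 'v) module, ('k, 'v) module_arr) func,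
      ('o, 'm, ('k, 'v) module, ('k, 'v) module_arr) func \<times> ('o \<Rightarrow> ('k, 'v) module_arr) \<times>
      ('o, 'm, ('k, 'v) module, ('k, 'v) module_arr) func) cat" where
  "fp_modules \<tau> K C = (let D = additive_functor_cat (op_lincat C) (module_cat \<tau> K)
     in full_sub D {A \<in> Obj D. finitely_presented K C A})"

end

theory Submission
  imports Defs
begin

text \<open>Let \<open>Q = B/T\<close> and let \<open>\<Omega>S\<close> stand for a syzygy of an object of \<open>S\<close>. The equivalence is induced by
  the restricted Yoneda functor \<open>H\<close>, which sends \<open>X\<close> to \<open>Hom\<^bsub>Q\<^esub>(-, X)\<close> on syzygies. Five facts carry the
  proof.

  First, for a conflation \<open>\<Omega>S \<rightarrow> P \<rightarrow> S\<close> with \<open>P\<close> projective, a morphism \<open>\<Omega>S \<rightarrow> X\<close> factors through \<open>T\<close> if and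
  only if it extends to \<open>P\<close>, because \<open>Ext\<close> of \<open>S\<close> by \<open>T\<close> vanishes and \<open>P\<close> lies in \<open>T\<close>
  (\<open>factors_iff_extends\<close>). So \<open>H(X)(\<Omega>S)\<close> is \<open>Ext(S, X)\<close>, and between syzygies the morphisms modulo \<open>T\<close> are
  the morphisms modulo projectives.

  Second, choose conflations \<open>X \<rightarrow> M \<rightarrow> S0\<close> and \<open>N \<rightarrow> S1 \<rightarrow> M\<close> with \<open>M\<close>, \<open>N\<close> in \<open>T\<close>. They yield a sequence
  \<open>\<Omega>S1 \<rightarrow> \<Omega>S0 \<rightarrow> X\<close> that \<open>H\<close> turns into a presentation of \<open>H(X)\<close>. The map \<open>\<Omega>S0 \<rightarrow> X\<close> is an epimorphism in
  \<open>Q\<close>: the square on \<open>\<Omega>S0\<close>, \<open>P0\<close>, \<open>X\<close> and \<open>M\<close> is a pushout, so a morphism out of \<open>X\<close> that vanishes in \<open>Q\<close> on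
  \<open>\<Omega>S0\<close> factors through \<open>M\<close> (\<open>presentation_of_object\<close>). Hence \<open>H\<close> takes finitely
  presented values and is faithful.

  Third, the pushout \<open>W\<close> of a morphism \<open>g : \<Omega>S1 \<rightarrow> \<Omega>S0\<close> along \<open>\<Omega>S1 \<rightarrow> P1\<close> is a weak cokernel of \<open>g\<close> in \<open>Q\<close>,
  and \<open>H(W)\<close> is the cokernel of \<open>H(g)\<close> (\<open>weak_cokernel_of_syzygies\<close>). Hence \<open>H\<close> is dense, and by the Yoneda
  lemma every morphism \<open>H(W) \<rightarrow> H(Y)\<close> comes from a morphism \<open>W \<rightarrow> Y\<close>.

  Fourth, \<open>H\<close> inverts the morphisms that are mono and epi in \<open>Q\<close>. Injectivity is clear. If \<open>f : X \<rightarrow> Y\<close> is epi in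
  \<open>Q\<close>, push out \<open>X \<rightarrow> M\<close> along \<open>f\<close>: the resulting \<open>Y \<rightarrow> C\<close> vanishes in \<open>Q\<close>, which forces every morphism from a
  syzygy to \<open>Y\<close> to lift to \<open>X\<close> (\<open>lift_along_quotient_epi\<close>). Conversely, let \<open>W\<close> be built from the
  presentation of \<open>X\<close>. The comparison \<open>w : W \<rightarrow> X\<close> becomes invertible under \<open>H\<close>, and since a
  faithful functor reflects monomorphisms and epimorphisms, \<open>w\<close> is mono and epi in \<open>Q\<close>.

  Fifth, these properties determine the localisation. Every zigzag starting at \<open>X\<close> is equal in the
  localisation to the formal inverse of \<open>w : W \<rightarrow> X\<close> followed by one morphism out of \<open>W\<close>, so that \<open>H\<close> is
  full and faithful on the localisation (\<open>localisation_equivalence\<close>).\<close>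

section \<open>Equivalences from fully faithful, essentially surjective functors\<close>

lemma HomD: "f \<in> Hom C X Y \<Longrightarrow> f \<in> Arr C \<and> Dom C f = X \<and> Cod C f = Y"
  by (simp add: Hom_def)

lemma Arr_Hom: "f \<in> Arr C \<Longrightarrow> f \<in> Hom C (Dom C f) (Cod C f)"
  by (simp add: Hom_def)

context category
begin

lemma Hom_Dom: "f \<in> Hom C X Y \<Longrightarrow> X \<in> Obj C"
  using Dom_in by (auto simp: Hom_def)

lemma Hom_Cod: "f \<in> Hom C X Y \<Longrightarrow> Y \<in> Obj C"
  using Cod_in by (auto simp: Hom_def)

lemma isoE:
  assumes "is_iso C f" "f \<in> Hom C X Y"
  obtains g where "g \<in> Hom C Y X" "g \<cdot> f = Idn C X" "f \<cdot> g = Idn C Y"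
  using assms by (auto simp: is_iso_def Hom_def)

lemma isoI:
  assumes "f \<in> Hom C X Y" "g \<in> Hom C Y X" "g \<cdot> f = Idn C X" "f \<cdot> g = Idn C Y"
  shows "is_iso C f"
  using assms unfolding is_iso_def Hom_def by auto

lemma iso_cancel_left:
  assumes "is_iso C f" "f \<in> Hom C Y Z" "a \<in> Hom C X Y" "b \<in> Hom C X Y" "f \<cdot> a = f \<cdot> b"
  shows "a = b"
proof -
  obtain g where g: "g \<in> Hom C Z Y" "g \<cdot> f = Idn C Y" using isoE[OF assms(1,2)] by metis
  show ?thesis using Cmp_assoc[OF assms(3,2) g(1)] Cmp_assoc[OF assms(4,2) g(1)] assms g Idn_left by metis
qed

lemma iso_cancel_right:
  assumes "is_iso C f" "f \<in> Hom C X Y" "a \<in> Hom C Y Z" "b \<in> Hom C Y Z" "a \<cdot> f = b \<cdot> f"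
  shows "a = b"
proof -
  obtain g where g: "g \<in> Hom C Y X" "f \<cdot> g = Idn C Y" using isoE[OF assms(1,2)] by metis
  show ?thesis using Cmp_assoc[OF g(1) assms(2,3)] Cmp_assoc[OF g(1) assms(2,4)] assms g Idn_right by metis
qed

lemma iso_inverse_iso:
  assumes "f \<in> Hom C X Y" "g \<in> Hom C Y X" "g \<cdot> f = Idn C X" "f \<cdot> g = Idn C Y"
  shows "is_iso C g"
  using assms isoI by blast

end

lemma functor_Obj: "\<lbrakk>is_functor C D F; X \<in> Obj C\<rbrakk> \<Longrightarrow> FO F X \<in> Obj D"
  by (simp add: is_functor_def)

lemma functor_Idn: "\<lbrakk>is_functor C D F; X \<in> Obj C\<rbrakk> \<Longrightarrow> FA F (Idn C X) = Idn D (FO F X)"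
  by (simp add: is_functor_def)

lemma functor_Hom: "\<lbrakk>is_functor C D F; f \<in> Hom C X Y\<rbrakk> \<Longrightarrow> FA F f \<in> Hom D (FO F X) (FO F Y)"
  by (auto simp: is_functor_def Hom_def)

lemma functor_Cmp:
  "\<lbrakk>is_functor C D F; f \<in> Hom C X Y; g \<in> Hom C Y Z\<rbrakk> \<Longrightarrow> FA F (g \<cdot>\<^bsub>C\<^esub> f) = FA F g \<cdot>\<^bsub>D\<^esub> FA F f"
  by (auto simp: is_functor_def Hom_def)

lemma is_functorI:
  assumes "\<And>X. X \<in> Obj C \<Longrightarrow> FO F X \<in> Obj D"
    and "\<And>X. X \<in> Obj C \<Longrightarrow> FA F (Idn C X) = Idn D (FO F X)"
    and "\<And>f X Y. f \<in> Hom C X Y \<Longrightarrow> FA F f \<in> Hom D (FO F X) (FO F Y)"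
    and "\<And>f g X Y Z. \<lbrakk>f \<in> Hom C X Y; g \<in> Hom C Y Z\<rbrakk> \<Longrightarrow> FA F (g \<cdot>\<^bsub>C\<^esub> f) = FA F g \<cdot>\<^bsub>D\<^esub> FA F f"
  shows "is_functor C D F"
  using assms by (auto simp: is_functor_def Hom_def)

text \<open>On objects the quasi-inverse chooses some \<open>X\<close> with an isomorphism \<open>e : F X \<rightarrow> Z\<close>. On an arrow \<open>h\<close> it takes the
  unique preimage of \<open>e\<inverse> h e\<close>, so that \<open>e\<close> is natural by construction, and the preimages of the
  components of \<open>e\<close> at the objects \<open>F X\<close> give the other natural isomorphism.\<close>

lemma equivalence_of_full_faithful_dense:
  assumes C: "category C" and D: "category D" and F: "is_functor C D F"
    and ff: "\<And>X Y. \<lbrakk>X \<in> Obj C; Y \<in> Obj C\<rbrakk> \<Longrightarrow> bij_betw (FA F) (Hom C X Y) (Hom D (FO F X) (FO F Y))"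
    and dense: "\<And>Z. Z \<in> Obj D \<Longrightarrow> \<exists>X \<in> Obj C. \<exists>f \<in> Hom D (FO F X) Z. is_iso D f"
  shows "equivalent_categories C D"
proof -
  interpret C: category C by fact
  interpret D: category D by fact
  have "\<forall>Z \<in> Obj D. \<exists>t. fst t \<in> Obj C \<and> fst (snd t) \<in> Hom D (FO F (fst t)) Z
      \<and> snd (snd t) \<in> Hom D Z (FO F (fst t)) \<and> snd (snd t) \<cdot>\<^bsub>D\<^esub> fst (snd t) = Idn D (FO F (fst t))
      \<and> fst (snd t) \<cdot>\<^bsub>D\<^esub> snd (snd t) = Idn D Z"
  proof
    fix Z assume "Z \<in> Obj D"
    then obtain X f where X: "X \<in> Obj C" and f: "f \<in> Hom D (FO F X) Z" "is_iso D f" using dense by blast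
    obtain g where "g \<in> Hom D Z (FO F X)" "g \<cdot>\<^bsub>D\<^esub> f = Idn D (FO F X)" "f \<cdot>\<^bsub>D\<^esub> g = Idn D Z"
      using D.isoE[OF f(2,1)] .
    then show "\<exists>t. fst t \<in> Obj C \<and> fst (snd t) \<in> Hom D (FO F (fst t)) Z
      \<and> snd (snd t) \<in> Hom D Z (FO F (fst t)) \<and> snd (snd t) \<cdot>\<^bsub>D\<^esub> fst (snd t) = Idn D (FO F (fst t))
      \<and> fst (snd t) \<cdot>\<^bsub>D\<^esub> snd (snd t) = Idn D Z"
      using X f by (intro exI[of _ "(X, f, g)"]) simp
  qed
  from bchoice[OF this] obtain t where t: "\<forall>Z \<in> Obj D. fst (t Z) \<in> Obj C
      \<and> fst (snd (t Z)) \<in> Hom D (FO F (fst (t Z))) Z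
      \<and> snd (snd (t Z)) \<in> Hom D Z (FO F (fst (t Z)))
      \<and> snd (snd (t Z)) \<cdot>\<^bsub>D\<^esub> fst (snd (t Z)) = Idn D (FO F (fst (t Z)))
      \<and> fst (snd (t Z)) \<cdot>\<^bsub>D\<^esub> snd (snd (t Z)) = Idn D Z" ..
  define r e e' where "r Z = fst (t Z)" and "e Z = fst (snd (t Z))" and "e' Z = snd (snd (t Z))" for Z
  have rin: "\<And>Z. Z \<in> Obj D \<Longrightarrow> r Z \<in> Obj C"
    and e: "\<And>Z. Z \<in> Obj D \<Longrightarrow> e Z \<in> Hom D (FO F (r Z)) Z"
    and e': "\<And>Z. Z \<in> Obj D \<Longrightarrow> e' Z \<in> Hom D Z (FO F (r Z))"
    and e'e: "\<And>Z. Z \<in> Obj D \<Longrightarrow> e' Z \<cdot>\<^bsub>D\<^esub> e Z = Idn D (FO F (r Z))"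
    and ee': "\<And>Z. Z \<in> Obj D \<Longrightarrow> e Z \<cdot>\<^bsub>D\<^esub> e' Z = Idn D Z"
    using t by (auto simp: r_def e_def e'_def)
  have e_iso: "is_iso D (e Z)" if "Z \<in> Obj D" for Z
    using D.isoI e e' e'e ee' that by metis
  define pre where "pre X Y = inv_into (Hom C X Y) (FA F)" for X Y
  have pre_in: "pre X Y h \<in> Hom C X Y"
    and F_pre: "FA F (pre X Y h) = h"
    if "X \<in> Obj C" "Y \<in> Obj C" "h \<in> Hom D (FO F X) (FO F Y)" for X Y h
    using bij_betw_inv_into_right[OF ff[OF that(1,2)]] bij_betwE[OF bij_betw_inv_into[OF ff[OF that(1,2)]]] that
    by (auto simp: pre_def)
  have faithful: "f = g" if "f \<in> Hom C X Y" "g \<in> Hom C X Y" "FA F f = FA F g" for f g X Y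
    using ff[of X Y] that C.Hom_Dom C.Hom_Cod by (metis bij_betw_imp_inj_on inj_onD)
  define G where "G = \<lparr>FO = r, FA = (\<lambda>h. pre (r (Dom D h)) (r (Cod D h)) (e' (Cod D h) \<cdot>\<^bsub>D\<^esub> (h \<cdot>\<^bsub>D\<^esub> e (Dom D h))))\<rparr>"
  have mid: "e' Z' \<cdot>\<^bsub>D\<^esub> (h \<cdot>\<^bsub>D\<^esub> e Z) \<in> Hom D (FO F (r Z)) (FO F (r Z'))" if "h \<in> Hom D Z Z'" for h Z Z'
    using that D.Cmp_in e e' D.Hom_Dom D.Hom_Cod by metis
  have GA: "FA G h \<in> Hom C (r Z) (r Z')" "FA F (FA G h) = e' Z' \<cdot>\<^bsub>D\<^esub> (h \<cdot>\<^bsub>D\<^esub> e Z)" if h: "h \<in> Hom D Z Z'" for h Z Z'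
  proof -
    have "FA G h = pre (r Z) (r Z') (e' Z' \<cdot>\<^bsub>D\<^esub> (h \<cdot>\<^bsub>D\<^esub> e Z))"
      using HomD[OF h] by (simp add: G_def)
    then show "FA G h \<in> Hom C (r Z) (r Z')" "FA F (FA G h) = e' Z' \<cdot>\<^bsub>D\<^esub> (h \<cdot>\<^bsub>D\<^esub> e Z)"
      using pre_in[OF _ _ mid[OF h]] F_pre[OF _ _ mid[OF h]] rin D.Hom_Dom[OF h] D.Hom_Cod[OF h] by auto
  qed
  have e_nat: "e Z' \<cdot>\<^bsub>D\<^esub> FA F (FA G h) = h \<cdot>\<^bsub>D\<^esub> e Z" if h: "h \<in> Hom D Z Z'" for h Z Z'
  proof -
    have o: "Z \<in> Obj D" "Z' \<in> Obj D" using D.Hom_Dom[OF h] D.Hom_Cod[OF h] .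
    show ?thesis
      using D.Cmp_assoc[OF D.Cmp_in[OF e[OF o(1)] h] e'[OF o(2)] e[OF o(2)]] GA(2)[OF h] ee'[OF o(2)]
        D.Idn_left[OF D.Cmp_in[OF e[OF o(1)] h]] by simp
  qed
  have G: "is_functor D C G"
  proof (rule is_functorI)
    show "FO G Z \<in> Obj C" if "Z \<in> Obj D" for Z using rin[OF that] by (simp add: G_def)
    show "FA G (Idn D Z) = Idn C (FO G Z)" if Z: "Z \<in> Obj D" for Z
    proof -
      have "FA F (FA G (Idn D Z)) = FA F (Idn C (r Z))"
        using GA(2)[OF D.Idn_in[OF Z]] D.Idn_left[OF e[OF Z]] e'e[OF Z] functor_Idn[OF F rin[OF Z]] by simp
      then show ?thesis
        using faithful[OF GA(1)[OF D.Idn_in[OF Z]] C.Idn_in[OF rin[OF Z]]] by (simp add: G_def)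
    qed
    show "FA G h \<in> Hom C (FO G Z) (FO G Z')" if "h \<in> Hom D Z Z'" for h Z Z'
      using GA(1)[OF that] by (simp add: G_def)
    show "FA G (k \<cdot>\<^bsub>D\<^esub> h) = FA G k \<cdot>\<^bsub>C\<^esub> FA G h" if h: "h \<in> Hom D X Y" and k: "k \<in> Hom D Y Z" for h k X Y Z
    proof (rule faithful)
      show "FA G (k \<cdot>\<^bsub>D\<^esub> h) \<in> Hom C (r X) (r Z)" using GA(1)[OF D.Cmp_in[OF h k]] .
      show "FA G k \<cdot>\<^bsub>C\<^esub> FA G h \<in> Hom C (r X) (r Z)" using C.Cmp_in[OF GA(1)[OF h] GA(1)[OF k]] .
      have o: "X \<in> Obj D" "Y \<in> Obj D" "Z \<in> Obj D"
        using D.Hom_Dom[OF h] D.Hom_Cod[OF h] D.Hom_Cod[OF k] .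
      have Fh: "FA F (FA G h) \<in> Hom D (FO F (r X)) (FO F (r Y))" and Fk: "FA F (FA G k) \<in> Hom D (FO F (r Y)) (FO F (r Z))"
        and Fkh: "FA F (FA G (k \<cdot>\<^bsub>D\<^esub> h)) \<in> Hom D (FO F (r X)) (FO F (r Z))"
        using functor_Hom[OF F] GA(1) h k D.Cmp_in[OF h k] by blast+
      have "e Z \<cdot>\<^bsub>D\<^esub> FA F (FA G (k \<cdot>\<^bsub>D\<^esub> h)) = (k \<cdot>\<^bsub>D\<^esub> h) \<cdot>\<^bsub>D\<^esub> e X"
        using e_nat[OF D.Cmp_in[OF h k]] .
      also have "\<dots> = k \<cdot>\<^bsub>D\<^esub> (e Y \<cdot>\<^bsub>D\<^esub> FA F (FA G h))"
        using e_nat[OF h] D.Cmp_assoc[OF e[OF o(1)] h k] by simp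
      also have "\<dots> = e Z \<cdot>\<^bsub>D\<^esub> (FA F (FA G k) \<cdot>\<^bsub>D\<^esub> FA F (FA G h))"
        using e_nat[OF k] D.Cmp_assoc[OF Fh e[OF o(2)] k] D.Cmp_assoc[OF Fh Fk e[OF o(3)]] by simp
      finally have "FA F (FA G (k \<cdot>\<^bsub>D\<^esub> h)) = FA F (FA G k) \<cdot>\<^bsub>D\<^esub> FA F (FA G h)"
        using D.iso_cancel_left[OF e_iso[OF o(3)] e[OF o(3)] Fkh D.Cmp_in[OF Fh Fk]] by simp
      then show "FA F (FA G (k \<cdot>\<^bsub>D\<^esub> h)) = FA F (FA G k \<cdot>\<^bsub>C\<^esub> FA G h)"
        using functor_Cmp[OF F GA(1)[OF h] GA(1)[OF k]] by simp
    qed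
  qed
  have FG: "nat_isomorphic D D (comp_func F G) id_func"
    unfolding nat_isomorphic_def is_nat_trans_def
  proof (intro exI[of _ e] conjI ballI)
    fix Z assume Z: "Z \<in> Obj D"
    show "e Z \<in> Hom D (FO (comp_func F G) Z) (FO id_func Z)"
      using e[OF Z] by (simp add: comp_func_def id_func_def G_def)
    show "is_iso D (e Z)" using e_iso[OF Z] .
  next
    fix h assume "h \<in> Arr D"
    from e_nat[OF Arr_Hom[OF this]]
    show "e (Cod D h) \<cdot>\<^bsub>D\<^esub> FA (comp_func F G) h = FA id_func h \<cdot>\<^bsub>D\<^esub> e (Dom D h)"
      by (simp add: comp_func_def id_func_def)
  qed
  define n where "n X = pre (r (FO F X)) X (e (FO F X))" for X
  have n: "n X \<in> Hom C (r (FO F X)) X" and Fn: "FA F (n X) = e (FO F X)" if "X \<in> Obj C" for X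
    using pre_in F_pre that e[OF functor_Obj[OF F that]] rin[OF functor_Obj[OF F that]] by (auto simp: n_def)
  have n_iso: "is_iso C (n X)" if X: "X \<in> Obj C" for X
  proof -
    have FX: "FO F X \<in> Obj D" using functor_Obj[OF F X] .
    define m where "m = pre X (r (FO F X)) (e' (FO F X))"
    have m: "m \<in> Hom C X (r (FO F X))" and Fm: "FA F m = e' (FO F X)"
      using pre_in F_pre X e'[OF FX] rin[OF FX] by (auto simp: m_def)
    have "m \<cdot>\<^bsub>C\<^esub> n X = Idn C (r (FO F X))"
      using faithful[OF C.Cmp_in[OF n[OF X] m] C.Idn_in[OF rin[OF FX]]] functor_Cmp[OF F n[OF X] m]
        Fm Fn[OF X] e'e[OF FX] functor_Idn[OF F rin[OF FX]] by simp
    moreover have "n X \<cdot>\<^bsub>C\<^esub> m = Idn C X"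
      using faithful[OF C.Cmp_in[OF m n[OF X]] C.Idn_in[OF X]] functor_Cmp[OF F m n[OF X]]
        Fm Fn[OF X] ee'[OF FX] functor_Idn[OF F X] by simp
    ultimately show ?thesis using C.isoI[OF n[OF X] m] by simp
  qed
  have GF: "nat_isomorphic C C (comp_func G F) id_func"
    unfolding nat_isomorphic_def is_nat_trans_def
  proof (intro exI[of _ n] conjI ballI)
    fix X assume X: "X \<in> Obj C"
    show "n X \<in> Hom C (FO (comp_func G F) X) (FO id_func X)"
      using n[OF X] by (simp add: comp_func_def id_func_def G_def)
    show "is_iso C (n X)" using n_iso[OF X] .
  next
    fix f assume "f \<in> Arr C"
    then obtain X Y where f: "f \<in> Hom C X Y" and XY: "Dom C f = X" "Cod C f = Y"
      using Arr_Hom[of f C] by blast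
    have o: "X \<in> Obj C" "Y \<in> Obj C" using C.Hom_Dom[OF f] C.Hom_Cod[OF f] .
    note Ff = functor_Hom[OF F f]
    have "n Y \<cdot>\<^bsub>C\<^esub> FA G (FA F f) = f \<cdot>\<^bsub>C\<^esub> n X"
    proof (rule faithful[OF C.Cmp_in[OF GA(1)[OF Ff] n[OF o(2)]] C.Cmp_in[OF n[OF o(1)] f]])
      show "FA F (n Y \<cdot>\<^bsub>C\<^esub> FA G (FA F f)) = FA F (f \<cdot>\<^bsub>C\<^esub> n X)"
        using functor_Cmp[OF F GA(1)[OF Ff] n[OF o(2)]] functor_Cmp[OF F n[OF o(1)] f] e_nat[OF Ff] Fn o by simp
    qed
    then show "n (Cod C f) \<cdot>\<^bsub>C\<^esub> FA (comp_func G F) f = FA id_func f \<cdot>\<^bsub>C\<^esub> n (Dom C f)"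
      by (simp add: comp_func_def id_func_def XY)
  qed
  show ?thesis unfolding equivalent_categories_def using C D F G FG GF by blast
qed

section \<open>Localisations\<close>

lemma zz_path_append:
  "\<lbrakk>zz_path C R X v Y; zz_path C R Y w Z\<rbrakk> \<Longrightarrow> zz_path C R X (v @ w) Z"
  by (induction C R X v Y rule: zz_path.induct) auto
definition loc_arr ::
    "('o, 'm, 'z) cat_scheme \<Rightarrow> 'm set \<Rightarrow> 'o \<Rightarrow> 'm step list \<Rightarrow> 'o \<Rightarrow> 'o \<times> 'm step list set \<times> 'o" where
  "loc_arr C R X w Y = (X, zz_rel C R X Y `` {w}, Y)"

text \<open>The image of a zigzag under a functor that inverts \<open>R\<close>. The inverse of \<open>F r\<close> is unique, so the choice
  is only a way to name it.\<close>

fun eval_zigzag ::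
    "('o, 'm, 'y) cat_scheme \<Rightarrow> ('p, 'n, 'z) cat_scheme \<Rightarrow> ('o, 'm, 'p, 'n) func \<Rightarrow> 'o \<Rightarrow> 'm step list \<Rightarrow> 'n" where
  "eval_zigzag C M F X [] = Idn M (FO F X)"
| "eval_zigzag C M F X (Fwd f # w) = eval_zigzag C M F (Cod C f) w \<cdot>\<^bsub>M\<^esub> FA F f"
| "eval_zigzag C M F X (Bwd r # w) = eval_zigzag C M F (Dom C r) w \<cdot>\<^bsub>M\<^esub>
     (SOME g. g \<in> Hom M (FO F (Cod C r)) (FO F (Dom C r)) \<and> g \<cdot>\<^bsub>M\<^esub> FA F r = Idn M (FO F (Dom C r)) \<and>
        FA F r \<cdot>\<^bsub>M\<^esub> g = Idn M (FO F (Cod C r)))"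

context category
begin

lemma zz_path_Obj: "zz_path C R X w Y \<Longrightarrow> X \<in> Obj C \<and> Y \<in> Obj C"
proof (induction w arbitrary: X)
  case (Cons s w)
  then show ?case by (cases s) (use Dom_in Cod_in in auto)
qed auto

lemma zz_path_Fwd: "f \<in> Hom C X Y \<Longrightarrow> zz_path C R X [Fwd f] Y"
  using Cod_in by (auto simp: Hom_def)

lemma zz_path_Bwd: "\<lbrakk>r \<in> R; r \<in> Hom C X Y\<rbrakk> \<Longrightarrow> zz_path C R Y [Bwd r] X"
  using Dom_in by (auto simp: Hom_def)

text \<open>The generating relations hold between zigzags with common endpoints, hence the congruence relates
  paths only.\<close>

lemma zz_eq_path: "zz_eq C R X Y v w \<Longrightarrow> zz_path C R X v Y \<and> zz_path C R X w Y"
proof (induction rule: zz_eq.induct)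
  case (zz_append X Y v w Z v' w')
  then show ?case using zz_path_append[of C R X v Y v' Z] zz_path_append[of C R X w Y w' Z] by simp
next
  case (zz_identity X)
  then show ?case using zz_path_Fwd[OF Idn_in] by simp
next
  case (zz_comp f X Y g Z)
  then show ?case
    using zz_path_append[OF zz_path_Fwd zz_path_Fwd] zz_path_Fwd[OF Cmp_in] by fastforce
next
  case (zz_inv_left r X Y)
  then show ?case using zz_path_append[OF zz_path_Fwd zz_path_Bwd] Hom_Dom by fastforce
next
  case (zz_inv_right r X Y)
  then show ?case using zz_path_append[OF zz_path_Bwd zz_path_Fwd] Hom_Cod by fastforce
qed blast+

lemma equiv_zz_rel: "equiv {w. zz_path C R X w Y} (zz_rel C R X Y)"
proof (rule equivI)
  show "zz_rel C R X Y \<subseteq> {w. zz_path C R X w Y} \<times> {w. zz_path C R X w Y}"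
    using zz_eq_path unfolding zz_rel_def by fast
  show "refl_on {w. zz_path C R X w Y} (zz_rel C R X Y)"
    by (auto simp: refl_on_def zz_rel_def intro: zz_refl)
  show "sym (zz_rel C R X Y)" by (auto simp: sym_def zz_rel_def intro: zz_sym)
  show "trans (zz_rel C R X Y)" by (auto simp: trans_def zz_rel_def intro: zz_trans)
qed

lemma loc_arr_eq_iff:
  assumes "zz_path C R X v Y" "zz_path C R X w Y"
  shows "loc_arr C R X v Y = loc_arr C R X w Y \<longleftrightarrow> zz_eq C R X Y v w"
  using eq_equiv_class_iff[OF equiv_zz_rel, of v R X Y w] assms by (auto simp: loc_arr_def zz_rel_def)

lemma loc_arr_in: "zz_path C R X w Y \<Longrightarrow> loc_arr C R X w Y \<in> Hom (localisation C R) X Y"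
  using zz_path_Obj[of R X w Y]
  by (auto simp: Hom_def localisation_def loc_arr_def intro: quotientI)

lemma loc_arr_cases:
  assumes "c \<in> Hom (localisation C R) X Y"
  obtains w where "zz_path C R X w Y" "c = loc_arr C R X w Y"
proof -
  obtain d where c: "c = (X, d, Y)" and d: "d \<in> {w. zz_path C R X w Y} // zz_rel C R X Y"
    using assms by (auto simp: Hom_def localisation_def)
  from d obtain w where "zz_path C R X w Y" "d = zz_rel C R X Y `` {w}" by (auto elim: quotientE)
  then show thesis using that c by (simp add: loc_arr_def)
qed

lemma loc_Cmp:
  assumes v: "zz_path C R X v Y" and w: "zz_path C R Y w Z"
  shows "loc_arr C R Y w Z \<cdot>\<^bsub>localisation C R\<^esub> loc_arr C R X v Y = loc_arr C R X (v @ w) Z"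
proof -
  have *: "zz_rel C R X Z `` {v' @ w'} = zz_rel C R X Z `` {v @ w}"
    if "v' \<in> zz_rel C R X Y `` {v}" "w' \<in> zz_rel C R Y Z `` {w}" for v' w'
  proof -
    have "zz_eq C R X Z (v @ w) (v' @ w')" using that by (auto simp: zz_rel_def intro: zz_append)
    then show ?thesis using equiv_class_eq[OF equiv_zz_rel, of "v @ w" "v' @ w'"] by (simp add: zz_rel_def)
  qed
  have mem: "v \<in> zz_rel C R X Y `` {v}" "w \<in> zz_rel C R Y Z `` {w}"
    using v w by (auto simp: zz_rel_def intro: zz_refl)
  have "(\<Union>v' \<in> zz_rel C R X Y `` {v}. \<Union>w' \<in> zz_rel C R Y Z `` {w}. zz_rel C R X Z `` {v' @ w'})
      = zz_rel C R X Z `` {v @ w}" (is "?A = ?B")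
  proof
    show "?A \<subseteq> ?B" using * by blast
    show "?B \<subseteq> ?A" using mem by blast
  qed
  then show ?thesis by (simp add: localisation_def loc_arr_def)
qed

lemma loc_Obj: "Obj (localisation C R) = Obj C"
  by (simp add: localisation_def)

lemma loc_Idn: "Idn (localisation C R) X = loc_arr C R X [] X"
  by (simp add: localisation_def loc_arr_def)

lemma category_localisation: "category (localisation C R)"
proof
  fix f assume "f \<in> Arr (localisation C R)"
  then show "Dom (localisation C R) f \<in> Obj (localisation C R)"
    "Cod (localisation C R) f \<in> Obj (localisation C R)"
    by (auto simp: localisation_def)
next
  fix X assume "X \<in> Obj (localisation C R)"
  then show "Idn (localisation C R) X \<in> Hom (localisation C R) X X"
    using loc_arr_in[of R X "[]" X] by (simp add: loc_Obj loc_Idn)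
next
  fix f g X Y Z assume f: "f \<in> Hom (localisation C R) X Y" and g: "g \<in> Hom (localisation C R) Y Z"
  obtain v where v: "zz_path C R X v Y" "f = loc_arr C R X v Y" using loc_arr_cases[OF f] .
  obtain w where w: "zz_path C R Y w Z" "g = loc_arr C R Y w Z" using loc_arr_cases[OF g] .
  show "g \<cdot>\<^bsub>localisation C R\<^esub> f \<in> Hom (localisation C R) X Z"
    using v w loc_Cmp[OF v(1) w(1)] loc_arr_in[OF zz_path_append[OF v(1) w(1)]] by simp
next
  fix f g h W X Y Z assume f: "f \<in> Hom (localisation C R) W X" and g: "g \<in> Hom (localisation C R) X Y"
    and h: "h \<in> Hom (localisation C R) Y Z"
  obtain u where u: "zz_path C R W u X" "f = loc_arr C R W u X" using loc_arr_cases[OF f] .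
  obtain v where v: "zz_path C R X v Y" "g = loc_arr C R X v Y" using loc_arr_cases[OF g] .
  obtain w where w: "zz_path C R Y w Z" "h = loc_arr C R Y w Z" using loc_arr_cases[OF h] .
  show "h \<cdot>\<^bsub>localisation C R\<^esub> (g \<cdot>\<^bsub>localisation C R\<^esub> f) = (h \<cdot>\<^bsub>localisation C R\<^esub> g) \<cdot>\<^bsub>localisation C R\<^esub> f"
    using u v w by (simp add: loc_Cmp zz_path_append)
next
  fix f X Y assume f: "f \<in> Hom (localisation C R) X Y"
  obtain v where v: "zz_path C R X v Y" "f = loc_arr C R X v Y" using loc_arr_cases[OF f] .
  have o: "zz_path C R X [] X" "zz_path C R Y [] Y" using zz_path_Obj[OF v(1)] by auto
  show "Idn (localisation C R) Y \<cdot>\<^bsub>localisation C R\<^esub> f = f"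
    using loc_Cmp[OF v(1) o(2)] v by (simp add: loc_Idn)
  show "f \<cdot>\<^bsub>localisation C R\<^esub> Idn (localisation C R) X = f"
    using loc_Cmp[OF o(1) v(1)] v by (simp add: loc_Idn)
qed

end

text \<open>The universal property of the localisation, as far as existence: a functor that sends \<open>R\<close> to
  isomorphisms extends to the localisation.\<close>

locale inverting_functor = C: category C + M: category M
  for C :: "('o, 'm, 'y) cat_scheme" and M :: "('p, 'n, 'z) cat_scheme" +
  fixes R :: "'m set" and F :: "('o, 'm, 'p, 'n) func"
  assumes F: "is_functor C M F"
    and inverts: "\<lbrakk>r \<in> R; r \<in> Arr C\<rbrakk> \<Longrightarrow> is_iso M (FA F r)"
begin

abbreviation "ev \<equiv> eval_zigzag C M F"

definition image_inverse :: "'m \<Rightarrow> 'n" where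
  "image_inverse r = (SOME g. g \<in> Hom M (FO F (Cod C r)) (FO F (Dom C r)) \<and>
     g \<cdot>\<^bsub>M\<^esub> FA F r = Idn M (FO F (Dom C r)) \<and> FA F r \<cdot>\<^bsub>M\<^esub> g = Idn M (FO F (Cod C r)))"

lemma ev_Bwd: "ev X (Bwd r # w) = ev (Dom C r) w \<cdot>\<^bsub>M\<^esub> image_inverse r"
  by (simp add: image_inverse_def)

lemma image_inverse:
  assumes "r \<in> R" "r \<in> Hom C X Y"
  shows "image_inverse r \<in> Hom M (FO F Y) (FO F X)"
    and "image_inverse r \<cdot>\<^bsub>M\<^esub> FA F r = Idn M (FO F X)"
    and "FA F r \<cdot>\<^bsub>M\<^esub> image_inverse r = Idn M (FO F Y)"
proof -
  have r: "r \<in> Arr C" "Dom C r = X" "Cod C r = Y" using assms(2) by (auto simp: Hom_def)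
  obtain g where "g \<in> Hom M (FO F Y) (FO F X)" "g \<cdot>\<^bsub>M\<^esub> FA F r = Idn M (FO F X)"
    "FA F r \<cdot>\<^bsub>M\<^esub> g = Idn M (FO F Y)"
    using M.isoE[OF inverts[OF assms(1) r(1)] functor_Hom[OF F assms(2)]] .
  then have "\<exists>g. g \<in> Hom M (FO F (Cod C r)) (FO F (Dom C r)) \<and>
     g \<cdot>\<^bsub>M\<^esub> FA F r = Idn M (FO F (Dom C r)) \<and> FA F r \<cdot>\<^bsub>M\<^esub> g = Idn M (FO F (Cod C r))"
    using r by blast
  from someI_ex[OF this] show "image_inverse r \<in> Hom M (FO F Y) (FO F X)"
    "image_inverse r \<cdot>\<^bsub>M\<^esub> FA F r = Idn M (FO F X)" "FA F r \<cdot>\<^bsub>M\<^esub> image_inverse r = Idn M (FO F Y)"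
    using r by (auto simp: image_inverse_def)
qed

lemma ev_Hom: "zz_path C R X w Y \<Longrightarrow> ev X w \<in> Hom M (FO F X) (FO F Y)"
proof (induction w arbitrary: X)
  case Nil
  then show ?case using M.Idn_in[OF functor_Obj[OF F]] by auto
next
  case (Cons s w)
  show ?case
  proof (cases s)
    case (Fwd f)
    then have "f \<in> Hom C X (Cod C f)" "zz_path C R (Cod C f) w Y" using Cons.prems by (auto simp: Hom_def)
    then show ?thesis using M.Cmp_in[OF functor_Hom[OF F] Cons.IH] Fwd by simp
  next
    case (Bwd r)
    then have "r \<in> R" "r \<in> Hom C (Dom C r) X" "zz_path C R (Dom C r) w Y"
      using Cons.prems by (auto simp: Hom_def)
    then show ?thesis using M.Cmp_in[OF image_inverse(1) Cons.IH] Bwd by (simp add: image_inverse_def)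
  qed
qed

lemma ev_append:
  "\<lbrakk>zz_path C R X v Y; zz_path C R Y w Z\<rbrakk> \<Longrightarrow> ev X (v @ w) = ev Y w \<cdot>\<^bsub>M\<^esub> ev X v"
proof (induction v arbitrary: X)
  case Nil
  then show ?case using M.Idn_right[OF ev_Hom[OF Nil(2)]] by auto
next
  case (Cons s v)
  show ?case
  proof (cases s)
    case (Fwd f)
    then have f: "f \<in> Hom C X (Cod C f)" and v: "zz_path C R (Cod C f) v Y"
      using Cons.prems by (auto simp: Hom_def)
    show ?thesis
      using M.Cmp_assoc[OF functor_Hom[OF F f] ev_Hom[OF v] ev_Hom[OF Cons.prems(2)]]
        Cons.IH[OF v Cons.prems(2)] Fwd by simp
  next
    case (Bwd r)
    then have r: "r \<in> R" "r \<in> Hom C (Dom C r) X" and v: "zz_path C R (Dom C r) v Y"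
      using Cons.prems by (auto simp: Hom_def)
    show ?thesis
      using M.Cmp_assoc[OF image_inverse(1)[OF r] ev_Hom[OF v] ev_Hom[OF Cons.prems(2)]]
        Cons.IH[OF v Cons.prems(2)] Bwd by (simp add: ev_Bwd del: eval_zigzag.simps(3))
  qed
qed

lemma ev_Fwd_single: "f \<in> Hom C X Y \<Longrightarrow> ev X [Fwd f] = FA F f"
  using M.Idn_left[OF functor_Hom[OF F]] by (auto simp: Hom_def)

lemma ev_Bwd_single: "\<lbrakk>r \<in> R; r \<in> Hom C X Y\<rbrakk> \<Longrightarrow> ev Y [Bwd r] = image_inverse r"
  using M.Idn_left[OF image_inverse(1)] by (auto simp: Hom_def ev_Bwd simp del: eval_zigzag.simps(3))

text \<open>Each generating relation becomes an identity in \<open>M\<close>: functoriality of \<open>F\<close>, or the defining equations of the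
  inverse of \<open>F r\<close>.\<close>

lemma ev_cong: "zz_eq C R X Y v w \<Longrightarrow> ev X v = ev X w"
proof (induction rule: zz_eq.induct)
  case (zz_append X Y v w Z v' w')
  then show ?case using ev_append C.zz_eq_path by metis
next
  case (zz_identity X)
  then show ?case using ev_Fwd_single[OF C.Idn_in] functor_Idn[OF F] by simp
next
  case (zz_comp f X Y g Z)
  then show ?case
    using ev_append[OF C.zz_path_Fwd C.zz_path_Fwd, of f X Y g Z] ev_Fwd_single[of f] ev_Fwd_single[of g]
      ev_Fwd_single[OF C.Cmp_in] functor_Cmp[OF F]
    by simp
next
  case (zz_inv_left r X Y)
  then show ?case
    using ev_append[OF C.zz_path_Fwd C.zz_path_Bwd, of r X Y r X] ev_Fwd_single[of r] ev_Bwd_single[of r]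
      image_inverse(2)
    by simp
next
  case (zz_inv_right r X Y)
  then show ?case
    using ev_append[OF C.zz_path_Bwd C.zz_path_Fwd, of r X Y r Y] ev_Fwd_single[of r] ev_Bwd_single[of r]
      image_inverse(3)
    by simp
qed auto

definition induced :: "('o, 'o \<times> 'm step list set \<times> 'o, 'p, 'n) func" where
  "induced = \<lparr>FO = FO F, FA = (\<lambda>(X, c, Y). ev X (SOME w. w \<in> c))\<rparr>"

lemma induced_loc_arr:
  assumes "zz_path C R X w Y"
  shows "FA induced (loc_arr C R X w Y) = ev X w"
proof -
  have "w \<in> zz_rel C R X Y `` {w}" using assms by (auto simp: zz_rel_def intro: zz_refl)
  then have "(SOME w'. w' \<in> zz_rel C R X Y `` {w}) \<in> zz_rel C R X Y `` {w}" by (rule someI)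
  then have "zz_eq C R X Y w (SOME w'. w' \<in> zz_rel C R X Y `` {w})" by (simp add: zz_rel_def)
  then show ?thesis using ev_cong by (simp add: induced_def loc_arr_def)
qed

lemma induced_functor: "is_functor (localisation C R) M induced"
proof (rule is_functorI)
  fix X assume "X \<in> Obj (localisation C R)"
  then have X: "X \<in> Obj C" by (simp add: C.loc_Obj)
  then show "FO induced X \<in> Obj M" using functor_Obj[OF F] by (simp add: induced_def)
  show "FA induced (Idn (localisation C R) X) = Idn M (FO induced X)"
    using induced_loc_arr[of X "[]" X] X by (simp add: C.loc_Idn induced_def)
next
  fix f X Y assume f: "f \<in> Hom (localisation C R) X Y"
  obtain v where v: "zz_path C R X v Y" "f = loc_arr C R X v Y" using C.loc_arr_cases[OF f] .
  show "FA induced f \<in> Hom M (FO induced X) (FO induced Y)"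
    using ev_Hom[OF v(1)] induced_loc_arr[OF v(1)] v(2) by (simp add: induced_def)
next
  fix f g X Y Z assume f: "f \<in> Hom (localisation C R) X Y" and g: "g \<in> Hom (localisation C R) Y Z"
  obtain v where v: "zz_path C R X v Y" "f = loc_arr C R X v Y" using C.loc_arr_cases[OF f] .
  obtain w where w: "zz_path C R Y w Z" "g = loc_arr C R Y w Z" using C.loc_arr_cases[OF g] .
  show "FA induced (g \<cdot>\<^bsub>localisation C R\<^esub> f) = FA induced g \<cdot>\<^bsub>M\<^esub> FA induced f"
    using v w C.loc_Cmp[OF v(1) w(1)] induced_loc_arr[OF zz_path_append[OF v(1) w(1)]]
      induced_loc_arr[OF v(1)] induced_loc_arr[OF w(1)] ev_append[OF v(1) w(1)] by simp
qed

text \<open>Call \<open>w : W \<rightarrow> X\<close> in \<open>R\<close> a cover if \<open>F\<close> is full on morphisms out of \<open>W\<close>. Given a cover, every zigzag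
  from \<open>X\<close> equals the backward step \<open>w\<close> followed by a single forward step \<open>g\<close>. This is proved by
  appending steps on the right. A forward step composes with \<open>g\<close>. For a backward step \<open>r\<close>, fullness yields \<open>g'\<close>
  with \<open>F g' = (F r)\<inverse> (F g)\<close>, faithfulness gives \<open>r g' = g\<close>, and the pair \<open>g\<close>, \<open>r\<inverse>\<close> is replaced by
  \<open>g'\<close>. On such normal forms the induced functor is visibly bijective.\<close>

theorem localisation_equivalence:
  assumes faithful: "\<And>X Y f g. \<lbrakk>f \<in> Hom C X Y; g \<in> Hom C X Y; FA F f = FA F g\<rbrakk> \<Longrightarrow> f = g"
    and cover: "\<And>X. X \<in> Obj C \<Longrightarrow> \<exists>W. \<exists>w \<in> Hom C W X. w \<in> R \<and>
      (\<forall>Y \<in> Obj C. \<forall>h \<in> Hom M (FO F W) (FO F Y). \<exists>g \<in> Hom C W Y. FA F g = h)"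
    and dense: "\<And>Z. Z \<in> Obj M \<Longrightarrow> \<exists>X \<in> Obj C. \<exists>f \<in> Hom M (FO F X) Z. is_iso M f"
  shows "equivalent_categories (localisation C R) M"
proof (rule equivalence_of_full_faithful_dense[OF C.category_localisation M.category_axioms induced_functor])
  show "\<exists>X \<in> Obj (localisation C R). \<exists>f \<in> Hom M (FO induced X) Z. is_iso M f" if "Z \<in> Obj M" for Z
    using dense[OF that] by (simp add: C.loc_Obj induced_def)
next
  fix X Y assume "X \<in> Obj (localisation C R)" "Y \<in> Obj (localisation C R)"
  then have XY: "X \<in> Obj C" "Y \<in> Obj C" by (simp_all add: C.loc_Obj)
  from cover[OF XY(1)] obtain W w where w: "w \<in> Hom C W X" "w \<in> R"
    and full: "\<And>Y h. \<lbrakk>Y \<in> Obj C; h \<in> Hom M (FO F W) (FO F Y)\<rbrakk> \<Longrightarrow> \<exists>g \<in> Hom C W Y. FA F g = h" by blast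
  note Bw = C.zz_path_Bwd[OF w(2,1)]
  note i = image_inverse[OF w(2,1)]
  have Fw: "FA F w \<in> Hom M (FO F W) (FO F X)" using functor_Hom[OF F w(1)] .
  have path: "zz_path C R X [Bwd w, Fwd g] Y" if "g \<in> Hom C W Y" for g Y
    using zz_path_append[OF Bw C.zz_path_Fwd[OF that]] by (simp only: append.simps)
  have ev_path: "ev X [Bwd w, Fwd g] = FA F g \<cdot>\<^bsub>M\<^esub> image_inverse w" if "g \<in> Hom C W Y" for g Y
    using ev_append[OF Bw C.zz_path_Fwd[OF that]] ev_Fwd_single[OF that] ev_Bwd_single[OF w(2,1)] by simp
  have normal: "\<exists>g \<in> Hom C W Y. zz_eq C R X Y v [Bwd w, Fwd g]" if "zz_path C R X v Y" for v Y
    using that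
  proof (induction v arbitrary: Y rule: rev_induct)
    case Nil
    then have "X = Y" by simp
    \<comment> \<open>The empty zigzag at \<open>X\<close> has the normal form \<open>w w\<inverse>\<close>.\<close>
    moreover have "zz_eq C R X X [] [Bwd w, Fwd w]" by (rule zz_sym[OF zz_inv_right[OF w(2,1)]])
    ultimately show ?case using w(1) by blast
  next
    case (snoc s v)
    obtain Z where v: "zz_path C R X v Z" and s: "zz_path C R Z [s] Y"
    proof -
      have "\<exists>Z. zz_path C R X v Z \<and> zz_path C R Z [s] Y" if "zz_path C R X (v @ [s]) Y" for X
        using that
      proof (induction v arbitrary: X)
        case Nil
        then have "zz_path C R X [] X" using C.zz_path_Obj by auto
        then show ?case using Nil by auto
      next
        case (Cons t v)
        show ?case
        proof (cases t)
          case (Fwd f)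
          then show ?thesis using Cons.IH[of "Cod C f"] Cons.prems by auto
        next
          case (Bwd f)
          then show ?thesis using Cons.IH[of "Dom C f"] Cons.prems by auto
        qed
      qed
      then show thesis using snoc.prems that by blast
    qed
    obtain g where g: "g \<in> Hom C W Z" and vg: "zz_eq C R X Z v [Bwd w, Fwd g]" using snoc.IH[OF v] by blast
    have step: "zz_eq C R X Y (v @ [s]) [Bwd w, Fwd g, s]"
      using zz_append[OF vg zz_refl[OF s]] by simp
    show ?case
    proof (cases s)
      case (Fwd f)
      then have f: "f \<in> Hom C Z Y" using s by (auto simp: Hom_def)
      have "zz_eq C R X Y [Bwd w, Fwd g, s] [Bwd w, Fwd (f \<cdot>\<^bsub>C\<^esub> g)]"
        using zz_append[OF zz_refl[OF Bw] zz_comp[OF g f]] Fwd by simp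
      then show ?thesis using zz_trans[OF step] C.Cmp_in[OF g f] by blast
    next
      case (Bwd r)
      then have r: "r \<in> R" "r \<in> Hom C Y Z" using s by (auto simp: Hom_def)
      have Fg: "FA F g \<in> Hom M (FO F W) (FO F Z)" using functor_Hom[OF F g] .
      obtain g' where g': "g' \<in> Hom C W Y" "FA F g' = image_inverse r \<cdot>\<^bsub>M\<^esub> FA F g"
        using full[OF C.Hom_Dom[OF r(2)] M.Cmp_in[OF Fg image_inverse(1)[OF r]]] by blast
      have "FA F (r \<cdot>\<^bsub>C\<^esub> g') = FA F g"
        using functor_Cmp[OF F g'(1) r(2)] g'(2) image_inverse(3)[OF r] M.Idn_left[OF Fg]
          M.Cmp_assoc[OF Fg image_inverse(1)[OF r] functor_Hom[OF F r(2)]] by simp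
      then have rg: "r \<cdot>\<^bsub>C\<^esub> g' = g" using faithful[OF C.Cmp_in[OF g'(1) r(2)] g] by simp
      have a: "zz_eq C R W Z [Fwd g', Fwd r] [Fwd g]" using zz_comp[OF g'(1) r(2), of R] rg by simp
      have b: "zz_eq C R W Y [Fwd g', Fwd r, Bwd r] [Fwd g, Bwd r]"
        using zz_append[OF a zz_refl[OF C.zz_path_Bwd[OF r]]] by simp
      have c: "zz_eq C R W Y [Fwd g', Fwd r, Bwd r] [Fwd g']"
        using zz_append[OF zz_refl[OF C.zz_path_Fwd[OF g'(1)]] zz_inv_left[OF r]] by simp
      have "zz_eq C R X Y [Bwd w, Fwd g, s] [Bwd w, Fwd g']"
        using zz_append[OF zz_refl[OF Bw] zz_trans[OF zz_sym[OF b] c]] Bwd by simp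
      then show ?thesis using zz_trans[OF step] g'(1) by blast
    qed
  qed
  show "bij_betw (FA induced) (Hom (localisation C R) X Y) (Hom M (FO induced X) (FO induced Y))"
    unfolding bij_betw_def
  proof
    show "inj_on (FA induced) (Hom (localisation C R) X Y)"
    proof (rule inj_onI)
      fix c d assume c: "c \<in> Hom (localisation C R) X Y" and d: "d \<in> Hom (localisation C R) X Y"
        and eq: "FA induced c = FA induced d"
      obtain u where u: "zz_path C R X u Y" "c = loc_arr C R X u Y" using C.loc_arr_cases[OF c] .
      obtain v where v: "zz_path C R X v Y" "d = loc_arr C R X v Y" using C.loc_arr_cases[OF d] .
      obtain f where f: "f \<in> Hom C W Y" "zz_eq C R X Y u [Bwd w, Fwd f]" using normal[OF u(1)] by blast
      obtain g where g: "g \<in> Hom C W Y" "zz_eq C R X Y v [Bwd w, Fwd g]" using normal[OF v(1)] by blast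
      have "ev X u = ev X v" using eq u v induced_loc_arr[OF u(1)] induced_loc_arr[OF v(1)] by simp
      then have "ev X [Bwd w, Fwd f] = ev X [Bwd w, Fwd g]" using ev_cong[OF f(2)] ev_cong[OF g(2)] by simp
      then have "FA F f \<cdot>\<^bsub>M\<^esub> image_inverse w = FA F g \<cdot>\<^bsub>M\<^esub> image_inverse w" using ev_path f(1) g(1) by metis
      then have "FA F f = FA F g"
        using M.iso_cancel_right[OF M.iso_inverse_iso[OF Fw i] i(1) functor_Hom[OF F f(1)] functor_Hom[OF F g(1)]]
        by simp
      then have "f = g" using faithful[OF f(1) g(1)] by simp
      then have "zz_eq C R X Y u [Bwd w, Fwd g]" using f(2) by simp
      then have "zz_eq C R X Y u v" by (rule zz_trans[OF _ zz_sym[OF g(2)]])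
      then show "c = d" using C.loc_arr_eq_iff[OF u(1) v(1)] u(2) v(2) by simp
    qed
    show "FA induced ` Hom (localisation C R) X Y = Hom M (FO induced X) (FO induced Y)"
    proof
      show "FA induced ` Hom (localisation C R) X Y \<subseteq> Hom M (FO induced X) (FO induced Y)"
        using functor_Hom[OF induced_functor] by blast
      show "Hom M (FO induced X) (FO induced Y) \<subseteq> FA induced ` Hom (localisation C R) X Y"
      proof
        fix h assume "h \<in> Hom M (FO induced X) (FO induced Y)"
        then have h: "h \<in> Hom M (FO F X) (FO F Y)" by (simp add: induced_def)
        obtain g where g: "g \<in> Hom C W Y" "FA F g = h \<cdot>\<^bsub>M\<^esub> FA F w"
          using full[OF XY(2) M.Cmp_in[OF Fw h]] by blast
        have "FA induced (loc_arr C R X [Bwd w, Fwd g] Y) = h"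
          using induced_loc_arr[OF path[OF g(1)]] ev_path[OF g(1)] g(2) i(3) M.Cmp_assoc[OF i(1) Fw h]
            M.Idn_right[OF h] by simp
        then show "h \<in> FA induced ` Hom (localisation C R) X Y"
          using C.loc_arr_in[OF path[OF g(1)]] by blast
      qed
    qed
  qed
qed

end

section \<open>Linear categories and their quotients\<close>

text \<open>The module laws are equations and pass to the image. This supplies the module structures both on quotients of
  \<open>Hom\<close> modules and on copies of them inside another universe.\<close>

lemma module_of_image:
  assumes M: "module K M" and onto: "\<phi> ` carrier M = carrier N"
    and add: "\<And>x y. \<lbrakk>x \<in> carrier M; y \<in> carrier M\<rbrakk> \<Longrightarrow> \<phi> (x \<oplus>\<^bsub>M\<^esub> y) = \<phi> x \<oplus>\<^bsub>N\<^esub> \<phi> y"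
    and zero: "\<phi> \<zero>\<^bsub>M\<^esub> = \<zero>\<^bsub>N\<^esub>"
    and smult: "\<And>a x. \<lbrakk>a \<in> carrier K; x \<in> carrier M\<rbrakk> \<Longrightarrow> \<phi> (a \<odot>\<^bsub>M\<^esub> x) = a \<odot>\<^bsub>N\<^esub> \<phi> x"
  shows "module K N"
proof -
  interpret M: module K M by fact
  have ex: "\<exists>x \<in> carrier M. y = \<phi> x" if "y \<in> carrier N" for y using that onto by blast
  show ?thesis
  proof (rule moduleI)
    show "cring K" by (rule M.R.cring_axioms)
    show "abelian_group N"
    proof (rule abelian_groupI)
      fix x y assume "x \<in> carrier N" "y \<in> carrier N"
      then obtain a b where ab: "a \<in> carrier M" "b \<in> carrier M" "x = \<phi> a" "y = \<phi> b" using ex by meson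
      then show "x \<oplus>\<^bsub>N\<^esub> y \<in> carrier N" using onto by (auto simp: add[symmetric])
      show "x \<oplus>\<^bsub>N\<^esub> y = y \<oplus>\<^bsub>N\<^esub> x" using ab by (simp add: add[symmetric] M.a_comm)
    next
      show "\<zero>\<^bsub>N\<^esub> \<in> carrier N" using onto M.zero_closed by (auto simp: zero[symmetric])
    next
      fix x y z assume "x \<in> carrier N" "y \<in> carrier N" "z \<in> carrier N"
      then obtain a b c where "a \<in> carrier M" "b \<in> carrier M" "c \<in> carrier M" "x = \<phi> a" "y = \<phi> b" "z = \<phi> c"
        using ex by meson
      then show "(x \<oplus>\<^bsub>N\<^esub> y) \<oplus>\<^bsub>N\<^esub> z = x \<oplus>\<^bsub>N\<^esub> (y \<oplus>\<^bsub>N\<^esub> z)" by (simp add: add[symmetric] M.a_assoc)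
    next
      fix x assume "x \<in> carrier N"
      then obtain a where a: "a \<in> carrier M" "x = \<phi> a" using ex by meson
      then show "\<zero>\<^bsub>N\<^esub> \<oplus>\<^bsub>N\<^esub> x = x" by (simp add: add[symmetric] zero[symmetric])
      have "\<phi> (\<ominus>\<^bsub>M\<^esub> a) \<oplus>\<^bsub>N\<^esub> x = \<zero>\<^bsub>N\<^esub>" using a by (simp add: add[symmetric] zero[symmetric] M.l_neg)
      then show "\<exists>y \<in> carrier N. y \<oplus>\<^bsub>N\<^esub> x = \<zero>\<^bsub>N\<^esub>" using a M.a_inv_closed onto by blast
    qed
  next
    fix k x assume k: "k \<in> carrier K" and "x \<in> carrier N"
    then obtain a where "a \<in> carrier M" "x = \<phi> a" using ex by meson
    then show "k \<odot>\<^bsub>N\<^esub> x \<in> carrier N" using k onto M.smult_closed by (auto simp: smult[symmetric])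
  next
    fix k l x assume kl: "k \<in> carrier K" "l \<in> carrier K" and "x \<in> carrier N"
    then obtain a where a: "a \<in> carrier M" "x = \<phi> a" using ex by meson
    show "(k \<oplus>\<^bsub>K\<^esub> l) \<odot>\<^bsub>N\<^esub> x = k \<odot>\<^bsub>N\<^esub> x \<oplus>\<^bsub>N\<^esub> l \<odot>\<^bsub>N\<^esub> x"
      using a kl by (simp add: smult[symmetric] add[symmetric] M.smult_l_distr)
    show "(k \<otimes>\<^bsub>K\<^esub> l) \<odot>\<^bsub>N\<^esub> x = k \<odot>\<^bsub>N\<^esub> (l \<odot>\<^bsub>N\<^esub> x)"
      using a kl by (simp add: smult[symmetric] M.smult_assoc1)
  next
    fix k x y assume k: "k \<in> carrier K" and "x \<in> carrier N" "y \<in> carrier N"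
    then obtain a b where "a \<in> carrier M" "b \<in> carrier M" "x = \<phi> a" "y = \<phi> b" using ex by meson
    then show "k \<odot>\<^bsub>N\<^esub> (x \<oplus>\<^bsub>N\<^esub> y) = k \<odot>\<^bsub>N\<^esub> x \<oplus>\<^bsub>N\<^esub> k \<odot>\<^bsub>N\<^esub> y"
      using k by (simp add: smult[symmetric] add[symmetric] M.smult_r_distr)
  next
    fix x assume "x \<in> carrier N"
    then obtain a where "a \<in> carrier M" "x = \<phi> a" using ex by meson
    then show "\<one>\<^bsub>K\<^esub> \<odot>\<^bsub>N\<^esub> x = x" by (simp add: smult[symmetric])
  qed
qed

context linear_category
begin

abbreviation compose_arrows (infixr \<open>\<bullet>\<close> 75) where "g \<bullet> f \<equiv> Cmp C g f"

lemma Zero_in: "\<lbrakk>X \<in> Obj C; Y \<in> Obj C\<rbrakk> \<Longrightarrow> Zero C X Y \<in> Hom C X Y"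
proof -
  assume "X \<in> Obj C" "Y \<in> Obj C"
  then interpret M: module K "hom_module C X Y" by (rule hom_module)
  show ?thesis using M.zero_closed by (simp add: hom_module_def)
qed

lemma hom_module_at: "f \<in> Hom C X Y \<Longrightarrow> module K (hom_module C X Y)"
  using hom_module Hom_Dom Hom_Cod by blast

lemma Add_in: assumes "f \<in> Hom C X Y" "g \<in> Hom C X Y" shows "Add C f g \<in> Hom C X Y"
proof -
  interpret M: module K "hom_module C X Y" using hom_module_at[OF assms(1)] .
  show ?thesis using M.a_closed[of f g] assms by (simp add: hom_module_def)
qed

lemma Scal_in: assumes "a \<in> carrier K" "f \<in> Hom C X Y" shows "Scal C a f \<in> Hom C X Y"
proof -
  interpret M: module K "hom_module C X Y" using hom_module_at[OF assms(2)] .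
  show ?thesis using M.smult_closed[of a f] assms by (simp add: hom_module_def)
qed

lemma Add_assoc:
  assumes "f \<in> Hom C X Y" "g \<in> Hom C X Y" "h \<in> Hom C X Y"
  shows "Add C (Add C f g) h = Add C f (Add C g h)"
proof -
  interpret M: module K "hom_module C X Y" using hom_module_at[OF assms(1)] .
  show ?thesis using M.a_assoc[of f g h] assms by (simp add: hom_module_def)
qed

lemma Add_comm: assumes "f \<in> Hom C X Y" "g \<in> Hom C X Y" shows "Add C f g = Add C g f"
proof -
  interpret M: module K "hom_module C X Y" using hom_module_at[OF assms(1)] .
  show ?thesis using M.a_comm[of f g] assms by (simp add: hom_module_def)
qed

lemma Add_Zero_left: assumes "f \<in> Hom C X Y" shows "Add C (Zero C X Y) f = f"
proof -
  interpret M: module K "hom_module C X Y" using hom_module_at[OF assms(1)] .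
  show ?thesis using M.l_zero[of f] assms by (simp add: hom_module_def)
qed

lemma Add_Zero_right: assumes "f \<in> Hom C X Y" shows "Add C f (Zero C X Y) = f"
  using Add_Zero_left[OF assms] Add_comm[OF assms Zero_in] Hom_Dom[OF assms] Hom_Cod[OF assms] by simp

lemma neg_ex: assumes "f \<in> Hom C X Y" shows "\<exists>g \<in> Hom C X Y. Add C f g = Zero C X Y"
proof -
  interpret M: module K "hom_module C X Y" using hom_module_at[OF assms(1)] .
  show ?thesis using M.r_neg[of f] M.a_inv_closed[of f] assms by (auto simp: hom_module_def)
qed

lemma Add_cancel:
  assumes "f \<in> Hom C X Y" "g \<in> Hom C X Y" "h \<in> Hom C X Y" "Add C f g = Add C f h"
  shows "g = h"
proof -
  interpret M: module K "hom_module C X Y" using hom_module_at[OF assms(1)] .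
  show ?thesis using M.r_neg1[of f g] M.r_neg1[of f h] assms by (simp add: hom_module_def)
qed

text \<open>Calculations in \<open>Hom\<close> groups go through this statement: a relation \<open>f - g = h\<close> is recorded as \<open>f = g + h\<close>, which
  avoids signs.\<close>

lemma diff_ex:
  assumes "f \<in> Hom C X Y" "g \<in> Hom C X Y"
  shows "\<exists>h \<in> Hom C X Y. f = Add C g h"
proof -
  obtain n where n: "n \<in> Hom C X Y" "Add C g n = Zero C X Y" using neg_ex[OF assms(2)] by blast
  have "Add C g (Add C n f) = f" using Add_assoc[OF assms(2) n(1) assms(1)] n(2) Add_Zero_left[OF assms(1)] by simp
  then show ?thesis using Add_in[OF n(1) assms(1)] by force
qed

lemma Add_eq_self: assumes "f \<in> Hom C X Y" "h \<in> Hom C X Y" "Add C f h = f" shows "h = Zero C X Y"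
  using Add_cancel[OF assms(1,2) Zero_in[OF Hom_Dom[OF assms(1)] Hom_Cod[OF assms(1)]]]
    Add_Zero_right[OF assms(1)] assms(3) by simp

lemma Cmp_Zero_left:
  assumes "f \<in> Hom C X Y" "Z \<in> Obj C" shows "Zero C Y Z \<bullet> f = Zero C X Z"
proof -
  have z: "Zero C Y Z \<in> Hom C Y Z" using Zero_in[OF Hom_Cod[OF assms(1)] assms(2)] .
  show ?thesis
    using Add_eq_self[OF Cmp_in[OF assms(1) z] Cmp_in[OF assms(1) z]] Cmp_Add_left[OF assms(1) z z]
      Add_Zero_left[OF z] by simp
qed

lemma Cmp_Zero_right:
  assumes "f \<in> Hom C X Y" "W \<in> Obj C" shows "f \<bullet> Zero C W X = Zero C W Y"
proof -
  have z: "Zero C W X \<in> Hom C W X" using Zero_in[OF assms(2) Hom_Dom[OF assms(1)]] .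
  show ?thesis
    using Add_eq_self[OF Cmp_in[OF z assms(1)] Cmp_in[OF z assms(1)]] Cmp_Add_right[OF z z assms(1)]
      Add_Zero_left[OF z] by simp
qed

lemma Scal_Add: assumes "a \<in> carrier K" "f \<in> Hom C X Y" "g \<in> Hom C X Y"
  shows "Scal C a (Add C f g) = Add C (Scal C a f) (Scal C a g)"
proof -
  interpret M: module K "hom_module C X Y" using hom_module_at[OF assms(2)] .
  show ?thesis using M.smult_r_distr[of a f g] assms by (simp add: hom_module_def)
qed

lemma hom_module_minus_iff:
  assumes "f \<in> Hom C X Y" "g \<in> Hom C X Y" "n \<in> Hom C X Y"
  shows "f \<ominus>\<^bsub>hom_module C X Y\<^esub> g = n \<longleftrightarrow> f = Add C g n"
proof -
  interpret M: module K "hom_module C X Y" using hom_module_at[OF assms(1)] .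
  have c: "f \<in> carrier (hom_module C X Y)" "g \<in> carrier (hom_module C X Y)" "n \<in> carrier (hom_module C X Y)"
    using assms by (simp_all add: hom_module_def)
  have add: "Add C g n = g \<oplus>\<^bsub>hom_module C X Y\<^esub> n" by (simp add: hom_module_def)
  show ?thesis unfolding add
  proof
    assume "f \<ominus>\<^bsub>hom_module C X Y\<^esub> g = n"
    then show "f = g \<oplus>\<^bsub>hom_module C X Y\<^esub> n"
      using c by (auto simp: a_minus_def M.a_ac M.r_neg)
  next
    assume "f = g \<oplus>\<^bsub>hom_module C X Y\<^esub> n"
    then show "f \<ominus>\<^bsub>hom_module C X Y\<^esub> g = n"
      using c M.a_inv_closed[OF c(2)] by (simp add: a_minus_def M.a_assoc M.a_lcomm[of g n] M.r_neg)
  qed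
qed

lemma hom_module_minus_in:
  assumes "f \<in> Hom C X Y" "g \<in> Hom C X Y"
  shows "f \<ominus>\<^bsub>hom_module C X Y\<^esub> g \<in> Hom C X Y"
proof -
  interpret M: module K "hom_module C X Y" using hom_module_at[OF assms(1)] .
  show ?thesis using M.minus_closed[of f g] assms by (simp add: hom_module_def)
qed

text \<open>The relation \<open>quot_rel\<close> with its subtraction replaced by an additive remainder.\<close>

definition equal_mod where
  "equal_mod U f g \<longleftrightarrow> f \<in> Arr C \<and> g \<in> Hom C (Dom C f) (Cod C f) \<and>
     (\<exists>n \<in> Hom C (Dom C f) (Cod C f). factors_through C U n \<and> f = Add C g n)"

lemma quot_rel_iff: "(f, g) \<in> quot_rel C U \<longleftrightarrow> equal_mod U f g"
proof -
  have "factors_through C U (f \<ominus>\<^bsub>hom_module C (Dom C f) (Cod C f)\<^esub> g) \<longleftrightarrow>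
      (\<exists>n \<in> Hom C (Dom C f) (Cod C f). factors_through C U n \<and> f = Add C g n)"
    if "f \<in> Arr C" "g \<in> Hom C (Dom C f) (Cod C f)"
  proof -
    have f: "f \<in> Hom C (Dom C f) (Cod C f)" using that(1) by (rule Arr_Hom)
    show ?thesis
      using hom_module_minus_iff[OF f that(2)] hom_module_minus_in[OF f that(2)] by metis
  qed
  then show ?thesis unfolding quot_rel_def equal_mod_def by blast
qed

lemma equal_mod_Hom:
  assumes "f \<in> Hom C X Y" "g \<in> Hom C X Y"
  shows "equal_mod U f g \<longleftrightarrow> (\<exists>n \<in> Hom C X Y. factors_through C U n \<and> f = Add C g n)"
  using assms by (auto simp: equal_mod_def Hom_def)

lemma factors_through_Hom:
  "f \<in> Hom C X Y \<Longrightarrow> factors_through C U f \<longleftrightarrow> (\<exists>W \<in> U. \<exists>a \<in> Hom C X W. \<exists>b \<in> Hom C W Y. f = b \<bullet> a)"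
  by (auto simp: factors_through_def Hom_def)

lemma factors_Cmp_left:
  assumes "factors_through C U f" "f \<in> Hom C X Y" "g \<in> Hom C Y Z"
  shows "factors_through C U (g \<bullet> f)"
proof -
  obtain W a b where W: "W \<in> U" "a \<in> Hom C X W" "b \<in> Hom C W Y" "f = b \<bullet> a"
    using assms factors_through_Hom by blast
  then have "g \<bullet> f = (g \<bullet> b) \<bullet> a" using Cmp_assoc[OF W(2,3) assms(3)] by simp
  then show ?thesis
    using factors_through_Hom[OF Cmp_in[OF assms(2,3)]] W Cmp_in[OF W(3) assms(3)] by blast
qed

lemma factors_Cmp_right:
  assumes "factors_through C U f" "f \<in> Hom C X Y" "e \<in> Hom C W X"
  shows "factors_through C U (f \<bullet> e)"
proof -
  obtain V a b where V: "V \<in> U" "a \<in> Hom C X V" "b \<in> Hom C V Y" "f = b \<bullet> a"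
    using assms factors_through_Hom by blast
  then have "f \<bullet> e = b \<bullet> (a \<bullet> e)" using Cmp_assoc[OF assms(3) V(2,3)] by simp
  then show ?thesis
    using factors_through_Hom[OF Cmp_in[OF assms(3,2)]] V Cmp_in[OF assms(3) V(2)] by blast
qed

lemma factors_neg:
  assumes "factors_through C U f" "f \<in> Hom C X Y"
  shows "\<exists>g \<in> Hom C X Y. factors_through C U g \<and> Add C f g = Zero C X Y"
proof -
  obtain V a b where V: "V \<in> U" "a \<in> Hom C X V" "b \<in> Hom C V Y" "f = b \<bullet> a"
    using assms factors_through_Hom by blast
  obtain b' where b': "b' \<in> Hom C V Y" "Add C b b' = Zero C V Y" using neg_ex[OF V(3)] by blast
  have "Add C f (b' \<bullet> a) = Zero C X Y"
    using Cmp_Add_left[OF V(2,3) b'(1)] b'(2) V(4) Cmp_Zero_left[OF V(2) Hom_Cod[OF assms(2)]] by simp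
  then show ?thesis using Cmp_in[OF V(2) b'(1)] factors_through_Hom[OF Cmp_in[OF V(2) b'(1)]] V b' by blast
qed

lemma factors_Scal:
  assumes "factors_through C U f" "f \<in> Hom C X Y" "k \<in> carrier K"
  shows "factors_through C U (Scal C k f)"
proof -
  obtain V a b where V: "V \<in> U" "a \<in> Hom C X V" "b \<in> Hom C V Y" "f = b \<bullet> a"
    using assms factors_through_Hom by blast
  have "Scal C k f = Scal C k b \<bullet> a" using Cmp_Scal_left[OF assms(3) V(2,3)] V(4) by simp
  then show ?thesis using factors_through_Hom[OF Scal_in[OF assms(3,2)]] V Scal_in[OF assms(3) V(3)] by blast
qed

end

text \<open>Closure under sums makes the morphisms that factor through \<open>U\<close> an ideal; closure under composition and
  scalars is automatic.\<close>

locale linear_quotient = linear_category K C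
  for K :: "('k, 'r) ring_scheme" (structure) and C :: "('o, 'm, 'k, 'z) lincat_scheme" (structure) +
  fixes U :: "'o set"
  assumes factors_Zero: "\<lbrakk>X \<in> Obj C; Y \<in> Obj C\<rbrakk> \<Longrightarrow> factors_through C U (Zero C X Y)"
    and factors_Add: "\<lbrakk>f \<in> Hom C X Y; g \<in> Hom C X Y; factors_through C U f; factors_through C U g\<rbrakk>
      \<Longrightarrow> factors_through C U (Add C f g)"
begin

abbreviation "Q \<equiv> quot_cat C U"
abbreviation eqm (infix \<open>\<simeq>\<close> 50) where "f \<simeq> g \<equiv> equal_mod U f g"

definition cls :: "'m \<Rightarrow> 'm set" where
  "cls f = quot_rel C U `` {f}"

lemma eqmI:
  assumes "f \<in> Hom C X Y" "g \<in> Hom C X Y" "n \<in> Hom C X Y" "factors_through C U n" "f = Add C g n"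
  shows "f \<simeq> g"
  using equal_mod_Hom[OF assms(1,2)] assms(3-5) by blast

lemma eqmE:
  assumes "f \<simeq> g" "f \<in> Hom C X Y"
  obtains n where "g \<in> Hom C X Y" "n \<in> Hom C X Y" "factors_through C U n" "f = Add C g n"
  using assms by (auto simp: equal_mod_def Hom_def)

lemma eqm_refl: assumes "f \<in> Hom C X Y" shows "f \<simeq> f"
proof -
  have o: "X \<in> Obj C" "Y \<in> Obj C" using Hom_Dom[OF assms] Hom_Cod[OF assms] .
  show ?thesis using eqmI[OF assms assms Zero_in[OF o] factors_Zero[OF o]] Add_Zero_right[OF assms] by simp
qed

lemma eqm_sym: assumes "f \<simeq> g" shows "g \<simeq> f"
proof -
  have "f \<in> Arr C" using assms by (simp add: equal_mod_def)
  then have f: "f \<in> Hom C (Dom C f) (Cod C f)" by (rule Arr_Hom)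
  obtain n where g: "g \<in> Hom C (Dom C f) (Cod C f)" and n: "n \<in> Hom C (Dom C f) (Cod C f)" "factors_through C U n"
    "f = Add C g n" using eqmE[OF assms f] .
  obtain n' where n': "n' \<in> Hom C (Dom C f) (Cod C f)" "factors_through C U n'"
    "Add C n n' = Zero C (Dom C f) (Cod C f)" using factors_neg[OF n(2,1)] by blast
  have "Add C f n' = Add C g (Add C n n')" using Add_assoc[OF g n(1) n'(1)] n(3) by simp
  also have "\<dots> = g" using n'(3) Add_Zero_right[OF g] by simp
  finally show ?thesis using eqmI[OF g f n'(1,2)] by simp
qed

lemma eqm_trans: assumes "f \<simeq> g" "g \<simeq> h" shows "f \<simeq> h"
proof -
  have "f \<in> Arr C" using assms by (simp add: equal_mod_def)
  then have f: "f \<in> Hom C (Dom C f) (Cod C f)" by (rule Arr_Hom)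
  obtain n where g: "g \<in> Hom C (Dom C f) (Cod C f)" and n: "n \<in> Hom C (Dom C f) (Cod C f)" "factors_through C U n"
    "f = Add C g n" using eqmE[OF assms(1) f] .
  obtain n' where h: "h \<in> Hom C (Dom C f) (Cod C f)" and n': "n' \<in> Hom C (Dom C f) (Cod C f)" "factors_through C U n'"
    "g = Add C h n'" using eqmE[OF assms(2) g] .
  show ?thesis
    using eqmI[OF f h Add_in[OF n'(1) n(1)] factors_Add[OF n'(1) n(1) n'(2) n(2)]]
      Add_assoc[OF h n'(1) n(1)] n(3) n'(3) by simp
qed

lemma eqm_Cmp:
  assumes "f \<simeq> f'" "g \<simeq> g'" "f \<in> Hom C X Y" "g \<in> Hom C Y Z"
  shows "g \<bullet> f \<simeq> g' \<bullet> f'"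
proof -
  obtain n where f': "f' \<in> Hom C X Y" and n: "n \<in> Hom C X Y" "factors_through C U n" "f = Add C f' n"
    using eqmE[OF assms(1,3)] .
  obtain p where g': "g' \<in> Hom C Y Z" and p: "p \<in> Hom C Y Z" "factors_through C U p" "g = Add C g' p"
    using eqmE[OF assms(2,4)] .
  have 1: "g \<bullet> f \<simeq> g \<bullet> f'"
    using eqmI[OF Cmp_in[OF assms(3,4)] Cmp_in[OF f' assms(4)] Cmp_in[OF n(1) assms(4)]
      factors_Cmp_left[OF n(2,1) assms(4)]] Cmp_Add_right[OF f' n(1) assms(4)] n(3) by simp
  have 2: "g \<bullet> f' \<simeq> g' \<bullet> f'"
    using eqmI[OF Cmp_in[OF f' assms(4)] Cmp_in[OF f' g'] Cmp_in[OF f' p(1)]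
      factors_Cmp_right[OF p(2,1) f']] Cmp_Add_left[OF f' g' p(1)] p(3) by simp
  show ?thesis using eqm_trans[OF 1 2] .
qed

lemma eqm_Add:
  assumes "f \<simeq> f'" "g \<simeq> g'" "f \<in> Hom C X Y" "g \<in> Hom C X Y"
  shows "Add C f g \<simeq> Add C f' g'"
proof -
  obtain n where f': "f' \<in> Hom C X Y" and n: "n \<in> Hom C X Y" "factors_through C U n" "f = Add C f' n"
    using eqmE[OF assms(1,3)] .
  obtain p where g': "g' \<in> Hom C X Y" and p: "p \<in> Hom C X Y" "factors_through C U p" "g = Add C g' p"
    using eqmE[OF assms(2,4)] .
  have 1: "Add C f g \<simeq> Add C f g'"
    using eqmI[OF Add_in[OF assms(3,4)] Add_in[OF assms(3) g'] p(1,2)] Add_assoc[OF assms(3) g' p(1)] p(3) by simp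
  have 2: "Add C g' f \<simeq> Add C g' f'"
    using eqmI[OF Add_in[OF g' assms(3)] Add_in[OF g' f'] n(1,2)] Add_assoc[OF g' f' n(1)] n(3) by simp
  show ?thesis using eqm_trans[OF 1] 2 Add_comm[OF assms(3) g'] Add_comm[OF f' g'] by simp
qed

lemma eqm_Scal:
  assumes "f \<simeq> f'" "k \<in> carrier K" "f \<in> Hom C X Y"
  shows "Scal C k f \<simeq> Scal C k f'"
proof -
  obtain n where f': "f' \<in> Hom C X Y" and n: "n \<in> Hom C X Y" "factors_through C U n" "f = Add C f' n"
    using eqmE[OF assms(1,3)] .
  show ?thesis
    using eqmI[OF Scal_in[OF assms(2,3)] Scal_in[OF assms(2) f'] Scal_in[OF assms(2) n(1)]
      factors_Scal[OF n(2,1) assms(2)]] Scal_Add[OF assms(2) f' n(1)] n(3) by simp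
qed

lemma eqm_Zero_iff: assumes "f \<in> Hom C X Y" shows "f \<simeq> Zero C X Y \<longleftrightarrow> factors_through C U f"
proof -
  have z: "Zero C X Y \<in> Hom C X Y" using Zero_in[OF Hom_Dom[OF assms] Hom_Cod[OF assms]] .
  show ?thesis using equal_mod_Hom[OF assms z] Add_Zero_left assms by auto
qed

lemma equiv_quot_rel: "equiv (Arr C) (quot_rel C U)"
proof (rule equivI)
  show "quot_rel C U \<subseteq> Arr C \<times> Arr C" by (auto simp: quot_rel_def Hom_def)
  show "refl_on (Arr C) (quot_rel C U)"
    using eqm_refl Arr_Hom by (force simp: refl_on_def quot_rel_iff)
  show "sym (quot_rel C U)" using eqm_sym by (auto simp: sym_def quot_rel_iff)
  show "trans (quot_rel C U)" using eqm_trans by (auto simp: trans_def quot_rel_iff)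
qed

lemma mem_cls: "g \<in> cls f \<longleftrightarrow> f \<simeq> g"
  by (simp add: cls_def quot_rel_iff)

lemma cls_eq_iff:
  assumes "f \<in> Arr C" "g \<in> Arr C" shows "cls f = cls g \<longleftrightarrow> f \<simeq> g"
  unfolding cls_def using eq_equiv_class_iff[OF equiv_quot_rel assms] by (simp add: quot_rel_iff)

lemma cls_eqI: "f \<simeq> g \<Longrightarrow> cls f = cls g"
  using cls_eq_iff[of f g] by (auto simp: equal_mod_def Hom_def)

lemma cls_eq_Hom:
  "\<lbrakk>f \<in> Hom C X Y; g \<in> Hom C X Y\<rbrakk> \<Longrightarrow> cls f = cls g \<longleftrightarrow> f \<simeq> g"
  using cls_eq_iff by (auto simp: Hom_def)

lemma image_cls:
  assumes "f \<in> Hom C X Y"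
  shows "Dom C ` cls f = {X}" "Cod C ` cls f = {Y}"
proof -
  have "f \<in> cls f" using mem_cls eqm_refl[OF assms] by simp
  moreover have "Dom C g = X" "Cod C g = Y" if "g \<in> cls f" for g
    using that assms unfolding mem_cls equal_mod_def Hom_def by auto
  ultimately show "Dom C ` cls f = {X}" "Cod C ` cls f = {Y}" using assms by (auto simp: Hom_def)
qed

lemma cls_in: assumes "f \<in> Hom C X Y" shows "cls f \<in> Hom Q X Y"
  using image_cls[OF assms] assms quotientI[of f "Arr C" "quot_rel C U"]
  by (auto simp: Hom_def quot_cat_def cls_def)

lemma cls_cases:
  assumes "c \<in> Hom Q X Y"
  obtains f where "f \<in> Hom C X Y" "c = cls f"
proof -
  have c: "c \<in> Arr C // quot_rel C U" "the_elem (Dom C ` c) = X" "the_elem (Cod C ` c) = Y"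
    using assms by (auto simp: Hom_def quot_cat_def)
  obtain f where f: "f \<in> Arr C" "c = cls f" using c(1) by (auto simp: cls_def elim: quotientE)
  have "f \<in> Hom C X Y" using image_cls[OF Arr_Hom[OF f(1)]] c f by (auto simp: Hom_def)
  then show thesis using that f by blast
qed

lemma quot_Obj: "Obj Q = Obj C"
  and quot_Idn: "Idn Q X = cls (Idn C X)"
  and quot_Zero: "Zero Q X Y = cls (Zero C X Y)"
  by (simp_all add: quot_cat_def cls_def)

lemma Union_cls2:
  assumes "f \<simeq> f" "g \<simeq> g" "\<And>f' g'. f \<simeq> f' \<Longrightarrow> g \<simeq> g' \<Longrightarrow> h f g \<simeq> h f' g'"
  shows "(\<Union>f' \<in> cls f. \<Union>g' \<in> cls g. cls (h f' g')) = cls (h f g)"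
proof -
  have "cls (h f' g') = cls (h f g)" if "f' \<in> cls f" "g' \<in> cls g" for f' g'
    using assms(3) that cls_eqI mem_cls by metis
  moreover have "f \<in> cls f" "g \<in> cls g" using assms by (simp_all add: mem_cls)
  ultimately show ?thesis by blast
qed

lemma quot_Cmp:
  assumes "f \<in> Hom C X Y" "g \<in> Hom C Y Z"
  shows "cls g \<cdot>\<^bsub>Q\<^esub> cls f = cls (g \<bullet> f)"
  using Union_cls2[of g f "\<lambda>g f. g \<bullet> f"] eqm_refl assms eqm_Cmp[OF _ _ assms]
  by (simp add: quot_cat_def cls_def[symmetric])

lemma quot_Add:
  assumes "f \<in> Hom C X Y" "g \<in> Hom C X Y"
  shows "Add Q (cls f) (cls g) = cls (Add C f g)"
  using Union_cls2[of f g "Add C"] eqm_refl assms eqm_Add[OF _ _ assms]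
  by (simp add: quot_cat_def cls_def[symmetric])

lemma quot_Scal:
  assumes "k \<in> carrier K" "f \<in> Hom C X Y"
  shows "Scal Q k (cls f) = cls (Scal C k f)"
proof -
  have "cls (Scal C k f') = cls (Scal C k f)" if "f' \<in> cls f" for f'
    using eqm_Scal[OF _ assms] cls_eqI that mem_cls by metis
  moreover have "f \<in> cls f" using eqm_refl[OF assms(2)] by (simp add: mem_cls)
  ultimately have "(\<Union>f' \<in> cls f. cls (Scal C k f')) = cls (Scal C k f)" by blast
  then show ?thesis by (simp add: quot_cat_def cls_def)
qed

lemma module_quot_hom:
  assumes "X \<in> Obj C" "Y \<in> Obj C" shows "module K (hom_module Q X Y)"
proof (rule module_of_image[OF hom_module[OF assms], where \<phi> = cls])
  have "cls ` Hom C X Y = Hom Q X Y"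
    using cls_in by (auto elim!: cls_cases)
  then show "cls ` carrier (hom_module C X Y) = carrier (hom_module Q X Y)" by (simp add: hom_module_def)
qed (simp_all add: hom_module_def quot_Zero quot_Add[of _ X Y] quot_Scal[of _ _ X Y])

lemma category_quot: "category Q"
proof
  fix c assume "c \<in> Arr Q"
  then have c: "c \<in> Hom Q (Dom Q c) (Cod Q c)" by (rule Arr_Hom)
  obtain f where f: "f \<in> Hom C (Dom Q c) (Cod Q c)" "c = cls f" using cls_cases[OF c] .
  show "Dom Q c \<in> Obj Q" "Cod Q c \<in> Obj Q" using Hom_Dom[OF f(1)] Hom_Cod[OF f(1)] by (simp_all add: quot_Obj)
next
  fix X assume "X \<in> Obj Q"
  then show "Idn Q X \<in> Hom Q X X" using cls_in[OF Idn_in] by (simp add: quot_Obj quot_Idn)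
next
  fix c d X Y Z assume c: "c \<in> Hom Q X Y" and d: "d \<in> Hom Q Y Z"
  obtain f where f: "f \<in> Hom C X Y" "c = cls f" using cls_cases[OF c] .
  obtain g where g: "g \<in> Hom C Y Z" "d = cls g" using cls_cases[OF d] .
  show "d \<cdot>\<^bsub>Q\<^esub> c \<in> Hom Q X Z" using quot_Cmp[OF f(1) g(1)] cls_in[OF Cmp_in[OF f(1) g(1)]] f g by simp
next
  fix c d e W X Y Z assume c: "c \<in> Hom Q W X" and d: "d \<in> Hom Q X Y" and e: "e \<in> Hom Q Y Z"
  obtain f where f: "f \<in> Hom C W X" "c = cls f" using cls_cases[OF c] .
  obtain g where g: "g \<in> Hom C X Y" "d = cls g" using cls_cases[OF d] .
  obtain h where h: "h \<in> Hom C Y Z" "e = cls h" using cls_cases[OF e] .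
  show "e \<cdot>\<^bsub>Q\<^esub> (d \<cdot>\<^bsub>Q\<^esub> c) = (e \<cdot>\<^bsub>Q\<^esub> d) \<cdot>\<^bsub>Q\<^esub> c"
    using quot_Cmp[OF f(1) g(1)] quot_Cmp[OF g(1) h(1)] quot_Cmp[OF Cmp_in[OF f(1) g(1)] h(1)]
      quot_Cmp[OF f(1) Cmp_in[OF g(1) h(1)]] Cmp_assoc[OF f(1) g(1) h(1)] f g h by simp
next
  fix c X Y assume c: "c \<in> Hom Q X Y"
  obtain f where f: "f \<in> Hom C X Y" "c = cls f" using cls_cases[OF c] .
  show "Idn Q Y \<cdot>\<^bsub>Q\<^esub> c = c"
    using quot_Cmp[OF f(1) Idn_in[OF Hom_Cod[OF f(1)]]] Idn_left[OF f(1)] f by (simp add: quot_Idn)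
  show "c \<cdot>\<^bsub>Q\<^esub> Idn Q X = c"
    using quot_Cmp[OF Idn_in[OF Hom_Dom[OF f(1)]] f(1)] Idn_right[OF f(1)] f by (simp add: quot_Idn)
qed

lemma linear_category_quot: "linear_category K Q"
proof (intro linear_category.intro linear_category_axioms.intro category_quot)
  show "field K" by (rule K.field_axioms)
  show "module K (hom_module Q X Y)" if "X \<in> Obj Q" "Y \<in> Obj Q" for X Y
    using module_quot_hom that by (simp add: quot_Obj)
next
  fix c d e X Y Z assume c: "c \<in> Hom Q X Y" and d: "d \<in> Hom Q Y Z" and e: "e \<in> Hom Q Y Z"
  obtain f where f: "f \<in> Hom C X Y" "c = cls f" using cls_cases[OF c] .
  obtain g where g: "g \<in> Hom C Y Z" "d = cls g" using cls_cases[OF d] .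
  obtain h where h: "h \<in> Hom C Y Z" "e = cls h" using cls_cases[OF e] .
  show "Add Q d e \<cdot>\<^bsub>Q\<^esub> c = Add Q (d \<cdot>\<^bsub>Q\<^esub> c) (e \<cdot>\<^bsub>Q\<^esub> c)"
    using f g h Cmp_Add_left[OF f(1) g(1) h(1)] quot_Add[OF g(1) h(1)] quot_Cmp[OF f(1) g(1)]
      quot_Cmp[OF f(1) h(1)] quot_Cmp[OF f(1) Add_in[OF g(1) h(1)]]
      quot_Add[OF Cmp_in[OF f(1) g(1)] Cmp_in[OF f(1) h(1)]] by simp
next
  fix c d e X Y Z assume c: "c \<in> Hom Q X Y" and d: "d \<in> Hom Q X Y" and e: "e \<in> Hom Q Y Z"
  obtain f where f: "f \<in> Hom C X Y" "c = cls f" using cls_cases[OF c] .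
  obtain g where g: "g \<in> Hom C X Y" "d = cls g" using cls_cases[OF d] .
  obtain h where h: "h \<in> Hom C Y Z" "e = cls h" using cls_cases[OF e] .
  show "e \<cdot>\<^bsub>Q\<^esub> Add Q c d = Add Q (e \<cdot>\<^bsub>Q\<^esub> c) (e \<cdot>\<^bsub>Q\<^esub> d)"
    using f g h Cmp_Add_right[OF f(1) g(1) h(1)] quot_Add[OF f(1) g(1)] quot_Cmp[OF f(1) h(1)]
      quot_Cmp[OF g(1) h(1)] quot_Cmp[OF Add_in[OF f(1) g(1)] h(1)]
      quot_Add[OF Cmp_in[OF f(1) h(1)] Cmp_in[OF g(1) h(1)]] by simp
next
  fix k c d X Y Z assume k: "k \<in> carrier K" and c: "c \<in> Hom Q X Y" and d: "d \<in> Hom Q Y Z"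
  obtain f where f: "f \<in> Hom C X Y" "c = cls f" using cls_cases[OF c] .
  obtain g where g: "g \<in> Hom C Y Z" "d = cls g" using cls_cases[OF d] .
  show "Scal Q k d \<cdot>\<^bsub>Q\<^esub> c = Scal Q k (d \<cdot>\<^bsub>Q\<^esub> c)"
    using f g Cmp_Scal_left[OF k f(1) g(1)] quot_Scal[OF k g(1)] quot_Cmp[OF f(1) g(1)]
      quot_Cmp[OF f(1) Scal_in[OF k g(1)]] quot_Scal[OF k Cmp_in[OF f(1) g(1)]] by simp
  show "d \<cdot>\<^bsub>Q\<^esub> Scal Q k c = Scal Q k (d \<cdot>\<^bsub>Q\<^esub> c)"
    using f g Cmp_Scal_right[OF k f(1) g(1)] quot_Scal[OF k f(1)] quot_Cmp[OF f(1) g(1)]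
      quot_Cmp[OF Scal_in[OF k f(1)] g(1)] quot_Scal[OF k Cmp_in[OF f(1) g(1)]] by simp
qed

end

section \<open>Finitely presented functors\<close>

lemma full_sub_simps:
  "Obj (full_sub C U) = U" "Dom (full_sub C U) = Dom C" "Cod (full_sub C U) = Cod C"
  "Idn (full_sub C U) = Idn C" "Cmp (full_sub C U) = Cmp C"
  by (simp_all add: full_sub_def)

lemma full_sub_lincat_simps:
  "Zero (full_sub C U) = Zero C" "Add (full_sub C U) = Add C" "Scal (full_sub C U) = Scal C"
  by (simp_all add: full_sub_def)

lemma Hom_full_sub: "Hom (full_sub C U) X Y = (if X \<in> U \<and> Y \<in> U then Hom C X Y else {})"
  by (auto simp: Hom_def full_sub_def)

lemma op_lincat_simps:
  "Obj (op_lincat C) = Obj C" "Arr (op_lincat C) = Arr C" "Dom (op_lincat C) = Cod C"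
  "Cod (op_lincat C) = Dom C" "Idn (op_lincat C) = Idn C" "g \<cdot>\<^bsub>op_lincat C\<^esub> f = f \<cdot>\<^bsub>C\<^esub> g"
  "Add (op_lincat C) = Add C"
  by (simp_all add: op_lincat_def)

lemma Hom_op: "Hom (op_lincat C) X Y = Hom C Y X"
  by (auto simp: Hom_def op_lincat_simps)

lemma module_mapsI:
  assumes "\<And>x. x \<in> carrier M \<Longrightarrow> h x \<in> carrier N"
    and "\<And>x y. \<lbrakk>x \<in> carrier M; y \<in> carrier M\<rbrakk> \<Longrightarrow> h (x \<oplus>\<^bsub>M\<^esub> y) = h x \<oplus>\<^bsub>N\<^esub> h y"
    and "\<And>a x. \<lbrakk>a \<in> carrier K; x \<in> carrier M\<rbrakk> \<Longrightarrow> h (a \<odot>\<^bsub>M\<^esub> x) = a \<odot>\<^bsub>N\<^esub> h x"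
  shows "h \<in> module_maps K M N"
  using assms by (auto simp: module_maps_def)

lemma module_mapsD:
  assumes "h \<in> module_maps K M N"
  shows "x \<in> carrier M \<Longrightarrow> h x \<in> carrier N"
    and "\<lbrakk>x \<in> carrier M; y \<in> carrier M\<rbrakk> \<Longrightarrow> h (x \<oplus>\<^bsub>M\<^esub> y) = h x \<oplus>\<^bsub>N\<^esub> h y"
    and "\<lbrakk>a \<in> carrier K; x \<in> carrier M\<rbrakk> \<Longrightarrow> h (a \<odot>\<^bsub>M\<^esub> x) = a \<odot>\<^bsub>N\<^esub> h x"
  using assms by (auto simp: module_maps_def)

lemma module_maps_comp:
  assumes "g \<in> module_maps K M N" "h \<in> module_maps K N P"
  shows "h \<circ> g \<in> module_maps K M P"
  by (rule module_mapsI) (simp_all add: module_mapsD[OF assms(1)] module_mapsD[OF assms(2)])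

lemma module_maps_cong:
  assumes "module K M" "\<And>x. x \<in> carrier M \<Longrightarrow> g x = h x" "h \<in> module_maps K M N"
  shows "g \<in> module_maps K M N"
proof -
  interpret M: module K M by fact
  show ?thesis by (rule module_mapsI) (simp_all add: assms(2) module_mapsD[OF assms(3)])
qed

lemma module_maps_inv:
  assumes "module K M" "module K N" "h \<in> module_maps K M N" "bij_betw h (carrier M) (carrier N)"
  shows "inv_into (carrier M) h \<in> module_maps K N M"
proof -
  interpret M: module K M by fact
  interpret N: module K N by fact
  let ?i = "inv_into (carrier M) h"
  have i: "?i y \<in> carrier M" "h (?i y) = y" if "y \<in> carrier N" for y
    using that assms(4) bij_betw_inv_into_right bij_betw_imp_surj_on inv_into_into by metis+
  have j: "?i (h x) = x" if "x \<in> carrier M" for x using bij_betw_inv_into_left[OF assms(4) that] .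
  show ?thesis
  proof (rule module_mapsI)
    fix x y assume xy: "x \<in> carrier N" "y \<in> carrier N"
    have "h (?i x \<oplus>\<^bsub>M\<^esub> ?i y) = x \<oplus>\<^bsub>N\<^esub> y" using module_mapsD(2)[OF assms(3)] i xy by simp
    then show "?i (x \<oplus>\<^bsub>N\<^esub> y) = ?i x \<oplus>\<^bsub>M\<^esub> ?i y" using j[of "?i x \<oplus>\<^bsub>M\<^esub> ?i y"] i xy by simp
  next
    fix a x assume ax: "a \<in> carrier K" "x \<in> carrier N"
    have "h (a \<odot>\<^bsub>M\<^esub> ?i x) = a \<odot>\<^bsub>N\<^esub> x" using module_mapsD(3)[OF assms(3)] i ax by simp
    then show "?i (a \<odot>\<^bsub>N\<^esub> x) = a \<odot>\<^bsub>M\<^esub> ?i x" using j[of "a \<odot>\<^bsub>M\<^esub> ?i x"] i ax by simp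
  qed (use i in auto)
qed

lemma Hom_module_cat:
  "\<phi> \<in> Hom (module_cat t K) M N \<longleftrightarrow>
     (\<exists>h. \<phi> = (M, h, N) \<and> module K M \<and> module K N \<and> h \<in> module_maps K M N \<and> h \<in> extensional (carrier M))"
  by (auto simp: Hom_def module_cat_def)

text \<open>An arrow between module-valued functors carries source and target modules in each component and is
  extensional. All of this is determined by a bare family of maps \<open>\<phi>\<close>, with which it is easier to compute.\<close>

definition nat_arr ::
  "('o, 'm, 'z) cat_scheme \<Rightarrow> ('o, 'm, ('k, 'v) module, ('k, 'v) module_arr) func \<Rightarrow>
   ('o, 'm, ('k, 'v) module, ('k, 'v) module_arr) func \<Rightarrow> ('o \<Rightarrow> 'v \<Rightarrow> 'v) \<Rightarrow>
   ('o, 'm, ('k, 'v) module, ('k, 'v) module_arr) func \<times> ('o \<Rightarrow> ('k, 'v) module_arr) \<times>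
   ('o, 'm, ('k, 'v) module, ('k, 'v) module_arr) func" where
  "nat_arr D F G \<phi> = (F, \<lambda>A \<in> Obj D. (FO F A, restrict (\<phi> A) (carrier (FO F A)), FO G A), G)"

locale fp_functors = category D
  for K :: "('k, 'r) ring_scheme" and D :: "('o, 'n, 'k, 'z) lincat_scheme" +
  fixes universe :: "'v itself"
begin

abbreviation "Fp \<equiv> fp_modules universe K D"

lemma Obj_Fp:
  "F \<in> Obj Fp \<longleftrightarrow> is_additive_functor (op_lincat D) (module_cat universe K) F \<and> finitely_presented K D F"
  by (simp add: fp_modules_def full_sub_simps additive_functor_cat_def)

lemma Hom_Fp:
  "h \<in> Hom Fp F G \<longleftrightarrow> F \<in> Obj Fp \<and> G \<in> Obj Fp \<and>
     (\<exists>\<eta>. h = (F, \<eta>, G) \<and> is_nat_trans (op_lincat D) (module_cat universe K) F G \<eta> \<and> \<eta> \<in> extensional (Obj D))"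
  unfolding Obj_Fp by (auto simp: fp_modules_def Let_def full_sub_def Hom_def additive_functor_cat_def op_lincat_simps)

lemma Fp_value: "\<lbrakk>F \<in> Obj Fp; A \<in> Obj D\<rbrakk> \<Longrightarrow> module K (FO F A)"
  by (simp add: Obj_Fp is_additive_functor_def is_functor_def op_lincat_simps module_cat_def)

lemma Fp_arr:
  assumes "F \<in> Obj Fp" "f \<in> Hom D A B"
  shows "FA F f = (FO F B, arr_map (FA F f), FO F A)"
    and "arr_map (FA F f) \<in> module_maps K (FO F B) (FO F A)"
    and "arr_map (FA F f) \<in> extensional (carrier (FO F B))"
proof -
  have "FA F f \<in> Hom (module_cat universe K) (FO F B) (FO F A)"
    using functor_Hom[of "op_lincat D" "module_cat universe K" F f B A] assms
    by (simp add: Obj_Fp is_additive_functor_def Hom_op)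
  then show "FA F f = (FO F B, arr_map (FA F f), FO F A)"
    "arr_map (FA F f) \<in> module_maps K (FO F B) (FO F A)"
    "arr_map (FA F f) \<in> extensional (carrier (FO F B))" by (auto simp: Hom_module_cat)
qed

lemma nat_arr_in:
  assumes F: "F \<in> Obj Fp" and G: "G \<in> Obj Fp" and \<phi>: "module_nat_trans K D F G \<phi>"
  shows "nat_arr D F G \<phi> \<in> Hom Fp F G"
proof -
  let ?\<eta> = "\<lambda>A \<in> Obj D. (FO F A, restrict (\<phi> A) (carrier (FO F A)), FO G A)"
  have "is_nat_trans (op_lincat D) (module_cat universe K) F G ?\<eta>"
    unfolding is_nat_trans_def op_lincat_simps
  proof (intro conjI ballI)
    fix A assume A: "A \<in> Obj D"
    have "\<phi> A \<in> module_maps K (FO F A) (FO G A)" using \<phi> A by (simp add: module_nat_trans_def)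
    then have "restrict (\<phi> A) (carrier (FO F A)) \<in> module_maps K (FO F A) (FO G A)"
      using module_maps_cong[OF Fp_value[OF F A], of "restrict (\<phi> A) (carrier (FO F A))" "\<phi> A"] by simp
    then show "?\<eta> A \<in> Hom (module_cat universe K) (FO F A) (FO G A)"
      using A Fp_value[OF F A] Fp_value[OF G A] by (simp add: Hom_module_cat)
  next
    fix f assume "f \<in> Arr D"
    then have f: "f \<in> Hom D (Dom D f) (Cod D f)" by (rule Arr_Hom)
    have o: "Dom D f \<in> Obj D" "Cod D f \<in> Obj D" using Hom_Dom[OF f] Hom_Cod[OF f] .
    have FA: "FA F f = (FO F (Cod D f), arr_map (FA F f), FO F (Dom D f))" using Fp_arr(1)[OF F f] .
    have GA: "FA G f = (FO G (Cod D f), arr_map (FA G f), FO G (Dom D f))" using Fp_arr(1)[OF G f] .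
    have "compose (carrier (FO F (Cod D f))) (restrict (\<phi> (Dom D f)) (carrier (FO F (Dom D f)))) (arr_map (FA F f))
        = compose (carrier (FO F (Cod D f))) (arr_map (FA G f)) (restrict (\<phi> (Cod D f)) (carrier (FO F (Cod D f))))"
    proof
      fix x
      show "compose (carrier (FO F (Cod D f))) (restrict (\<phi> (Dom D f)) (carrier (FO F (Dom D f)))) (arr_map (FA F f)) x
        = compose (carrier (FO F (Cod D f))) (arr_map (FA G f)) (restrict (\<phi> (Cod D f)) (carrier (FO F (Cod D f)))) x"
      proof (cases "x \<in> carrier (FO F (Cod D f))")
        case True
        then have "\<phi> (Dom D f) (arr_map (FA F f) x) = arr_map (FA G f) (\<phi> (Cod D f) x)"
          using \<phi> \<open>f \<in> Arr D\<close> by (simp add: module_nat_trans_def)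
        then show ?thesis using True module_mapsD(1)[OF Fp_arr(2)[OF F f] True] by (simp add: compose_def)
      qed (simp add: compose_def)
    qed
    then have "(FO F (Dom D f), restrict (\<phi> (Dom D f)) (carrier (FO F (Dom D f))), FO G (Dom D f))
          \<cdot>\<^bsub>module_cat universe K\<^esub> (FO F (Cod D f), arr_map (FA F f), FO F (Dom D f))
        = (FO G (Cod D f), arr_map (FA G f), FO G (Dom D f))
          \<cdot>\<^bsub>module_cat universe K\<^esub> (FO F (Cod D f), restrict (\<phi> (Cod D f)) (carrier (FO F (Cod D f))), FO G (Cod D f))"
      by (simp add: module_cat_def)
    then show "?\<eta> (Dom D f) \<cdot>\<^bsub>module_cat universe K\<^esub> FA F f = FA G f \<cdot>\<^bsub>module_cat universe K\<^esub> ?\<eta> (Cod D f)"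
      using o FA[symmetric] GA[symmetric] by simp
  qed
  then show ?thesis using F G by (simp add: Hom_Fp nat_arr_def)
qed

lemma nat_arr_cases:
  assumes "h \<in> Hom Fp F G"
  obtains \<phi> where "module_nat_trans K D F G \<phi>" "h = nat_arr D F G \<phi>"
proof -
  obtain \<eta> where h: "h = (F, \<eta>, G)" and nt: "is_nat_trans (op_lincat D) (module_cat universe K) F G \<eta>"
    and ext: "\<eta> \<in> extensional (Obj D)" and F: "F \<in> Obj Fp" and G: "G \<in> Obj Fp" using assms by (auto simp: Hom_Fp)
  define \<phi> where "\<phi> A = arr_map (\<eta> A)" for A
  have \<eta>: "\<eta> A = (FO F A, \<phi> A, FO G A)" "\<phi> A \<in> module_maps K (FO F A) (FO G A)"
    "\<phi> A \<in> extensional (carrier (FO F A))" if "A \<in> Obj D" for A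
    using nt that by (auto simp: is_nat_trans_def op_lincat_simps Hom_module_cat \<phi>_def)
  have "module_nat_trans K D F G \<phi>"
    unfolding module_nat_trans_def
  proof (intro conjI ballI)
    fix f x assume "f \<in> Arr D" and x: "x \<in> carrier (FO F (Cod D f))"
    then have f: "f \<in> Hom D (Dom D f) (Cod D f)" by (simp add: Arr_Hom)
    have o: "Dom D f \<in> Obj D" "Cod D f \<in> Obj D" using Hom_Dom[OF f] Hom_Cod[OF f] .
    have "\<eta> (Dom D f) \<cdot>\<^bsub>module_cat universe K\<^esub> FA F f = FA G f \<cdot>\<^bsub>module_cat universe K\<^esub> \<eta> (Cod D f)"
      using nt \<open>f \<in> Arr D\<close> by (simp add: is_nat_trans_def op_lincat_simps)
    then have "(FO F (Dom D f), \<phi> (Dom D f), FO G (Dom D f))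
          \<cdot>\<^bsub>module_cat universe K\<^esub> (FO F (Cod D f), arr_map (FA F f), FO F (Dom D f))
        = (FO G (Cod D f), arr_map (FA G f), FO G (Dom D f))
          \<cdot>\<^bsub>module_cat universe K\<^esub> (FO F (Cod D f), \<phi> (Cod D f), FO G (Cod D f))"
      using \<eta>(1)[OF o(1)] \<eta>(1)[OF o(2)] Fp_arr(1)[OF F f] Fp_arr(1)[OF G f] by metis
    then have "compose (carrier (FO F (Cod D f))) (\<phi> (Dom D f)) (arr_map (FA F f))
        = compose (carrier (FO F (Cod D f))) (arr_map (FA G f)) (\<phi> (Cod D f))" by (simp add: module_cat_def)
    from fun_cong[OF this, of x]
    show "\<phi> (Dom D f) (arr_map (FA F f) x) = arr_map (FA G f) (\<phi> (Cod D f) x)"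
      using x by (simp add: compose_def)
  qed (use \<eta> in blast)
  moreover have "\<eta> A = (\<lambda>A \<in> Obj D. (FO F A, restrict (\<phi> A) (carrier (FO F A)), FO G A)) A" for A
    using \<eta>[of A] ext extensional_arb[OF ext] extensional_restrict[of "\<phi> A"] by (cases "A \<in> Obj D") simp_all
  then have "h = nat_arr D F G \<phi>" unfolding h nat_arr_def by blast
  ultimately show thesis using that by blast
qed

lemma nat_arr_eq_iff:
  "nat_arr D F G \<phi> = nat_arr D F G \<psi> \<longleftrightarrow> (\<forall>A \<in> Obj D. \<forall>x \<in> carrier (FO F A). \<phi> A x = \<psi> A x)"
proof
  assume eq: "nat_arr D F G \<phi> = nat_arr D F G \<psi>"
  show "\<forall>A \<in> Obj D. \<forall>x \<in> carrier (FO F A). \<phi> A x = \<psi> A x"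
  proof (intro ballI)
    fix A x assume A: "A \<in> Obj D" and x: "x \<in> carrier (FO F A)"
    have "(\<lambda>A \<in> Obj D. (FO F A, restrict (\<phi> A) (carrier (FO F A)), FO G A)) A
        = (\<lambda>A \<in> Obj D. (FO F A, restrict (\<psi> A) (carrier (FO F A)), FO G A)) A"
      using eq by (simp add: nat_arr_def)
    then have "restrict (\<phi> A) (carrier (FO F A)) x = restrict (\<psi> A) (carrier (FO F A)) x" using A by simp
    then show "\<phi> A x = \<psi> A x" using x by simp
  qed
next
  assume "\<forall>A \<in> Obj D. \<forall>x \<in> carrier (FO F A). \<phi> A x = \<psi> A x"
  then have "(\<lambda>A \<in> Obj D. (FO F A, restrict (\<phi> A) (carrier (FO F A)), FO G A))
        = (\<lambda>A \<in> Obj D. (FO F A, restrict (\<psi> A) (carrier (FO F A)), FO G A))"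
    by (intro restrict_ext) (auto intro: restrict_ext)
  then show "nat_arr D F G \<phi> = nat_arr D F G \<psi>" by (simp add: nat_arr_def)
qed

lemma nat_arr_Cmp:
  assumes "module_nat_trans K D F G \<phi>"
  shows "nat_arr D G H \<psi> \<cdot>\<^bsub>Fp\<^esub> nat_arr D F G \<phi> = nat_arr D F H (\<lambda>A. \<psi> A \<circ> \<phi> A)"
proof -
  have "(\<lambda>A \<in> Obj D. (FO G A, restrict (\<psi> A) (carrier (FO G A)), FO H A)) A \<cdot>\<^bsub>module_cat universe K\<^esub>
        (\<lambda>A \<in> Obj D. (FO F A, restrict (\<phi> A) (carrier (FO F A)), FO G A)) A
      = (FO F A, restrict (\<psi> A \<circ> \<phi> A) (carrier (FO F A)), FO H A)" if "A \<in> Obj D" for A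
  proof -
    have "\<phi> A \<in> module_maps K (FO F A) (FO G A)" using assms that by (simp add: module_nat_trans_def)
    then have "compose (carrier (FO F A)) (restrict (\<psi> A) (carrier (FO G A))) (restrict (\<phi> A) (carrier (FO F A)))
        = restrict (\<psi> A \<circ> \<phi> A) (carrier (FO F A))"
      by (auto simp: compose_def module_mapsD(1) intro!: restrict_ext)
    then show ?thesis using that by (simp add: module_cat_def)
  qed
  then have "(\<lambda>A \<in> Obj D. (\<lambda>A \<in> Obj D. (FO G A, restrict (\<psi> A) (carrier (FO G A)), FO H A)) A \<cdot>\<^bsub>module_cat universe K\<^esub>
        (\<lambda>A \<in> Obj D. (FO F A, restrict (\<phi> A) (carrier (FO F A)), FO G A)) A)
      = (\<lambda>A \<in> Obj D. (FO F A, restrict (\<psi> A \<circ> \<phi> A) (carrier (FO F A)), FO H A))"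
    by (intro restrict_ext) blast
  then show ?thesis
    by (simp add: fp_modules_def full_sub_simps additive_functor_cat_def nat_arr_def op_lincat_simps)
qed

lemma Fp_Idn: "Idn Fp F = nat_arr D F F (\<lambda>A x. x)"
  by (simp add: fp_modules_def full_sub_simps additive_functor_cat_def nat_arr_def op_lincat_simps
      module_cat_def id_def)

lemma nat_trans_id: "module_nat_trans K D F F (\<lambda>A x. x)"
  by (simp add: module_nat_trans_def module_maps_def)

lemma nat_trans_comp:
  assumes "module_nat_trans K D F G \<phi>" "module_nat_trans K D G H \<psi>"
  shows "module_nat_trans K D F H (\<lambda>A. \<psi> A \<circ> \<phi> A)"
  unfolding module_nat_trans_def
proof (intro conjI ballI)
  show "\<psi> A \<circ> \<phi> A \<in> module_maps K (FO F A) (FO H A)" if "A \<in> Obj D" for A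
    using assms that unfolding module_nat_trans_def by (metis module_maps_comp)
next
  fix f x assume f: "f \<in> Arr D" and x: "x \<in> carrier (FO F (Cod D f))"
  have "\<phi> (Cod D f) \<in> module_maps K (FO F (Cod D f)) (FO G (Cod D f))"
    using assms(1) Cod_in[OF f] by (simp add: module_nat_trans_def)
  then show "(\<psi> (Dom D f) \<circ> \<phi> (Dom D f)) (arr_map (FA F f) x) = arr_map (FA H f) ((\<psi> (Cod D f) \<circ> \<phi> (Cod D f)) x)"
    using assms f x by (simp add: module_nat_trans_def module_mapsD(1))
qed

lemma category_Fp: "category Fp"
proof
  fix h assume "h \<in> Arr Fp"
  then have "h \<in> Hom Fp (Dom Fp h) (Cod Fp h)" by (rule Arr_Hom)
  then show "Dom Fp h \<in> Obj Fp" "Cod Fp h \<in> Obj Fp" by (auto simp: Hom_Fp)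
next
  fix F assume "F \<in> Obj Fp"
  then show "Idn Fp F \<in> Hom Fp F F" using nat_arr_in[OF _ _ nat_trans_id] by (simp add: Fp_Idn)
next
  fix h k F G H assume h: "h \<in> Hom Fp F G" and k: "k \<in> Hom Fp G H"
  obtain \<phi> where \<phi>: "module_nat_trans K D F G \<phi>" "h = nat_arr D F G \<phi>" using nat_arr_cases[OF h] .
  obtain \<psi> where \<psi>: "module_nat_trans K D G H \<psi>" "k = nat_arr D G H \<psi>" using nat_arr_cases[OF k] .
  show "k \<cdot>\<^bsub>Fp\<^esub> h \<in> Hom Fp F H"
    using nat_arr_in[OF _ _ nat_trans_comp[OF \<phi>(1) \<psi>(1)]] h k nat_arr_Cmp[OF \<phi>(1)] \<phi>(2) \<psi>(2) by (simp add: Hom_Fp)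
next
  fix h k l F G H L assume h: "h \<in> Hom Fp F G" and k: "k \<in> Hom Fp G H" and l: "l \<in> Hom Fp H L"
  obtain \<phi> where \<phi>: "module_nat_trans K D F G \<phi>" "h = nat_arr D F G \<phi>" using nat_arr_cases[OF h] .
  obtain \<psi> where \<psi>: "module_nat_trans K D G H \<psi>" "k = nat_arr D G H \<psi>" using nat_arr_cases[OF k] .
  obtain \<chi> where \<chi>: "module_nat_trans K D H L \<chi>" "l = nat_arr D H L \<chi>" using nat_arr_cases[OF l] .
  show "l \<cdot>\<^bsub>Fp\<^esub> (k \<cdot>\<^bsub>Fp\<^esub> h) = (l \<cdot>\<^bsub>Fp\<^esub> k) \<cdot>\<^bsub>Fp\<^esub> h"
    using nat_arr_Cmp[OF \<phi>(1)] nat_arr_Cmp[OF \<psi>(1)] nat_arr_Cmp[OF nat_trans_comp[OF \<phi>(1) \<psi>(1)]] \<phi>(2) \<psi>(2) \<chi>(2)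
    by (simp add: comp_assoc)
next
  fix h F G assume h: "h \<in> Hom Fp F G"
  obtain \<phi> where \<phi>: "module_nat_trans K D F G \<phi>" "h = nat_arr D F G \<phi>" using nat_arr_cases[OF h] .
  show "Idn Fp G \<cdot>\<^bsub>Fp\<^esub> h = h" "h \<cdot>\<^bsub>Fp\<^esub> Idn Fp F = h"
    using nat_arr_Cmp[OF \<phi>(1)] nat_arr_Cmp[OF nat_trans_id] \<phi>(2) by (simp_all add: Fp_Idn comp_def)
qed

text \<open>The pointwise inverses are again linear and natural.\<close>

lemma nat_arr_iso:
  assumes F: "F \<in> Obj Fp" and G: "G \<in> Obj Fp" and \<phi>: "module_nat_trans K D F G \<phi>"
    and bij: "\<And>A. A \<in> Obj D \<Longrightarrow> bij_betw (\<phi> A) (carrier (FO F A)) (carrier (FO G A))"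
  shows "is_iso Fp (nat_arr D F G \<phi>)"
proof -
  interpret Fp: category Fp by (rule category_Fp)
  define \<psi> where "\<psi> A = inv_into (carrier (FO F A)) (\<phi> A)" for A
  have l: "\<psi> A (\<phi> A x) = x" if "A \<in> Obj D" "x \<in> carrier (FO F A)" for A x
    using bij_betw_inv_into_left[OF bij] that by (simp add: \<psi>_def)
  have r: "\<phi> A (\<psi> A x) = x" "\<psi> A x \<in> carrier (FO F A)" if "A \<in> Obj D" "x \<in> carrier (FO G A)" for A x
    using bij_betw_inv_into_right[OF bij] bij_betwE[OF bij_betw_inv_into[OF bij]] that by (auto simp: \<psi>_def)
  have \<psi>: "module_nat_trans K D G F \<psi>"
    unfolding module_nat_trans_def
  proof (intro conjI ballI)
    fix A assume A: "A \<in> Obj D"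
    then have "\<phi> A \<in> module_maps K (FO F A) (FO G A)" using \<phi> by (simp add: module_nat_trans_def)
    then show "\<psi> A \<in> module_maps K (FO G A) (FO F A)"
      unfolding \<psi>_def using module_maps_inv[OF Fp_value[OF F A] Fp_value[OF G A]] bij[OF A] by blast
  next
    fix f x assume "f \<in> Arr D" and x: "x \<in> carrier (FO G (Cod D f))"
    then have f: "f \<in> Hom D (Dom D f) (Cod D f)" by (simp add: Arr_Hom)
    have o: "Dom D f \<in> Obj D" "Cod D f \<in> Obj D" using Hom_Dom[OF f] Hom_Cod[OF f] .
    have "\<phi> (Dom D f) (arr_map (FA F f) (\<psi> (Cod D f) x)) = arr_map (FA G f) x"
      using \<phi> \<open>f \<in> Arr D\<close> r[OF o(2) x] by (simp add: module_nat_trans_def)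
    moreover have "arr_map (FA F f) (\<psi> (Cod D f) x) \<in> carrier (FO F (Dom D f))"
      using module_mapsD(1)[OF Fp_arr(2)[OF F f] r(2)[OF o(2) x]] .
    ultimately show "\<psi> (Dom D f) (arr_map (FA G f) x) = arr_map (FA F f) (\<psi> (Cod D f) x)"
      using l[OF o(1)] by metis
  qed
  show ?thesis
  proof (rule Fp.isoI[OF nat_arr_in[OF F G \<phi>] nat_arr_in[OF G F \<psi>]])
    show "nat_arr D G F \<psi> \<cdot>\<^bsub>Fp\<^esub> nat_arr D F G \<phi> = Idn Fp F"
      using l by (simp add: nat_arr_Cmp[OF \<phi>] Fp_Idn nat_arr_eq_iff)
    show "nat_arr D F G \<phi> \<cdot>\<^bsub>Fp\<^esub> nat_arr D G F \<psi> = Idn Fp G"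
      using r by (simp add: nat_arr_Cmp[OF \<psi>] Fp_Idn nat_arr_eq_iff)
  qed
qed

end

section \<open>The restricted Yoneda functor\<close>

lemma module_maps_zero:
  assumes "module K M" "module K N" "h \<in> module_maps K M N"
  shows "h \<zero>\<^bsub>M\<^esub> = \<zero>\<^bsub>N\<^esub>"
proof -
  interpret M: module K M by fact
  interpret N: module K N by fact
  have "h \<zero>\<^bsub>M\<^esub> \<in> carrier N" using module_mapsD(1)[OF assms(3)] by simp
  moreover have "h \<zero>\<^bsub>M\<^esub> \<oplus>\<^bsub>N\<^esub> h \<zero>\<^bsub>M\<^esub> = h \<zero>\<^bsub>M\<^esub>"
    using module_mapsD(2)[OF assms(3), of "\<zero>\<^bsub>M\<^esub>" "\<zero>\<^bsub>M\<^esub>"] by simp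
  ultimately show ?thesis by simp
qed

text \<open>\<open>D\<close> is the full subcategory of \<open>Q\<close> on some objects, up to the values of its operations on arguments outside
  \<open>D\<close>: a quotient of a subcategory agrees with the subcategory of the quotient only in this sense.
  The map \<open>e\<close> copies the morphisms of \<open>Q\<close> into the universe \<open>'v\<close> of the module category.\<close>

locale restricted_hom = linear_category K Q
  for K :: "('k, 'r) ring_scheme" and Q :: "('o, 'n, 'k, 'y) lincat_scheme" +
  fixes D :: "('o, 'n, 'k, 'z) lincat_scheme" and e :: "'n \<Rightarrow> 'v"
  assumes Obj_D: "A \<in> Obj D \<Longrightarrow> A \<in> Obj Q"
    and Hom_D: "\<lbrakk>A \<in> Obj D; B \<in> Obj D\<rbrakk> \<Longrightarrow> Hom D A B = Hom Q A B"
    and Arr_D: "f \<in> Arr D \<Longrightarrow> Dom D f \<in> Obj D \<and> Cod D f \<in> Obj D"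
    and Idn_D: "A \<in> Obj D \<Longrightarrow> Idn D A = Idn Q A"
    and Cmp_D: "\<lbrakk>f \<in> Hom D A B; g \<in> Hom D B X\<rbrakk> \<Longrightarrow> g \<cdot>\<^bsub>D\<^esub> f = g \<cdot>\<^bsub>Q\<^esub> f"
    and Add_D: "\<lbrakk>f \<in> Hom D A B; g \<in> Hom D A B\<rbrakk> \<Longrightarrow> Add D f g = Add Q f g"
    and Scal_D: "\<lbrakk>k \<in> carrier K; f \<in> Hom D A B\<rbrakk> \<Longrightarrow> Scal D k f = Scal Q k f"
    and inj_e: "inj_on e (Arr Q)"
begin

abbreviation compose_in_Q (infixr \<open>\<bullet>\<close> 75) where "g \<bullet> f \<equiv> Cmp Q g f"

lemma D_objs: assumes "f \<in> Hom D A B" shows "A \<in> Obj D" "B \<in> Obj D"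
  using Arr_D[of f] assms by (auto simp: Hom_def)

lemma D_Q: "f \<in> Hom D A B \<Longrightarrow> f \<in> Hom Q A B"
  using Hom_D D_objs by blast

lemma Q_D: "\<lbrakk>f \<in> Hom Q A B; A \<in> Obj D; B \<in> Obj D\<rbrakk> \<Longrightarrow> f \<in> Hom D A B"
  using Hom_D by blast

lemma category_D: "category D"
proof
  fix f assume "f \<in> Arr D" then show "Dom D f \<in> Obj D" "Cod D f \<in> Obj D" using Arr_D by auto
next
  fix X assume "X \<in> Obj D" then show "Idn D X \<in> Hom D X X" using Hom_D Idn_D Idn_in[OF Obj_D] by simp
next
  fix f g X Y Z assume f: "f \<in> Hom D X Y" and g: "g \<in> Hom D Y Z"
  show "g \<cdot>\<^bsub>D\<^esub> f \<in> Hom D X Z"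
    using Cmp_D[OF f g] Q_D[OF Cmp_in[OF D_Q[OF f] D_Q[OF g]]] D_objs(1)[OF f] D_objs(2)[OF g] by simp
next
  fix f g h W X Y Z assume f: "f \<in> Hom D W X" and g: "g \<in> Hom D X Y" and h: "h \<in> Hom D Y Z"
  have gf: "g \<cdot>\<^bsub>D\<^esub> f \<in> Hom D W Y"
    using Cmp_D[OF f g] Q_D[OF Cmp_in[OF D_Q[OF f] D_Q[OF g]]] D_objs(1)[OF f] D_objs(2)[OF g] by simp
  have hg: "h \<cdot>\<^bsub>D\<^esub> g \<in> Hom D X Z"
    using Cmp_D[OF g h] Q_D[OF Cmp_in[OF D_Q[OF g] D_Q[OF h]]] D_objs(1)[OF g] D_objs(2)[OF h] by simp
  show "h \<cdot>\<^bsub>D\<^esub> (g \<cdot>\<^bsub>D\<^esub> f) = (h \<cdot>\<^bsub>D\<^esub> g) \<cdot>\<^bsub>D\<^esub> f"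
    using Cmp_D[OF gf h] Cmp_D[OF f hg] Cmp_D[OF f g] Cmp_D[OF g h] Cmp_assoc[OF D_Q[OF f] D_Q[OF g] D_Q[OF h]] by simp
next
  fix f X Y assume f: "f \<in> Hom D X Y"
  have i: "Idn D X \<in> Hom D X X" "Idn D Y \<in> Hom D Y Y"
    using Hom_D Idn_D Idn_in[OF Obj_D] D_objs[OF f] by simp_all
  show "Idn D Y \<cdot>\<^bsub>D\<^esub> f = f" using Cmp_D[OF f i(2)] Idn_D[OF D_objs(2)[OF f]] Idn_left[OF D_Q[OF f]] by simp
  show "f \<cdot>\<^bsub>D\<^esub> Idn D X = f" using Cmp_D[OF i(1) f] Idn_D[OF D_objs(1)[OF f]] Idn_right[OF D_Q[OF f]] by simp
qed

sublocale fp: fp_functors K D "TYPE('v)"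
  by (rule fp_functors.intro[OF category_D])

definition decode :: "'v \<Rightarrow> 'n" where "decode = inv_into (Arr Q) e"

lemma decode: "f \<in> Hom Q X Y \<Longrightarrow> decode (e f) = f"
  unfolding decode_def using inv_into_f_f[OF inj_e] by (auto simp: Hom_def)

lemma e_eq_iff: "\<lbrakk>f \<in> Hom Q X Y; g \<in> Hom Q X Y\<rbrakk> \<Longrightarrow> e f = e g \<longleftrightarrow> f = g"
  using inj_e by (auto simp: Hom_def inj_on_def)

text \<open>The module \<open>Hom\<^bsub>Q\<^esub>(A, X)\<close>, transported along \<open>e\<close>.\<close>

definition value_at :: "'o \<Rightarrow> 'o \<Rightarrow> ('k, 'v) module" where
  "value_at X A = \<lparr>carrier = e ` Hom Q A X, mult = undefined, one = undefined, zero = e (Zero Q A X),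
     add = (\<lambda>x y. e (Add Q (decode x) (decode y))), smult = (\<lambda>k x. e (Scal Q k (decode x)))\<rparr>"

definition yoneda :: "'o \<Rightarrow> ('o, 'n, ('k, 'v) module, ('k, 'v) module_arr) func" where
  "yoneda X = \<lparr>FO = value_at X,
     FA = (\<lambda>f. (value_at X (Cod D f), \<lambda>x \<in> e ` Hom Q (Cod D f) X. e (decode x \<bullet> f), value_at X (Dom D f)))\<rparr>"

definition postcompose :: "'n \<Rightarrow> 'o \<Rightarrow> 'v \<Rightarrow> 'v" where
  "postcompose h A x = e (h \<bullet> decode x)"

lemma carrier_yoneda: "carrier (FO (yoneda X) A) = e ` Hom Q A X"
  by (simp add: yoneda_def value_at_def)

lemma zero_yoneda: "\<zero>\<^bsub>FO (yoneda X) A\<^esub> = e (Zero Q A X)"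
  by (simp add: yoneda_def value_at_def)

lemma add_yoneda: "\<lbrakk>a \<in> Hom Q A X; b \<in> Hom Q A X\<rbrakk> \<Longrightarrow> e a \<oplus>\<^bsub>FO (yoneda X) A\<^esub> e b = e (Add Q a b)"
  by (simp add: yoneda_def value_at_def decode)

lemma smult_yoneda: "a \<in> Hom Q A X \<Longrightarrow> k \<odot>\<^bsub>FO (yoneda X) A\<^esub> e a = e (Scal Q k a)"
  by (simp add: yoneda_def value_at_def decode)

lemma yoneda_map: "\<lbrakk>f \<in> Hom D A B; a \<in> Hom Q B X\<rbrakk> \<Longrightarrow> arr_map (FA (yoneda X) f) (e a) = e (a \<bullet> f)"
  by (auto simp: yoneda_def decode Hom_def)

lemma postcompose_e: "a \<in> Hom Q A X \<Longrightarrow> postcompose h A (e a) = e (h \<bullet> a)"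
  by (simp add: postcompose_def decode)

lemma module_yoneda:
  assumes "A \<in> Obj Q" "X \<in> Obj Q" shows "module K (FO (yoneda X) A)"
  by (rule module_of_image[OF hom_module[OF assms], where \<phi> = e])
    (simp_all add: hom_module_def carrier_yoneda zero_yoneda add_yoneda smult_yoneda)

lemma yoneda_arr:
  assumes X: "X \<in> Obj Q" and f: "f \<in> Hom D A B"
  shows "FA (yoneda X) f \<in> Hom (module_cat TYPE('v) K) (FO (yoneda X) B) (FO (yoneda X) A)"
proof -
  have o: "A \<in> Obj D" "B \<in> Obj D" "A \<in> Obj Q" "B \<in> Obj Q" using D_objs[OF f] Obj_D by auto
  note f' = D_Q[OF f]
  have "FA (yoneda X) f = (FO (yoneda X) B, arr_map (FA (yoneda X) f), FO (yoneda X) A)"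
    using f by (auto simp: yoneda_def Hom_def)
  moreover have "arr_map (FA (yoneda X) f) \<in> extensional (carrier (FO (yoneda X) B))"
    using f by (auto simp: yoneda_def value_at_def Hom_def)
  moreover have "arr_map (FA (yoneda X) f) \<in> module_maps K (FO (yoneda X) B) (FO (yoneda X) A)"
  proof (rule module_mapsI)
    fix x assume "x \<in> carrier (FO (yoneda X) B)"
    then obtain a where a: "a \<in> Hom Q B X" "x = e a" by (auto simp: carrier_yoneda)
    then show "arr_map (FA (yoneda X) f) x \<in> carrier (FO (yoneda X) A)"
      using Cmp_in[OF f' a(1)] by (simp add: yoneda_map[OF f] carrier_yoneda)
  next
    fix x y assume "x \<in> carrier (FO (yoneda X) B)" "y \<in> carrier (FO (yoneda X) B)"
    then obtain a b where a: "a \<in> Hom Q B X" "x = e a" and b: "b \<in> Hom Q B X" "y = e b" by (auto simp: carrier_yoneda)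
    then show "arr_map (FA (yoneda X) f) (x \<oplus>\<^bsub>FO (yoneda X) B\<^esub> y)
        = arr_map (FA (yoneda X) f) x \<oplus>\<^bsub>FO (yoneda X) A\<^esub> arr_map (FA (yoneda X) f) y"
      using Cmp_Add_left[OF f' a(1) b(1)] Cmp_in[OF f' a(1)] Cmp_in[OF f' b(1)] Add_in[OF a(1) b(1)]
      by (simp add: yoneda_map[OF f] add_yoneda)
  next
    fix k x assume k: "k \<in> carrier K" and "x \<in> carrier (FO (yoneda X) B)"
    then obtain a where a: "a \<in> Hom Q B X" "x = e a" by (auto simp: carrier_yoneda)
    then show "arr_map (FA (yoneda X) f) (k \<odot>\<^bsub>FO (yoneda X) B\<^esub> x) = k \<odot>\<^bsub>FO (yoneda X) A\<^esub> arr_map (FA (yoneda X) f) x"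
      using Cmp_Scal_left[OF k f' a(1)] Cmp_in[OF f' a(1)] Scal_in[OF k a(1)]
      by (simp add: yoneda_map[OF f] smult_yoneda)
  qed
  ultimately show ?thesis
    unfolding Hom_module_cat using module_yoneda[OF o(3) X] module_yoneda[OF o(4) X] by blast
qed

lemma yoneda_arr_eqI:
  assumes X: "X \<in> Obj Q" and f: "f \<in> Hom D A B"
    and \<phi>: "\<phi> = (FO (yoneda X) B, h, FO (yoneda X) A)" "h \<in> extensional (e ` Hom Q B X)"
    and eq: "\<And>a. a \<in> Hom Q B X \<Longrightarrow> h (e a) = e (a \<bullet> f)"
  shows "FA (yoneda X) f = \<phi>"
proof -
  obtain g where g: "FA (yoneda X) f = (FO (yoneda X) B, g, FO (yoneda X) A)" "g \<in> extensional (e ` Hom Q B X)"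
    using yoneda_arr[OF X f] unfolding Hom_module_cat carrier_yoneda by blast
  have "g = h"
  proof (rule extensionalityI[OF g(2) \<phi>(2)])
    fix x assume "x \<in> e ` Hom Q B X"
    then obtain a where a: "a \<in> Hom Q B X" "x = e a" by blast
    then show "g x = h x" using yoneda_map[OF f a(1)] eq[OF a(1)] g(1) by simp
  qed
  then show ?thesis using g \<phi> by simp
qed

lemma yoneda_additive:
  assumes X: "X \<in> Obj Q"
  shows "is_additive_functor (op_lincat D) (module_cat TYPE('v) K) (yoneda X)"
  unfolding is_additive_functor_def
proof (intro conjI ballI)
  show "is_functor (op_lincat D) (module_cat TYPE('v) K) (yoneda X)"
  proof (rule is_functorI)
    fix A assume "A \<in> Obj (op_lincat D)"
    then have A: "A \<in> Obj D" "A \<in> Obj Q" using Obj_D by (simp_all add: op_lincat_simps)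
    show "FO (yoneda X) A \<in> Obj (module_cat TYPE('v) K)"
      using module_yoneda[OF A(2) X] by (simp add: module_cat_def)
    have i: "Idn D A \<in> Hom D A A" using category.Idn_in[OF category_D A(1)] .
    show "FA (yoneda X) (Idn (op_lincat D) A) = Idn (module_cat TYPE('v) K) (FO (yoneda X) A)"
      unfolding op_lincat_simps
      by (rule yoneda_arr_eqI[OF X i, where h = "restrict id (e ` Hom Q A X)"])
        (simp_all add: module_cat_def carrier_yoneda Idn_D[OF A(1)] Idn_right)
  next
    fix f B A assume "f \<in> Hom (op_lincat D) B A"
    then show "FA (yoneda X) f \<in> Hom (module_cat TYPE('v) K) (FO (yoneda X) B) (FO (yoneda X) A)"
      using yoneda_arr[OF X] by (simp add: Hom_op)
  next
    fix g f C B A assume "g \<in> Hom (op_lincat D) C B" "f \<in> Hom (op_lincat D) B A"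
    then have f: "f \<in> Hom D A B" and g: "g \<in> Hom D B C" by (simp_all add: Hom_op)
    have gf: "g \<cdot>\<^bsub>D\<^esub> f \<in> Hom D A C" using category.Cmp_in[OF category_D f g] .
    obtain u where u: "FA (yoneda X) f = (FO (yoneda X) B, u, FO (yoneda X) A)"
      using yoneda_arr[OF X f] unfolding Hom_module_cat by blast
    obtain v where v: "FA (yoneda X) g = (FO (yoneda X) C, v, FO (yoneda X) B)"
      using yoneda_arr[OF X g] unfolding Hom_module_cat by blast
    show "FA (yoneda X) (f \<cdot>\<^bsub>op_lincat D\<^esub> g) = FA (yoneda X) f \<cdot>\<^bsub>module_cat TYPE('v) K\<^esub> FA (yoneda X) g"
      unfolding op_lincat_simps
    proof (rule yoneda_arr_eqI[OF X gf, where h = "compose (e ` Hom Q C X) u v"])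
      show "FA (yoneda X) f \<cdot>\<^bsub>module_cat TYPE('v) K\<^esub> FA (yoneda X) g
          = (FO (yoneda X) C, compose (e ` Hom Q C X) u v, FO (yoneda X) A)"
        unfolding u v by (simp add: module_cat_def carrier_yoneda)
      fix a assume a: "a \<in> Hom Q C X"
      show "compose (e ` Hom Q C X) u v (e a) = e (a \<bullet> (g \<cdot>\<^bsub>D\<^esub> f))"
        using yoneda_map[OF g a] yoneda_map[OF f Cmp_in[OF D_Q[OF g] a]] u v a Cmp_D[OF f g]
          Cmp_assoc[OF D_Q[OF f] D_Q[OF g] a] by (simp add: compose_def)
    qed simp
  qed
next
  fix B A f g assume "f \<in> Hom (op_lincat D) B A" "g \<in> Hom (op_lincat D) B A"
  then have f: "f \<in> Hom D A B" and g: "g \<in> Hom D A B" by (simp_all add: Hom_op)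
  have fg: "Add D f g \<in> Hom D A B"
    using Add_in[OF D_Q[OF f] D_Q[OF g]] Add_D[OF f g] Q_D D_objs[OF f] by simp
  obtain u where u: "FA (yoneda X) f = (FO (yoneda X) B, u, FO (yoneda X) A)"
    using yoneda_arr[OF X f] unfolding Hom_module_cat by blast
  obtain v where v: "FA (yoneda X) g = (FO (yoneda X) B, v, FO (yoneda X) A)"
    using yoneda_arr[OF X g] unfolding Hom_module_cat by blast
  show "FA (yoneda X) (Add (op_lincat D) f g) = Add (module_cat TYPE('v) K) (FA (yoneda X) f) (FA (yoneda X) g)"
    unfolding op_lincat_simps
  proof (rule yoneda_arr_eqI[OF X fg, where h = "\<lambda>x \<in> e ` Hom Q B X. u x \<oplus>\<^bsub>FO (yoneda X) A\<^esub> v x"])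
    show "Add (module_cat TYPE('v) K) (FA (yoneda X) f) (FA (yoneda X) g)
        = (FO (yoneda X) B, \<lambda>x \<in> e ` Hom Q B X. u x \<oplus>\<^bsub>FO (yoneda X) A\<^esub> v x, FO (yoneda X) A)"
      unfolding u v by (simp add: module_cat_def carrier_yoneda)
    fix a assume a: "a \<in> Hom Q B X"
    show "(\<lambda>x \<in> e ` Hom Q B X. u x \<oplus>\<^bsub>FO (yoneda X) A\<^esub> v x) (e a) = e (a \<bullet> Add D f g)"
      using yoneda_map[OF f a] yoneda_map[OF g a] u v a Add_D[OF f g] Cmp_Add_right[OF D_Q[OF f] D_Q[OF g] a]
        add_yoneda[OF Cmp_in[OF D_Q[OF f] a] Cmp_in[OF D_Q[OF g] a]] by simp
  qed simp
qed

lemma postcompose_nat_trans: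
  assumes h: "h \<in> Hom Q X Y" shows "module_nat_trans K D (yoneda X) (yoneda Y) (postcompose h)"
  unfolding module_nat_trans_def
proof (intro conjI ballI)
  fix A assume "A \<in> Obj D"
  show "postcompose h A \<in> module_maps K (FO (yoneda X) A) (FO (yoneda Y) A)"
  proof (rule module_mapsI)
    fix x assume "x \<in> carrier (FO (yoneda X) A)"
    then obtain a where a: "a \<in> Hom Q A X" "x = e a" by (auto simp: carrier_yoneda)
    then show "postcompose h A x \<in> carrier (FO (yoneda Y) A)"
      using Cmp_in[OF a(1) h] by (simp add: postcompose_e carrier_yoneda)
  next
    fix x y assume "x \<in> carrier (FO (yoneda X) A)" "y \<in> carrier (FO (yoneda X) A)"
    then obtain a b where a: "a \<in> Hom Q A X" "x = e a" and b: "b \<in> Hom Q A X" "y = e b" by (auto simp: carrier_yoneda)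
    then show "postcompose h A (x \<oplus>\<^bsub>FO (yoneda X) A\<^esub> y) = postcompose h A x \<oplus>\<^bsub>FO (yoneda Y) A\<^esub> postcompose h A y"
      using Cmp_Add_right[OF a(1) b(1) h] Cmp_in[OF a(1) h] Cmp_in[OF b(1) h] Add_in[OF a(1) b(1)]
      by (simp add: postcompose_e add_yoneda)
  next
    fix k x assume k: "k \<in> carrier K" and "x \<in> carrier (FO (yoneda X) A)"
    then obtain a where a: "a \<in> Hom Q A X" "x = e a" by (auto simp: carrier_yoneda)
    then show "postcompose h A (k \<odot>\<^bsub>FO (yoneda X) A\<^esub> x) = k \<odot>\<^bsub>FO (yoneda Y) A\<^esub> postcompose h A x"
      using Cmp_Scal_right[OF k a(1) h] Cmp_in[OF a(1) h] Scal_in[OF k a(1)]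
      by (simp add: postcompose_e smult_yoneda)
  qed
next
  fix f x assume "f \<in> Arr D" and "x \<in> carrier (FO (yoneda X) (Cod D f))"
  then obtain a where a: "a \<in> Hom Q (Cod D f) X" "x = e a" by (auto simp: carrier_yoneda)
  have f: "f \<in> Hom D (Dom D f) (Cod D f)" using \<open>f \<in> Arr D\<close> by (simp add: Arr_Hom)
  show "postcompose h (Dom D f) (arr_map (FA (yoneda X) f) x) = arr_map (FA (yoneda Y) f) (postcompose h (Cod D f) x)"
    using a Cmp_in[OF a(1) h] Cmp_in[OF D_Q[OF f] a(1)] Cmp_assoc[OF D_Q[OF f] a(1) h]
    by (simp add: yoneda_map[OF f] postcompose_e)
qed

text \<open>The sequence \<open>C1 \<rightarrow> C0 \<rightarrow> X\<close> becomes right exact after applying \<open>Hom\<^bsub>Q\<^esub>(A, -)\<close> for every object \<open>A\<close> of \<open>D\<close>. In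
  other words, it induces a presentation of the functor \<open>yoneda X\<close> by representables.\<close>

definition presents :: "'o \<Rightarrow> 'o \<Rightarrow> 'o \<Rightarrow> 'n \<Rightarrow> 'n \<Rightarrow> bool" where
  "presents X C\<^sub>0 C\<^sub>1 g x \<longleftrightarrow> C\<^sub>0 \<in> Obj D \<and> C\<^sub>1 \<in> Obj D \<and> g \<in> Hom Q C\<^sub>1 C\<^sub>0 \<and> x \<in> Hom Q C\<^sub>0 X \<and>
     (\<forall>A \<in> Obj D. (\<forall>a \<in> Hom Q A X. \<exists>b \<in> Hom Q A C\<^sub>0. a = x \<bullet> b) \<and>
        (\<forall>b \<in> Hom Q A C\<^sub>0. x \<bullet> b = Zero Q A X \<longleftrightarrow> (\<exists>c \<in> Hom Q A C\<^sub>1. b = g \<bullet> c)))"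

text \<open>Exactness at the middle term, applied to the identity of \<open>C1\<close>.\<close>

lemma presents_composite_zero:
  assumes "presents X C\<^sub>0 C\<^sub>1 g x" shows "x \<bullet> g = Zero Q C\<^sub>1 X"
proof -
  have g: "g \<in> Hom Q C\<^sub>1 C\<^sub>0" "C\<^sub>1 \<in> Obj D" using assms by (auto simp: presents_def)
  have "g = g \<bullet> Idn Q C\<^sub>1" "Idn Q C\<^sub>1 \<in> Hom Q C\<^sub>1 C\<^sub>1" using Idn_right[OF g(1)] Idn_in[OF Obj_D[OF g(2)]] by auto
  then show ?thesis using assms g unfolding presents_def by blast
qed

lemma yoneda_fp:
  assumes X: "X \<in> Obj Q" and p: "presents X C\<^sub>0 C\<^sub>1 g x"
  shows "finitely_presented K D (yoneda X)"
proof -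
  have C: "C\<^sub>0 \<in> Obj D" "C\<^sub>1 \<in> Obj D" and g: "g \<in> Hom Q C\<^sub>1 C\<^sub>0" and x: "x \<in> Hom Q C\<^sub>0 X"
    using p by (auto simp: presents_def)
  have Hf: "carrier (FO (hom_functor D C) A) = Hom D A C"
    "a \<oplus>\<^bsub>FO (hom_functor D C) A\<^esub> b = Add D a b" "k \<odot>\<^bsub>FO (hom_functor D C) A\<^esub> a = Scal D k a" for C A a b k
    by (simp_all add: hom_functor_def hom_module_def)
  have \<eta>: "module_nat_trans K D (hom_functor D C\<^sub>1) (hom_functor D C\<^sub>0) (\<lambda>A c. g \<bullet> c)"
    unfolding module_nat_trans_def
  proof (intro conjI ballI module_mapsI)
    fix A c assume A: "A \<in> Obj D" and "c \<in> carrier (FO (hom_functor D C\<^sub>1) A)"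
    then have c: "c \<in> Hom Q A C\<^sub>1" using D_Q by (simp add: Hf)
    show "g \<bullet> c \<in> carrier (FO (hom_functor D C\<^sub>0) A)"
      using Cmp_in[OF c g] Q_D A C by (simp add: Hf)
  next
    fix A c c' assume A: "A \<in> Obj D" and "c \<in> carrier (FO (hom_functor D C\<^sub>1) A)" "c' \<in> carrier (FO (hom_functor D C\<^sub>1) A)"
    then have c: "c \<in> Hom D A C\<^sub>1" "c' \<in> Hom D A C\<^sub>1" by (simp_all add: Hf)
    note c' = c[THEN D_Q]
    have "g \<bullet> c \<in> Hom D A C\<^sub>0" "g \<bullet> c' \<in> Hom D A C\<^sub>0" using Cmp_in[OF _ g] c' Q_D A C by auto
    then show "g \<bullet> (c \<oplus>\<^bsub>FO (hom_functor D C\<^sub>1) A\<^esub> c') = (g \<bullet> c) \<oplus>\<^bsub>FO (hom_functor D C\<^sub>0) A\<^esub> (g \<bullet> c')"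
      using Add_D[OF c] Cmp_Add_right[OF c' g] Add_D by (simp add: Hf)
  next
    fix A k c assume A: "A \<in> Obj D" and k: "k \<in> carrier K" and "c \<in> carrier (FO (hom_functor D C\<^sub>1) A)"
    then have c: "c \<in> Hom D A C\<^sub>1" by (simp_all add: Hf)
    have "g \<bullet> c \<in> Hom D A C\<^sub>0" using Cmp_in[OF D_Q[OF c] g] Q_D A C by auto
    then show "g \<bullet> (k \<odot>\<^bsub>FO (hom_functor D C\<^sub>1) A\<^esub> c) = k \<odot>\<^bsub>FO (hom_functor D C\<^sub>0) A\<^esub> (g \<bullet> c)"
      using Scal_D[OF k c] Cmp_Scal_right[OF k D_Q[OF c] g] Scal_D[OF k] by (simp add: Hf)
  next
    fix f c assume "f \<in> Arr D" and "c \<in> carrier (FO (hom_functor D C\<^sub>1) (Cod D f))"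
    then have f: "f \<in> Hom D (Dom D f) (Cod D f)" and c: "c \<in> Hom D (Cod D f) C\<^sub>1" by (simp_all add: Hf Arr_Hom)
    have gc: "g \<bullet> c \<in> Hom D (Cod D f) C\<^sub>0" using Cmp_in[OF D_Q[OF c] g] Q_D D_objs(1)[OF c] C by auto
    show "g \<bullet> arr_map (FA (hom_functor D C\<^sub>1) f) c = arr_map (FA (hom_functor D C\<^sub>0) f) (g \<bullet> c)"
      using c gc Cmp_D[OF f c] Cmp_D[OF f gc] Cmp_assoc[OF D_Q[OF f] D_Q[OF c] g] by (simp add: hom_functor_def)
  qed
  have \<theta>: "module_nat_trans K D (hom_functor D C\<^sub>0) (yoneda X) (\<lambda>A b. e (x \<bullet> b))"
    unfolding module_nat_trans_def
  proof (intro conjI ballI module_mapsI)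
    fix A c assume A: "A \<in> Obj D" and "c \<in> carrier (FO (hom_functor D C\<^sub>0) A)"
    then have c: "c \<in> Hom Q A C\<^sub>0" using D_Q by (simp add: Hf)
    show "e (x \<bullet> c) \<in> carrier (FO (yoneda X) A)" using Cmp_in[OF c x] by (simp add: carrier_yoneda)
  next
    fix A c c' assume A: "A \<in> Obj D" and "c \<in> carrier (FO (hom_functor D C\<^sub>0) A)" "c' \<in> carrier (FO (hom_functor D C\<^sub>0) A)"
    then have c: "c \<in> Hom D A C\<^sub>0" "c' \<in> Hom D A C\<^sub>0" by (simp_all add: Hf)
    note c' = c[THEN D_Q]
    show "e (x \<bullet> (c \<oplus>\<^bsub>FO (hom_functor D C\<^sub>0) A\<^esub> c')) = e (x \<bullet> c) \<oplus>\<^bsub>FO (yoneda X) A\<^esub> e (x \<bullet> c')"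
      using Add_D[OF c] Cmp_Add_right[OF c' x] add_yoneda[OF Cmp_in[OF c'(1) x] Cmp_in[OF c'(2) x]] by (simp add: Hf)
  next
    fix A k c assume A: "A \<in> Obj D" and k: "k \<in> carrier K" and "c \<in> carrier (FO (hom_functor D C\<^sub>0) A)"
    then have c: "c \<in> Hom D A C\<^sub>0" by (simp_all add: Hf)
    show "e (x \<bullet> (k \<odot>\<^bsub>FO (hom_functor D C\<^sub>0) A\<^esub> c)) = k \<odot>\<^bsub>FO (yoneda X) A\<^esub> e (x \<bullet> c)"
      using Scal_D[OF k c] Cmp_Scal_right[OF k D_Q[OF c] x] smult_yoneda[OF Cmp_in[OF D_Q[OF c] x]] by (simp add: Hf)
  next
    fix f c assume "f \<in> Arr D" and "c \<in> carrier (FO (hom_functor D C\<^sub>0) (Cod D f))"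
    then have f: "f \<in> Hom D (Dom D f) (Cod D f)" and c: "c \<in> Hom D (Cod D f) C\<^sub>0" by (simp_all add: Hf Arr_Hom)
    show "e (x \<bullet> arr_map (FA (hom_functor D C\<^sub>0) f) c) = arr_map (FA (yoneda X) f) (e (x \<bullet> c))"
      using c Cmp_D[OF f c] yoneda_map[OF f Cmp_in[OF D_Q[OF c] x]] Cmp_assoc[OF D_Q[OF f] D_Q[OF c] x]
      by (simp add: hom_functor_def)
  qed
  have ex: "(\<lambda>c. g \<bullet> c) ` Hom D A C\<^sub>1 = {b \<in> Hom D A C\<^sub>0. e (x \<bullet> b) = \<zero>\<^bsub>FO (yoneda X) A\<^esub>}"
    "(\<lambda>b. e (x \<bullet> b)) ` Hom D A C\<^sub>0 = carrier (FO (yoneda X) A)" if A: "A \<in> Obj D" for A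
  proof -
    have p1: "a \<in> Hom Q A X \<Longrightarrow> \<exists>b \<in> Hom Q A C\<^sub>0. a = x \<bullet> b" for a
      using p A unfolding presents_def by blast
    have p2: "b \<in> Hom Q A C\<^sub>0 \<Longrightarrow> x \<bullet> b = Zero Q A X \<longleftrightarrow> (\<exists>c \<in> Hom Q A C\<^sub>1. b = g \<bullet> c)" for b
      using p A unfolding presents_def by blast
    have h: "Hom D A C\<^sub>1 = Hom Q A C\<^sub>1" "Hom D A C\<^sub>0 = Hom Q A C\<^sub>0" using Hom_D A C by auto
    have z: "e (x \<bullet> b) = \<zero>\<^bsub>FO (yoneda X) A\<^esub> \<longleftrightarrow> x \<bullet> b = Zero Q A X" if "b \<in> Hom Q A C\<^sub>0" for b
      using e_eq_iff[OF Cmp_in[OF that x] Zero_in[OF Obj_D[OF A] X]] by (simp add: zero_yoneda)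
    show "(\<lambda>c. g \<bullet> c) ` Hom D A C\<^sub>1 = {b \<in> Hom D A C\<^sub>0. e (x \<bullet> b) = \<zero>\<^bsub>FO (yoneda X) A\<^esub>}"
      unfolding h using z p2 Cmp_in[OF _ g] by blast
    show "(\<lambda>b. e (x \<bullet> b)) ` Hom D A C\<^sub>0 = carrier (FO (yoneda X) A)"
      unfolding h carrier_yoneda using p1 Cmp_in[OF _ x] by (auto simp: image_def)
  qed
  show ?thesis unfolding finitely_presented_def using C \<eta> \<theta> ex
    by (intro bexI[of _ C\<^sub>0] bexI[of _ C\<^sub>1] exI[of _ "\<lambda>A c. g \<bullet> c"] exI[of _ "\<lambda>A b. e (x \<bullet> b)"]) simp_all
qed

end

section \<open>Localisation of a category with functorial presentations\<close>

text \<open>The properties of \<open>Q = B/T\<close> and its syzygies that make the restricted Yoneda functor a localisation.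
  Objects have presentations by objects of \<open>D\<close> that start with an epimorphism, morphisms of
  \<open>D\<close> have weak cokernels that compute the cokernel of the represented functors, and objects of \<open>D\<close> lift along
  epimorphisms of \<open>Q\<close>.\<close>

locale presented_category = restricted_hom K Q D e
  for K :: "('k, 'r) ring_scheme" and Q :: "('o, 'n, 'k, 'y) lincat_scheme"
    and D :: "('o, 'n, 'k, 'z) lincat_scheme" and e :: "'n \<Rightarrow> 'v" +
  assumes presentation: "X \<in> Obj Q \<Longrightarrow> \<exists>C\<^sub>0 C\<^sub>1 g x. presents X C\<^sub>0 C\<^sub>1 g x \<and>
      (\<forall>Y \<in> Obj Q. \<forall>h \<in> Hom Q X Y. h \<bullet> x = Zero Q C\<^sub>0 Y \<longrightarrow> h = Zero Q X Y)"
    and weak_cokernel: "\<lbrakk>C\<^sub>0 \<in> Obj D; C\<^sub>1 \<in> Obj D; g \<in> Hom Q C\<^sub>1 C\<^sub>0\<rbrakk> \<Longrightarrow> \<exists>W \<in> Obj Q. \<exists>i. presents W C\<^sub>0 C\<^sub>1 g i \<and>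
      (\<forall>Y \<in> Obj Q. \<forall>y \<in> Hom Q C\<^sub>0 Y. y \<bullet> g = Zero Q C\<^sub>1 Y \<longrightarrow> (\<exists>h \<in> Hom Q W Y. h \<bullet> i = y))"
    and lift_along_epi: "\<lbrakk>f \<in> Hom Q X Y; is_epi Q f; A \<in> Obj D; a \<in> Hom Q A Y\<rbrakk> \<Longrightarrow> \<exists>b \<in> Hom Q A X. f \<bullet> b = a"
begin

lemma yoneda_Obj: assumes "X \<in> Obj Q" shows "yoneda X \<in> Obj fp.Fp"
proof -
  obtain C\<^sub>0 C\<^sub>1 g x where "presents X C\<^sub>0 C\<^sub>1 g x" using presentation[OF assms] by blast
  then show ?thesis using yoneda_additive[OF assms] yoneda_fp[OF assms] by (simp add: fp.Obj_Fp)
qed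

definition yoneda_functor ::
    "('o, 'n, ('o, 'n, ('k, 'v) module, ('k, 'v) module_arr) func,
      ('o, 'n, ('k, 'v) module, ('k, 'v) module_arr) func \<times> ('o \<Rightarrow> ('k, 'v) module_arr) \<times>
      ('o, 'n, ('k, 'v) module, ('k, 'v) module_arr) func) func" where
  "yoneda_functor = \<lparr>FO = yoneda, FA = (\<lambda>h. nat_arr D (yoneda (Dom Q h)) (yoneda (Cod Q h)) (postcompose h))\<rparr>"

lemma FA_yoneda: "h \<in> Hom Q X Y \<Longrightarrow> FA yoneda_functor h = nat_arr D (yoneda X) (yoneda Y) (postcompose h)"
  by (simp add: yoneda_functor_def Hom_def)

lemma FO_yoneda: "FO yoneda_functor = yoneda"
  by (simp add: yoneda_functor_def)

lemma postcompose_comp: assumes "f \<in> Hom Q X Y" "g \<in> Hom Q Y Z"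
  shows "nat_arr D (yoneda X) F (postcompose (g \<bullet> f)) = nat_arr D (yoneda X) F (\<lambda>A. postcompose g A \<circ> postcompose f A)"
  unfolding fp.nat_arr_eq_iff carrier_yoneda
proof (intro ballI)
  fix A x assume "x \<in> e ` Hom Q A X"
  then obtain a where a: "a \<in> Hom Q A X" "x = e a" by blast
  show "postcompose (g \<bullet> f) A x = (postcompose g A \<circ> postcompose f A) x"
    using a Cmp_in[OF a(1) assms(1)] Cmp_assoc[OF a(1) assms] by (simp add: postcompose_e)
qed

lemma yoneda_is_functor: "is_functor Q fp.Fp yoneda_functor"
proof (rule is_functorI)
  fix X assume X: "X \<in> Obj Q"
  then show "FO yoneda_functor X \<in> Obj fp.Fp" by (simp add: FO_yoneda yoneda_Obj)
  show "FA yoneda_functor (Idn Q X) = Idn fp.Fp (FO yoneda_functor X)"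
    unfolding FO_yoneda FA_yoneda[OF Idn_in[OF X]] fp.Fp_Idn fp.nat_arr_eq_iff carrier_yoneda
    by (auto simp: postcompose_e Idn_left)
next
  fix f X Y assume f: "f \<in> Hom Q X Y"
  show "FA yoneda_functor f \<in> Hom fp.Fp (FO yoneda_functor X) (FO yoneda_functor Y)"
    unfolding FO_yoneda FA_yoneda[OF f]
    by (rule fp.nat_arr_in[OF yoneda_Obj[OF Hom_Dom[OF f]] yoneda_Obj[OF Hom_Cod[OF f]] postcompose_nat_trans[OF f]])
next
  fix f g X Y Z assume f: "f \<in> Hom Q X Y" and g: "g \<in> Hom Q Y Z"
  show "FA yoneda_functor (g \<bullet> f) = FA yoneda_functor g \<cdot>\<^bsub>fp.Fp\<^esub> FA yoneda_functor f"
    by (simp add: FA_yoneda[OF f] FA_yoneda[OF g] FA_yoneda[OF Cmp_in[OF f g]] fp.nat_arr_Cmp[OF postcompose_nat_trans[OF f]]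
        postcompose_comp[OF f g])
qed

text \<open>The epimorphism at the start of a presentation of \<open>X\<close> has its source in \<open>D\<close>.\<close>

lemma determined_on_D:
  assumes f: "f \<in> Hom Q X Y" and g: "g \<in> Hom Q X Y"
    and eq: "\<And>A a. \<lbrakk>A \<in> Obj D; a \<in> Hom Q A X\<rbrakk> \<Longrightarrow> f \<bullet> a = g \<bullet> a"
  shows "f = g"
proof -
  have o: "X \<in> Obj Q" "Y \<in> Obj Q" using Hom_Dom[OF f] Hom_Cod[OF f] .
  obtain C\<^sub>0 C\<^sub>1 p x where pr: "presents X C\<^sub>0 C\<^sub>1 p x"
    and epi: "\<And>h. \<lbrakk>h \<in> Hom Q X Y; h \<bullet> x = Zero Q C\<^sub>0 Y\<rbrakk> \<Longrightarrow> h = Zero Q X Y"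
    using presentation[OF o(1)] o(2) by blast
  have x: "C\<^sub>0 \<in> Obj D" "x \<in> Hom Q C\<^sub>0 X" using pr by (auto simp: presents_def)
  obtain h where h: "h \<in> Hom Q X Y" "f = Add Q g h" using diff_ex[OF f g] by blast
  have "Add Q (g \<bullet> x) (h \<bullet> x) = g \<bullet> x"
    using eq[OF x] Cmp_Add_left[OF x(2) g h(1)] h(2) by simp
  then have "h = Zero Q X Y"
    using epi[OF h(1)] Add_eq_self[OF Cmp_in[OF x(2) g] Cmp_in[OF x(2) h(1)]] by simp
  then show ?thesis using h(2) Add_Zero_right[OF g] by simp
qed

lemma yoneda_faithful:
  assumes f: "f \<in> Hom Q X Y" and g: "g \<in> Hom Q X Y" and eq: "FA yoneda_functor f = FA yoneda_functor g"
  shows "f = g"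
proof (rule determined_on_D[OF f g])
  fix A a assume A: "A \<in> Obj D" and a: "a \<in> Hom Q A X"
  have "postcompose f A (e a) = postcompose g A (e a)"
    using eq A a unfolding FA_yoneda[OF f] FA_yoneda[OF g] fp.nat_arr_eq_iff carrier_yoneda by blast
  then show "f \<bullet> a = g \<bullet> a"
    using e_eq_iff[OF Cmp_in[OF a f] Cmp_in[OF a g]] by (simp add: postcompose_e[OF a])
qed

text \<open>Cancellation of \<open>r\<close> gives injectivity and lifting along \<open>r\<close> gives surjectivity of the induced maps.\<close>

lemma mono_epi_inverted:
  assumes r: "r \<in> mono_epis Q" shows "is_iso fp.Fp (FA yoneda_functor r)"
proof -
  have m: "is_mono Q r" and ep: "is_epi Q r" using r by (auto simp: mono_epis_def)
  then obtain X Y where r: "r \<in> Hom Q X Y" using Arr_Hom[of r Q] by (auto simp: is_mono_def)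
  have o: "X \<in> Obj Q" "Y \<in> Obj Q" using Hom_Dom[OF r] Hom_Cod[OF r] .
  show ?thesis unfolding FA_yoneda[OF r]
  proof (rule fp.nat_arr_iso[OF yoneda_Obj[OF o(1)] yoneda_Obj[OF o(2)] postcompose_nat_trans[OF r]])
    fix A assume A: "A \<in> Obj D"
    have mono: "a = b" if "a \<in> Hom Q A X" "b \<in> Hom Q A X" "r \<bullet> a = r \<bullet> b" for a b
      using m HomD[OF r] Obj_D[OF A] that unfolding is_mono_def by blast
    show "bij_betw (postcompose r A) (carrier (FO (yoneda X) A)) (carrier (FO (yoneda Y) A))"
      unfolding bij_betw_def carrier_yoneda
    proof
      show "inj_on (postcompose r A) (e ` Hom Q A X)"
      proof (rule inj_onI)
        fix x y assume "x \<in> e ` Hom Q A X" "y \<in> e ` Hom Q A X" and eq: "postcompose r A x = postcompose r A y"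
        then obtain a b where a: "a \<in> Hom Q A X" "x = e a" and b: "b \<in> Hom Q A X" "y = e b" by blast
        then have "r \<bullet> a = r \<bullet> b"
          using eq e_eq_iff[OF Cmp_in[OF a(1) r] Cmp_in[OF b(1) r]] by (simp add: postcompose_e)
        then show "x = y" using mono[OF a(1) b(1)] a b by simp
      qed
      show "postcompose r A ` e ` Hom Q A X = e ` Hom Q A Y"
      proof
        show "postcompose r A ` e ` Hom Q A X \<subseteq> e ` Hom Q A Y" using Cmp_in[OF _ r] by (auto simp: postcompose_e)
        show "e ` Hom Q A Y \<subseteq> postcompose r A ` e ` Hom Q A X"
        proof
          fix y assume "y \<in> e ` Hom Q A Y"
          then obtain a where a: "a \<in> Hom Q A Y" "y = e a" by blast
          obtain b where b: "b \<in> Hom Q A X" "r \<bullet> b = a" using lift_along_epi[OF r ep A a(1)] by blast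
          then have "y = postcompose r A (e b)" using a by (simp add: postcompose_e)
          then show "y \<in> postcompose r A ` e ` Hom Q A X" using b(1) by blast
        qed
      qed
    qed
  qed
qed

text \<open>The Yoneda lemma in stages. A transformation \<open>\<psi>\<close> out of \<open>yoneda W\<close> is determined by \<open>y = \<psi>(i)\<close>, because every
  element of \<open>yoneda W\<close> is \<open>i b\<close> for some \<open>b\<close> in \<open>D\<close>. By naturality \<open>y g = \<psi>(i g) = 0\<close>, hence the
  weak cokernel property provides \<open>h\<close> with \<open>h i = y\<close>.\<close>

lemma full_from_weak_cokernel:
  assumes W: "W \<in> Obj Q" and Y: "Y \<in> Obj Q" and p: "presents W C\<^sub>0 C\<^sub>1 g i"
    and wc: "\<And>y. \<lbrakk>y \<in> Hom Q C\<^sub>0 Y; y \<bullet> g = Zero Q C\<^sub>1 Y\<rbrakk> \<Longrightarrow> \<exists>h \<in> Hom Q W Y. h \<bullet> i = y"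
    and \<phi>: "\<phi> \<in> Hom fp.Fp (yoneda W) (yoneda Y)"
  shows "\<exists>h \<in> Hom Q W Y. FA yoneda_functor h = \<phi>"
proof -
  have C: "C\<^sub>0 \<in> Obj D" "C\<^sub>1 \<in> Obj D" and g: "g \<in> Hom Q C\<^sub>1 C\<^sub>0" and i: "i \<in> Hom Q C\<^sub>0 W"
    and sur: "\<And>A a. \<lbrakk>A \<in> Obj D; a \<in> Hom Q A W\<rbrakk> \<Longrightarrow> \<exists>b \<in> Hom Q A C\<^sub>0. a = i \<bullet> b"
    using p by (auto simp: presents_def)
  obtain \<psi> where \<psi>: "module_nat_trans K D (yoneda W) (yoneda Y) \<psi>"
    and \<phi>_eq: "\<phi> = nat_arr D (yoneda W) (yoneda Y) \<psi>" using fp.nat_arr_cases[OF \<phi>] .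
  have \<psi>m: "\<psi> A \<in> module_maps K (FO (yoneda W) A) (FO (yoneda Y) A)" if "A \<in> Obj D" for A
    using \<psi> that by (simp add: module_nat_trans_def)
  have nat: "\<psi> A (e (a \<bullet> f)) = arr_map (FA (yoneda Y) f) (\<psi> B (e a))" if f: "f \<in> Hom D A B" and a: "a \<in> Hom Q B W" for f a A B
  proof -
    have "f \<in> Arr D" "Dom D f = A" "Cod D f = B" using f by (auto simp: Hom_def)
    moreover have "e a \<in> carrier (FO (yoneda W) B)" using a by (simp add: carrier_yoneda)
    ultimately have "\<psi> A (arr_map (FA (yoneda W) f) (e a)) = arr_map (FA (yoneda Y) f) (\<psi> B (e a))"
      using \<psi> unfolding module_nat_trans_def by blast
    then show ?thesis by (simp add: yoneda_map[OF f a])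
  qed
  have "\<psi> C\<^sub>0 (e i) \<in> e ` Hom Q C\<^sub>0 Y"
    using module_mapsD(1)[OF \<psi>m[OF C(1)], of "e i"] i by (simp add: carrier_yoneda)
  then obtain y where y: "y \<in> Hom Q C\<^sub>0 Y" "\<psi> C\<^sub>0 (e i) = e y" by blast
  have "e (y \<bullet> g) = \<psi> C\<^sub>1 (e (i \<bullet> g))"
    using nat[OF Q_D[OF g C(2,1)] i] yoneda_map[OF Q_D[OF g C(2,1)] y(1)] y(2) by simp
  also have "\<dots> = e (Zero Q C\<^sub>1 Y)"
    using module_maps_zero[OF module_yoneda module_yoneda \<psi>m[OF C(2)]] Obj_D[OF C(2)] W Y
    by (simp add: presents_composite_zero[OF p] zero_yoneda)
  finally have "y \<bullet> g = Zero Q C\<^sub>1 Y"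
    using e_eq_iff[OF Cmp_in[OF g y(1)] Zero_in[OF Obj_D[OF C(2)] Y]] by simp
  then obtain h where h: "h \<in> Hom Q W Y" "h \<bullet> i = y" using wc[OF y(1)] by blast
  have "FA yoneda_functor h = \<phi>"
    unfolding FA_yoneda[OF h(1)] \<phi>_eq fp.nat_arr_eq_iff carrier_yoneda
  proof (intro ballI)
    fix A x assume A: "A \<in> Obj D" and "x \<in> e ` Hom Q A W"
    then obtain a where a: "a \<in> Hom Q A W" "x = e a" by blast
    obtain b where b: "b \<in> Hom Q A C\<^sub>0" "a = i \<bullet> b" using sur[OF A a(1)] by blast
    have "\<psi> A x = e (y \<bullet> b)"
      using nat[OF Q_D[OF b(1) A C(1)] i] yoneda_map[OF Q_D[OF b(1) A C(1)] y(1)] a b y(2) by simp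
    then show "postcompose h A x = \<psi> A x"
      using a b h(2) Cmp_assoc[OF b(1) i h(1)] by (simp add: postcompose_e)
  qed
  then show ?thesis using h(1) by blast
qed

text \<open>Take a presentation of \<open>X\<close> and the weak cokernel \<open>W\<close> of its first map. Then \<open>W\<close> and \<open>X\<close> are presented by
  the same morphism \<open>g\<close>, so the comparison \<open>w : W \<rightarrow> X\<close> is bijective on morphisms from \<open>D\<close>. Since these detect
  equality of morphisms, \<open>w\<close> can be cancelled on both sides.\<close>

lemma cover_by_weak_cokernel:
  assumes X: "X \<in> Obj Q"
  shows "\<exists>W. \<exists>w \<in> Hom Q W X. w \<in> mono_epis Q \<and>
    (\<forall>Y \<in> Obj Q. \<forall>\<phi> \<in> Hom fp.Fp (yoneda W) (yoneda Y). \<exists>h \<in> Hom Q W Y. FA yoneda_functor h = \<phi>)"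
proof -
  obtain C\<^sub>0 C\<^sub>1 g x where p: "presents X C\<^sub>0 C\<^sub>1 g x" using presentation[OF X] by blast
  have C: "C\<^sub>0 \<in> Obj D" "C\<^sub>1 \<in> Obj D" and g: "g \<in> Hom Q C\<^sub>1 C\<^sub>0" and x: "x \<in> Hom Q C\<^sub>0 X"
    and sur: "\<And>A a. \<lbrakk>A \<in> Obj D; a \<in> Hom Q A X\<rbrakk> \<Longrightarrow> \<exists>b \<in> Hom Q A C\<^sub>0. a = x \<bullet> b"
    and ker: "\<And>A b. \<lbrakk>A \<in> Obj D; b \<in> Hom Q A C\<^sub>0; x \<bullet> b = Zero Q A X\<rbrakk> \<Longrightarrow> \<exists>c \<in> Hom Q A C\<^sub>1. b = g \<bullet> c"
    using p by (auto simp: presents_def)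
  obtain W i where W: "W \<in> Obj Q" and pW: "presents W C\<^sub>0 C\<^sub>1 g i"
    and wc: "\<And>Y y. \<lbrakk>Y \<in> Obj Q; y \<in> Hom Q C\<^sub>0 Y; y \<bullet> g = Zero Q C\<^sub>1 Y\<rbrakk> \<Longrightarrow> \<exists>h \<in> Hom Q W Y. h \<bullet> i = y"
    using weak_cokernel[OF C g] by blast
  have i: "i \<in> Hom Q C\<^sub>0 W"
    and surW: "\<And>A a. \<lbrakk>A \<in> Obj D; a \<in> Hom Q A W\<rbrakk> \<Longrightarrow> \<exists>b \<in> Hom Q A C\<^sub>0. a = i \<bullet> b"
    using pW by (auto simp: presents_def)
  obtain w where w: "w \<in> Hom Q W X" "w \<bullet> i = x" using wc[OF X x presents_composite_zero[OF p]] by blast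
  have inj: "a = a'" if A: "A \<in> Obj D" and a: "a \<in> Hom Q A W" "a' \<in> Hom Q A W" and eq: "w \<bullet> a = w \<bullet> a'" for A a a'
  proof -
    obtain k where k: "k \<in> Hom Q A W" "a = Add Q a' k" using diff_ex[OF a] by blast
    obtain b where b: "b \<in> Hom Q A C\<^sub>0" "k = i \<bullet> b" using surW[OF A k(1)] by blast
    have "Add Q (w \<bullet> a') (w \<bullet> k) = w \<bullet> a'" using eq k Cmp_Add_right[OF a(2) k(1) w(1)] by simp
    then have "w \<bullet> k = Zero Q A X" using Add_eq_self[OF Cmp_in[OF a(2) w(1)] Cmp_in[OF k(1) w(1)]] by simp
    then have "x \<bullet> b = Zero Q A X" using b w(2) Cmp_assoc[OF b(1) i w(1)] by simp
    then obtain c where c: "c \<in> Hom Q A C\<^sub>1" "b = g \<bullet> c" using ker[OF A b(1)] by blast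
    have "k = Zero Q A W"
      using b(2) c Cmp_assoc[OF c(1) g i] presents_composite_zero[OF pW] Cmp_Zero_left[OF c(1) W] by simp
    then show "a = a'" using k(2) Add_Zero_right[OF a(2)] by simp
  qed
  have surj: "\<exists>a' \<in> Hom Q A W. a = w \<bullet> a'" if A: "A \<in> Obj D" and a: "a \<in> Hom Q A X" for A a
  proof -
    obtain b where b: "b \<in> Hom Q A C\<^sub>0" "a = x \<bullet> b" using sur[OF A a] by blast
    have "a = w \<bullet> (i \<bullet> b)" using b(2) Cmp_assoc[OF b(1) i w(1)] w(2) by simp
    then show ?thesis using Cmp_in[OF b(1) i] by blast
  qed
  have "is_mono Q w"
    unfolding is_mono_def
  proof (intro conjI ballI impI)
    show "w \<in> Arr Q" using w(1) by (simp add: Hom_def)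
    fix Z u v assume "Z \<in> Obj Q" "u \<in> Hom Q Z (Dom Q w)" "v \<in> Hom Q Z (Dom Q w)" and eq: "w \<bullet> u = w \<bullet> v"
    then have u: "u \<in> Hom Q Z W" and v: "v \<in> Hom Q Z W" using w(1) by (auto simp: Hom_def)
    show "u = v"
    proof (rule determined_on_D[OF u v])
      fix A a assume A: "A \<in> Obj D" and a: "a \<in> Hom Q A Z"
      show "u \<bullet> a = v \<bullet> a"
        using inj[OF A Cmp_in[OF a u] Cmp_in[OF a v]] eq Cmp_assoc[OF a u w(1)] Cmp_assoc[OF a v w(1)] by simp
    qed
  qed
  moreover have "is_epi Q w"
    unfolding is_epi_def
  proof (intro conjI ballI impI)
    show "w \<in> Arr Q" using w(1) by (simp add: Hom_def)
    fix Z u v assume "Z \<in> Obj Q" "u \<in> Hom Q (Cod Q w) Z" "v \<in> Hom Q (Cod Q w) Z" and eq: "u \<bullet> w = v \<bullet> w"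
    then have u: "u \<in> Hom Q X Z" and v: "v \<in> Hom Q X Z" using w(1) by (auto simp: Hom_def)
    show "u = v"
    proof (rule determined_on_D[OF u v])
      fix A a assume A: "A \<in> Obj D" and a: "a \<in> Hom Q A X"
      obtain a' where a': "a' \<in> Hom Q A W" "a = w \<bullet> a'" using surj[OF A a] by blast
      show "u \<bullet> a = v \<bullet> a"
        using eq a' Cmp_assoc[OF a'(1) w(1) u] Cmp_assoc[OF a'(1) w(1) v] by simp
    qed
  qed
  ultimately have "w \<in> mono_epis Q" by (simp add: mono_epis_def)
  moreover have "\<forall>Y \<in> Obj Q. \<forall>\<phi> \<in> Hom fp.Fp (yoneda W) (yoneda Y). \<exists>h \<in> Hom Q W Y. FA yoneda_functor h = \<phi>"
    using full_from_weak_cokernel[OF W _ pW] wc by blast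
  ultimately show ?thesis using w(1) by blast
qed

text \<open>A presentation of \<open>Z\<close> by representables is, by the Yoneda lemma, given by a morphism \<open>g\<close> of \<open>D\<close>. Its weak
  cokernel \<open>W\<close> has \<open>yoneda W\<close> presented by the same \<open>g\<close>, so both functors are the cokernel of the map that
  \<open>g\<close> induces.\<close>

lemma yoneda_dense:
  assumes Z: "Z \<in> Obj fp.Fp"
  shows "\<exists>W \<in> Obj Q. \<exists>h \<in> Hom fp.Fp (yoneda W) Z. is_iso fp.Fp h"
proof -
  have "finitely_presented K D Z" using Z by (simp add: fp.Obj_Fp)
  then obtain C\<^sub>0 C\<^sub>1 \<eta> \<theta> where C: "C\<^sub>0 \<in> Obj D" "C\<^sub>1 \<in> Obj D"
    and \<eta>: "module_nat_trans K D (hom_functor D C\<^sub>1) (hom_functor D C\<^sub>0) \<eta>"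
    and \<theta>: "module_nat_trans K D (hom_functor D C\<^sub>0) Z \<theta>"
    and exact: "\<forall>A \<in> Obj D. \<eta> A ` Hom D A C\<^sub>1 = {b \<in> Hom D A C\<^sub>0. \<theta> A b = \<zero>\<^bsub>FO Z A\<^esub>} \<and>
        \<theta> A ` Hom D A C\<^sub>0 = carrier (FO Z A)"
    unfolding finitely_presented_def by (elim bexE exE conjE)
  have ex: "\<eta> A ` Hom D A C\<^sub>1 = {b \<in> Hom D A C\<^sub>0. \<theta> A b = \<zero>\<^bsub>FO Z A\<^esub>}"
    and onto: "\<theta> A ` Hom D A C\<^sub>0 = carrier (FO Z A)" if "A \<in> Obj D" for A
    using exact that by simp_all
  have Hf: "carrier (FO (hom_functor D C) A) = Hom D A C"
    "a \<oplus>\<^bsub>FO (hom_functor D C) A\<^esub> b = Add D a b" "k \<odot>\<^bsub>FO (hom_functor D C) A\<^esub> a = Scal D k a" for C A a b k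
    by (simp_all add: hom_functor_def hom_module_def)
  have \<theta>m: "\<theta> A \<in> module_maps K (FO (hom_functor D C\<^sub>0) A) (FO Z A)" if "A \<in> Obj D" for A
    using \<theta> that by (simp add: module_nat_trans_def)
  have \<theta>_in: "\<theta> A b \<in> carrier (FO Z A)" if "A \<in> Obj D" "b \<in> Hom D A C\<^sub>0" for A b
    using onto that by blast
  have \<theta>_Add: "\<theta> A (Add Q b b') = \<theta> A b \<oplus>\<^bsub>FO Z A\<^esub> \<theta> A b'"
    if "A \<in> Obj D" "b \<in> Hom D A C\<^sub>0" "b' \<in> Hom D A C\<^sub>0" for A b b'
    using module_mapsD(2)[OF \<theta>m[OF that(1)], of b b'] that(2,3) by (simp add: Hf Add_D)
  have \<theta>_Scal: "\<theta> A (Scal Q k b) = k \<odot>\<^bsub>FO Z A\<^esub> \<theta> A b"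
    if "A \<in> Obj D" "k \<in> carrier K" "b \<in> Hom D A C\<^sub>0" for A b k
    using module_mapsD(3)[OF \<theta>m[OF that(1)] that(2), of b] that(2,3) by (simp add: Hf Scal_D)
  define g where "g = \<eta> C\<^sub>1 (Idn D C\<^sub>1)"
  have g: "g \<in> Hom Q C\<^sub>1 C\<^sub>0"
    using ex[OF C(2)] fp.Idn_in[OF C(2)] D_Q unfolding g_def by blast
  have \<eta>_eq: "\<eta> A c = g \<bullet> c" if c: "c \<in> Hom D A C\<^sub>1" for A c
  proof -
    have cD: "c \<in> Arr D" "Dom D c = A" "Cod D c = C\<^sub>1" using c by (auto simp: Hom_def)
    have "\<eta> A (arr_map (FA (hom_functor D C\<^sub>1) c) (Idn D C\<^sub>1)) = arr_map (FA (hom_functor D C\<^sub>0) c) g"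
      using \<eta> cD fp.Idn_in[OF C(2)] unfolding module_nat_trans_def g_def by (metis Hf(1))
    then show ?thesis
      using cD fp.Idn_in[OF C(2)] fp.Idn_left[OF c] Q_D[OF g C(2,1)] Cmp_D[OF c Q_D[OF g C(2,1)]]
      by (simp add: hom_functor_def)
  qed
  obtain W i where W: "W \<in> Obj Q" and pW: "presents W C\<^sub>0 C\<^sub>1 g i" using weak_cokernel[OF C g] by blast
  have i: "i \<in> Hom Q C\<^sub>0 W"
    and surW: "\<And>A a. \<lbrakk>A \<in> Obj D; a \<in> Hom Q A W\<rbrakk> \<Longrightarrow> \<exists>b \<in> Hom Q A C\<^sub>0. a = i \<bullet> b"
    and kerW: "\<And>A b. \<lbrakk>A \<in> Obj D; b \<in> Hom Q A C\<^sub>0\<rbrakk> \<Longrightarrow> i \<bullet> b = Zero Q A W \<longleftrightarrow> (\<exists>c \<in> Hom Q A C\<^sub>1. b = g \<bullet> c)"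
    using pW by (auto simp: presents_def)
  have same_kernel: "i \<bullet> b = Zero Q A W \<longleftrightarrow> \<theta> A b = \<zero>\<^bsub>FO Z A\<^esub>" if A: "A \<in> Obj D" and b: "b \<in> Hom D A C\<^sub>0" for A b
  proof -
    have "\<theta> A b = \<zero>\<^bsub>FO Z A\<^esub> \<longleftrightarrow> b \<in> \<eta> A ` Hom D A C\<^sub>1" using ex[OF A] b by blast
    also have "\<dots> \<longleftrightarrow> (\<exists>c \<in> Hom Q A C\<^sub>1. b = g \<bullet> c)" using \<eta>_eq Hom_D[OF A C(2)] by (auto simp: image_def)
    finally show ?thesis using kerW[OF A D_Q[OF b]] by simp
  qed
  have same_fibres: "i \<bullet> b = i \<bullet> b' \<longleftrightarrow> \<theta> A b = \<theta> A b'"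
    if A: "A \<in> Obj D" and b: "b \<in> Hom D A C\<^sub>0" and b': "b' \<in> Hom D A C\<^sub>0" for A b b'
  proof -
    interpret ZA: module K "FO Z A" using fp.Fp_value[OF Z A] .
    obtain k where k: "k \<in> Hom Q A C\<^sub>0" "b = Add Q b' k" using diff_ex[OF D_Q[OF b] D_Q[OF b']] by blast
    have kD: "k \<in> Hom D A C\<^sub>0" using Q_D[OF k(1) A C(1)] .
    have ib': "i \<bullet> b' \<in> Hom Q A W" and ik: "i \<bullet> k \<in> Hom Q A W"
      using Cmp_in[OF D_Q[OF b'] i] Cmp_in[OF k(1) i] .
    have "i \<bullet> b = i \<bullet> b' \<longleftrightarrow> i \<bullet> k = Zero Q A W"
      using k(2) Cmp_Add_right[OF D_Q[OF b'] k(1) i] Add_eq_self[OF ib' ik] Add_Zero_right[OF ib'] by metis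
    moreover have "\<theta> A b = \<theta> A b' \<longleftrightarrow> \<theta> A k = \<zero>\<^bsub>FO Z A\<^esub>"
      using k \<theta>_Add[OF A b' kD] \<theta>_in[OF A b'] \<theta>_in[OF A kD] by simp
    ultimately show ?thesis using same_kernel[OF A kD] by simp
  qed
  define \<psi> where "\<psi> A x = \<theta> A (SOME b. b \<in> Hom D A C\<^sub>0 \<and> i \<bullet> b = decode x)" for A x
  have \<psi>: "\<psi> A (e (i \<bullet> b)) = \<theta> A b" if A: "A \<in> Obj D" and b: "b \<in> Hom D A C\<^sub>0" for A b
  proof -
    let ?b = "SOME b'. b' \<in> Hom D A C\<^sub>0 \<and> i \<bullet> b' = i \<bullet> b"
    have "?b \<in> Hom D A C\<^sub>0 \<and> i \<bullet> ?b = i \<bullet> b" by (rule someI[of _ b]) (simp add: b)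
    then have "\<theta> A ?b = \<theta> A b" using same_fibres[OF A _ b, of ?b] by blast
    then show ?thesis using decode[OF Cmp_in[OF D_Q[OF b] i]] by (simp add: \<psi>_def)
  qed
  have elem: "\<exists>b. b \<in> Hom D A C\<^sub>0 \<and> x = e (i \<bullet> b)" if A: "A \<in> Obj D" and x: "x \<in> carrier (FO (yoneda W) A)" for A x
  proof -
    obtain a where a: "a \<in> Hom Q A W" "x = e a" using x by (auto simp: carrier_yoneda)
    then show ?thesis using surW[OF A a(1)] Q_D[OF _ A C(1)] by blast
  qed
  have nt: "module_nat_trans K D (yoneda W) Z \<psi>"
    unfolding module_nat_trans_def
  proof (intro conjI ballI module_mapsI)
    fix A x assume A: "A \<in> Obj D" and x: "x \<in> carrier (FO (yoneda W) A)"
    obtain b where "b \<in> Hom D A C\<^sub>0" "x = e (i \<bullet> b)" using elem[OF A x] by blast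
    then show "\<psi> A x \<in> carrier (FO Z A)" using \<psi>[OF A] \<theta>_in[OF A] by simp
  next
    fix A x y assume A: "A \<in> Obj D" and x: "x \<in> carrier (FO (yoneda W) A)" and y: "y \<in> carrier (FO (yoneda W) A)"
    obtain b where b: "b \<in> Hom D A C\<^sub>0" "x = e (i \<bullet> b)" using elem[OF A x] by blast
    obtain c where c: "c \<in> Hom D A C\<^sub>0" "y = e (i \<bullet> c)" using elem[OF A y] by blast
    have bc: "Add Q b c \<in> Hom D A C\<^sub>0" using Q_D[OF Add_in[OF D_Q[OF b(1)] D_Q[OF c(1)]] A C(1)] .
    show "\<psi> A (x \<oplus>\<^bsub>FO (yoneda W) A\<^esub> y) = \<psi> A x \<oplus>\<^bsub>FO Z A\<^esub> \<psi> A y"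
      using b c add_yoneda[OF Cmp_in[OF D_Q[OF b(1)] i] Cmp_in[OF D_Q[OF c(1)] i]]
        Cmp_Add_right[OF D_Q[OF b(1)] D_Q[OF c(1)] i] \<psi>[OF A bc] \<psi>[OF A b(1)] \<psi>[OF A c(1)]
        \<theta>_Add[OF A b(1) c(1)] by simp
  next
    fix A k x assume A: "A \<in> Obj D" and k: "k \<in> carrier K" and x: "x \<in> carrier (FO (yoneda W) A)"
    obtain b where b: "b \<in> Hom D A C\<^sub>0" "x = e (i \<bullet> b)" using elem[OF A x] by blast
    have kb: "Scal Q k b \<in> Hom D A C\<^sub>0" using Q_D[OF Scal_in[OF k D_Q[OF b(1)]] A C(1)] .
    show "\<psi> A (k \<odot>\<^bsub>FO (yoneda W) A\<^esub> x) = k \<odot>\<^bsub>FO Z A\<^esub> \<psi> A x"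
      using b smult_yoneda[OF Cmp_in[OF D_Q[OF b(1)] i]] Cmp_Scal_right[OF k D_Q[OF b(1)] i]
        \<psi>[OF A kb] \<psi>[OF A b(1)] \<theta>_Scal[OF A k b(1)] by simp
  next
    fix f x assume "f \<in> Arr D" and x: "x \<in> carrier (FO (yoneda W) (Cod D f))"
    then have f: "f \<in> Hom D (Dom D f) (Cod D f)" by (simp add: Arr_Hom)
    note o = D_objs[OF f]
    obtain b where b: "b \<in> Hom D (Cod D f) C\<^sub>0" "x = e (i \<bullet> b)" using elem[OF o(2) x] by blast
    have bf: "b \<cdot>\<^bsub>D\<^esub> f \<in> Hom D (Dom D f) C\<^sub>0" using fp.Cmp_in[OF f b(1)] .
    have "\<theta> (Dom D f) (arr_map (FA (hom_functor D C\<^sub>0) f) b) = arr_map (FA Z f) (\<theta> (Cod D f) b)"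
      using \<theta> \<open>f \<in> Arr D\<close> b(1) unfolding module_nat_trans_def by (metis Hf(1))
    then have "\<theta> (Dom D f) (b \<cdot>\<^bsub>D\<^esub> f) = arr_map (FA Z f) (\<theta> (Cod D f) b)" using b(1) by (simp add: hom_functor_def)
    then show "\<psi> (Dom D f) (arr_map (FA (yoneda W) f) x) = arr_map (FA Z f) (\<psi> (Cod D f) x)"
      using b yoneda_map[OF f Cmp_in[OF D_Q[OF b(1)] i]] Cmp_assoc[OF D_Q[OF f] D_Q[OF b(1)] i]
        Cmp_D[OF f b(1)] \<psi>[OF o(1) bf] \<psi>[OF o(2) b(1)] by simp
  qed
  have "is_iso fp.Fp (nat_arr D (yoneda W) Z \<psi>)"
  proof (rule fp.nat_arr_iso[OF yoneda_Obj[OF W] Z nt])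
    fix A assume A: "A \<in> Obj D"
    show "bij_betw (\<psi> A) (carrier (FO (yoneda W) A)) (carrier (FO Z A))"
      unfolding bij_betw_def
    proof
      show "inj_on (\<psi> A) (carrier (FO (yoneda W) A))"
      proof (rule inj_onI)
        fix x y assume x: "x \<in> carrier (FO (yoneda W) A)" and y: "y \<in> carrier (FO (yoneda W) A)"
          and eq: "\<psi> A x = \<psi> A y"
        obtain b where b: "b \<in> Hom D A C\<^sub>0" "x = e (i \<bullet> b)" using elem[OF A x] by blast
        obtain c where c: "c \<in> Hom D A C\<^sub>0" "y = e (i \<bullet> c)" using elem[OF A y] by blast
        show "x = y" using same_fibres[OF A b(1) c(1)] eq \<psi>[OF A b(1)] \<psi>[OF A c(1)] b c by simp
      qed
      show "\<psi> A ` carrier (FO (yoneda W) A) = carrier (FO Z A)"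
      proof
        show "\<psi> A ` carrier (FO (yoneda W) A) \<subseteq> carrier (FO Z A)"
          using nt A module_mapsD(1) unfolding module_nat_trans_def by (auto simp: module_maps_def)
        show "carrier (FO Z A) \<subseteq> \<psi> A ` carrier (FO (yoneda W) A)"
        proof
          fix z assume "z \<in> carrier (FO Z A)"
          then obtain b where b: "b \<in> Hom D A C\<^sub>0" "z = \<theta> A b" using onto[OF A] by blast
          then have "z = \<psi> A (e (i \<bullet> b))" using \<psi>[OF A] by simp
          moreover have "e (i \<bullet> b) \<in> carrier (FO (yoneda W) A)"
            using Cmp_in[OF D_Q[OF b(1)] i] by (simp add: carrier_yoneda)
          ultimately show "z \<in> \<psi> A ` carrier (FO (yoneda W) A)" by blast
        qed
      qed
    qed
  qed
  then show ?thesis using fp.nat_arr_in[OF yoneda_Obj[OF W] Z nt] W by blast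
qed

theorem localisation_at_mono_epis: "equivalent_categories (localisation Q (mono_epis Q)) fp.Fp"
proof -
  interpret I: inverting_functor Q "fp.Fp" "mono_epis Q" yoneda_functor
    by (intro inverting_functor.intro inverting_functor_axioms.intro category_axioms fp.category_Fp
        yoneda_is_functor mono_epi_inverted)
  show ?thesis
  proof (rule I.localisation_equivalence)
    show "f = g" if "f \<in> Hom Q X Y" "g \<in> Hom Q X Y" "FA yoneda_functor f = FA yoneda_functor g" for X Y f g
      using yoneda_faithful that by blast
  qed (use cover_by_weak_cokernel yoneda_dense in \<open>simp_all add: FO_yoneda\<close>)
qed

end

section \<open>Conflations\<close>

context exact_category
begin

definition conflation :: "'m \<Rightarrow> 'm \<Rightarrow> 'o \<Rightarrow> 'o \<Rightarrow> 'o \<Rightarrow> bool" where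
  "conflation i p X Y Z \<longleftrightarrow> (i, p) \<in> E \<and> i \<in> Hom C X Y \<and> p \<in> Hom C Y Z"

lemma conflationD:
  assumes "conflation i p X Y Z"
  shows "i \<in> Hom C X Y" "p \<in> Hom C Y Z" "X \<in> Obj C" "Y \<in> Obj C" "Z \<in> Obj C"
  using assms Hom_Dom[of i X Y] Hom_Cod[of i X Y] Hom_Cod[of p Y Z] by (auto simp: conflation_def)

lemma conflation_of_E:
  assumes "(i, p) \<in> E" shows "conflation i p (Dom C i) (Cod C i) (Cod C p)"
  using kernel_cokernel[OF assms] assms Arr_Hom[of i C] Arr_Hom[of p C]
  by (auto simp: conflation_def is_kernel_def)

lemma defl_infl_zero:
  assumes "conflation i p X Y Z" shows "p \<bullet> i = Zero C X Z"
proof -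
  have "Dom C i = X" "Cod C p = Z" using conflationD[OF assms] by (auto simp: Hom_def)
  then show ?thesis using kernel_cokernel[of i p] assms by (auto simp: conflation_def is_kernel_def)
qed

lemma kernel_factor:
  assumes "conflation i p X Y Z" "f \<in> Hom C W Y" "p \<bullet> f = Zero C W Z"
  shows "\<exists>!g. g \<in> Hom C W X \<and> i \<bullet> g = f"
proof -
  have "Dom C i = X" "Dom C p = Y" "Cod C p = Z" using conflationD[OF assms(1)] by (auto simp: Hom_def)
  then show ?thesis
    using kernel_cokernel[of i p] assms Hom_Dom[OF assms(2)] by (auto simp: conflation_def is_kernel_def)
qed

lemma cokernel_factor:
  assumes "conflation i p X Y Z" "f \<in> Hom C Y W" "f \<bullet> i = Zero C X W"
  shows "\<exists>!g. g \<in> Hom C Z W \<and> g \<bullet> p = f"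
proof -
  have "Dom C i = X" "Cod C i = Y" "Cod C p = Z" using conflationD[OF assms(1)] by (auto simp: Hom_def)
  then show ?thesis
    using kernel_cokernel[of i p] assms Hom_Cod[OF assms(2)] by (auto simp: conflation_def is_cokernel_def)
qed

lemma infl_cancel:
  assumes c: "conflation i p X Y Z" and g: "g \<in> Hom C W X" and h: "h \<in> Hom C W X" and eq: "i \<bullet> g = i \<bullet> h"
  shows "g = h"
proof -
  note i = conflationD(1)[OF c]
  have "p \<bullet> (i \<bullet> g) = Zero C W Z"
    using Cmp_assoc[OF g i conflationD(2)[OF c]] defl_infl_zero[OF c] Cmp_Zero_left[OF g conflationD(5)[OF c]] by simp
  from kernel_factor[OF c Cmp_in[OF g i] this] show ?thesis using g h eq by auto
qed

lemma defl_cancel: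
  assumes c: "conflation i p X Y Z" and g: "g \<in> Hom C Z W" and h: "h \<in> Hom C Z W" and eq: "g \<bullet> p = h \<bullet> p"
  shows "g = h"
proof -
  note p = conflationD(2)[OF c]
  have "(g \<bullet> p) \<bullet> i = Zero C X W"
    using Cmp_assoc[OF conflationD(1)[OF c] p g] defl_infl_zero[OF c] Cmp_Zero_right[OF g conflationD(3)[OF c]] by simp
  from cokernel_factor[OF c Cmp_in[OF p g] this] show ?thesis using g h eq by auto
qed

text \<open>With \<open>cokernel_diff\<close>, the form in which kernels and cokernels are used: morphisms with the same image under a
  deflation differ by one through its kernel.\<close>

lemma kernel_diff:
  assumes c: "conflation i p X Y Z" and f: "f \<in> Hom C W Y" and g: "g \<in> Hom C W Y" and eq: "p \<bullet> f = p \<bullet> g"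
  obtains h where "h \<in> Hom C W X" "f = Add C g (i \<bullet> h)"
proof -
  note p = conflationD(2)[OF c]
  obtain d where d: "d \<in> Hom C W Y" "f = Add C g d" using diff_ex[OF f g] by blast
  have "p \<bullet> d = Zero C W Z"
    using Add_eq_self[OF Cmp_in[OF g p] Cmp_in[OF d(1) p]] Cmp_Add_right[OF g d(1) p] eq d(2) by simp
  then show thesis using kernel_factor[OF c d(1)] d(2) that by blast
qed

lemma cokernel_diff:
  assumes c: "conflation i p X Y Z" and f: "f \<in> Hom C Y W" and g: "g \<in> Hom C Y W" and eq: "f \<bullet> i = g \<bullet> i"
  obtains h where "h \<in> Hom C Z W" "f = Add C g (h \<bullet> p)"
proof -
  note i = conflationD(1)[OF c]
  obtain d where d: "d \<in> Hom C Y W" "f = Add C g d" using diff_ex[OF f g] by blast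
  have "d \<bullet> i = Zero C X W"
    using Add_eq_self[OF Cmp_in[OF i g] Cmp_in[OF i d(1)]] Cmp_Add_left[OF i g d(1)] eq d(2) by simp
  then show thesis using cokernel_factor[OF c d(1)] d(2) that by blast
qed

lemma iso_Idn: "X \<in> Obj C \<Longrightarrow> is_iso C (Idn C X)"
  using isoI[OF Idn_in Idn_in] Idn_left[OF Idn_in] by blast

text \<open>Any two cokernels of \<open>i\<close> differ by an isomorphism, and conflations are closed under isomorphism.\<close>

lemma conflation_of_cokernel:
  assumes E: "(i, q) \<in> E" and p: "is_cokernel C p i" and i: "i \<in> Hom C X Y" and pH: "p \<in> Hom C Y Z"
  shows "conflation i p X Y Z"
proof -
  obtain Z' where c: "conflation i q X Y Z'" using conflation_of_E[OF E] i by (auto simp: Hom_def)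
  note q = conflationD(2)[OF c]
  have o: "X \<in> Obj C" "Y \<in> Obj C" "Z' \<in> Obj C" "Z \<in> Obj C" using conflationD[OF c] Hom_Cod[OF pH] by auto
  have pz: "p \<bullet> i = Zero C X Z"
    and pu: "\<And>W f. \<lbrakk>W \<in> Obj C; f \<in> Hom C Y W; f \<bullet> i = Zero C X W\<rbrakk> \<Longrightarrow> \<exists>!g. g \<in> Hom C Z W \<and> g \<bullet> p = f"
    using p i pH unfolding is_cokernel_def Hom_def by auto
  obtain a where a: "a \<in> Hom C Z' Z" "a \<bullet> q = p" using cokernel_factor[OF c pH pz] by blast
  obtain b where b: "b \<in> Hom C Z Z'" "b \<bullet> p = q" using pu[OF o(3) q defl_infl_zero[OF c]] by blast
  have "b \<bullet> a = Idn C Z'"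
    using defl_cancel[OF c Cmp_in[OF a(1) b(1)] Idn_in[OF o(3)]] Cmp_assoc[OF q a(1) b(1)] a(2) b(2) Idn_left[OF q] by simp
  moreover have "(a \<bullet> b) \<bullet> p = p" using Cmp_assoc[OF pH b(1) a(1)] a(2) b(2) by simp
  then have "a \<bullet> b = Idn C Z"
    using pu[OF o(4) pH pz] Cmp_in[OF b(1) a(1)] Idn_in[OF o(4)] Idn_left[OF pH] by blast
  ultimately have isoa: "is_iso C a" using isoI[OF a(1) b(1)] by simp
  have "ses_iso C (i, q) (i, p)"
    unfolding ses_iso_def split
  proof (intro conjI bexI)
    show "i \<in> Arr C" "q \<in> Arr C" "i \<in> Arr C" "p \<in> Arr C" "Cod C i = Dom C q" "Cod C i = Dom C p"
      "Idn C X \<in> Hom C (Dom C i) (Dom C i)" "Idn C Y \<in> Hom C (Cod C i) (Cod C i)" "a \<in> Hom C (Cod C q) (Cod C p)"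
      using i q pH a(1) Idn_in[OF o(1)] Idn_in[OF o(2)] by (auto simp: Hom_def)
    show "Idn C Y \<bullet> i = i \<bullet> Idn C X" "a \<bullet> q = p \<bullet> Idn C Y"
      using Idn_left[OF i] Idn_right[OF i] Idn_right[OF pH] a(2) by simp_all
  qed (use isoa iso_Idn o in simp_all)
  then show ?thesis using iso_closed[OF E] i pH by (simp add: conflation_def)
qed

text \<open>The pushout of an inflation has the same cokernel object. The axiom only says that \<open>i'\<close> is an
  inflation; the cokernel \<open>p'\<close> is induced by \<open>0\<close> and \<open>p\<close>.\<close>

lemma conflation_pushout:
  assumes c: "conflation i p X Y Z" and f: "f \<in> Hom C X X'"
  obtains Y' i' f' p' where "conflation i' p' X' Y' Z" "f' \<in> Hom C Y Y'" "i' \<bullet> f = f' \<bullet> i" "p' \<bullet> f' = p"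
    "\<And>W g h. \<lbrakk>g \<in> Hom C X' W; h \<in> Hom C Y W; g \<bullet> f = h \<bullet> i\<rbrakk> \<Longrightarrow>
        \<exists>u \<in> Hom C Y' W. u \<bullet> i' = g \<and> u \<bullet> f' = h"
proof -
  note i = conflationD(1)[OF c] and p = conflationD(2)[OF c]
  have "i \<in> Domain E" using c by (auto simp: conflation_def)
  then obtain i' f' where po: "is_pushout C i f i' f'" and i'E: "i' \<in> Domain E"
    using mono_pushout[of i f] i f by (auto simp: Hom_def)
  obtain Y' where i': "i' \<in> Hom C X' Y'" and f': "f' \<in> Hom C Y Y'"
    using po i f unfolding is_pushout_def Hom_def by auto
  have comm: "i' \<bullet> f = f' \<bullet> i" using po by (simp add: is_pushout_def)
  have up: "\<exists>!u. u \<in> Hom C Y' W \<and> u \<bullet> i' = g \<and> u \<bullet> f' = h"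
    if "g \<in> Hom C X' W" "h \<in> Hom C Y W" "g \<bullet> f = h \<bullet> i" for W g h
  proof -
    have "Cod C f = X'" "Cod C i = Y" "Cod C i' = Y'" using i f i' by (auto simp: Hom_def)
    then show ?thesis using po Hom_Cod[OF that(1)] that unfolding is_pushout_def by blast
  qed
  have o: "X' \<in> Obj C" "Z \<in> Obj C" "Y' \<in> Obj C" using Hom_Dom[OF i'] conflationD(5)[OF c] Hom_Cod[OF i'] .
  have "Zero C X' Z \<bullet> f = p \<bullet> i" using Cmp_Zero_left[OF f o(2)] defl_infl_zero[OF c] by simp
  then obtain p' where p': "p' \<in> Hom C Y' Z" "p' \<bullet> i' = Zero C X' Z" "p' \<bullet> f' = p"
    using up[OF Zero_in[OF o(1,2)] p] by blast
  have "is_cokernel C p' i'"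
    unfolding is_cokernel_def
  proof (intro conjI ballI impI)
    show "i' \<in> Arr C" "p' \<in> Arr C" "Cod C i' = Dom C p'" "p' \<bullet> i' = Zero C (Dom C i') (Cod C p')"
      using i' p' by (auto simp: Hom_def)
    fix W u assume "W \<in> Obj C" "u \<in> Hom C (Cod C i') W" "u \<bullet> i' = Zero C (Dom C i') W"
    then have W: "W \<in> Obj C" and u: "u \<in> Hom C Y' W" and uz: "u \<bullet> i' = Zero C X' W" using i' by (auto simp: Hom_def)
    have uf: "u \<bullet> f' \<in> Hom C Y W" using Cmp_in[OF f' u] .
    have "(u \<bullet> f') \<bullet> i = Zero C X W"
      using Cmp_assoc[OF i f' u] Cmp_assoc[OF f i' u] comm uz Cmp_Zero_left[OF f W] by simp
    then obtain v where v: "v \<in> Hom C Z W" "v \<bullet> p = u \<bullet> f'" using cokernel_factor[OF c uf] by blast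
    have z: "Zero C X' W \<in> Hom C X' W" using Zero_in[OF o(1) W] .
    have "Zero C X' W \<bullet> f = (u \<bullet> f') \<bullet> i"
      using \<open>(u \<bullet> f') \<bullet> i = Zero C X W\<close> Cmp_Zero_left[OF f W] by simp
    from up[OF z uf this] have uniq: "u1 = u2"
      if "u1 \<in> Hom C Y' W" "u1 \<bullet> i' = Zero C X' W" "u1 \<bullet> f' = u \<bullet> f'"
        "u2 \<in> Hom C Y' W" "u2 \<bullet> i' = Zero C X' W" "u2 \<bullet> f' = u \<bullet> f'" for u1 u2
      using that by blast
    have vp: "v \<bullet> p' = u"
    proof (rule uniq[OF Cmp_in[OF p'(1) v(1)] _ _ u uz refl])
      show "(v \<bullet> p') \<bullet> i' = Zero C X' W"
        using Cmp_assoc[OF i' p'(1) v(1)] p'(2) Cmp_Zero_right[OF v(1) o(1)] by simp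
      show "(v \<bullet> p') \<bullet> f' = u \<bullet> f'" using Cmp_assoc[OF f' p'(1) v(1)] p'(3) v(2) by simp
    qed
    show "\<exists>!g. g \<in> Hom C (Cod C p') W \<and> g \<bullet> p' = u"
    proof (rule ex1I[of _ v])
      show "v \<in> Hom C (Cod C p') W \<and> v \<bullet> p' = u" using v vp p'(1) by (auto simp: Hom_def)
      fix g assume "g \<in> Hom C (Cod C p') W \<and> g \<bullet> p' = u"
      then have g: "g \<in> Hom C Z W" "g \<bullet> p' = u" using p'(1) by (auto simp: Hom_def)
      then have "g \<bullet> p = v \<bullet> p" using Cmp_assoc[OF f' p'(1) g(1)] p'(3) v(2) by simp
      then show "g = v" using defl_cancel[OF c g(1) v(1)] by simp
    qed
  qed
  then have "conflation i' p' X' Y' Z" using i'E conflation_of_cokernel[OF _ _ i' p'(1)] by blast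
  moreover have "\<exists>u \<in> Hom C Y' W. u \<bullet> i' = g \<and> u \<bullet> f' = h"
    if "g \<in> Hom C X' W" "h \<in> Hom C Y W" "g \<bullet> f = h \<bullet> i" for W g h using up[OF that] by blast
  ultimately show thesis using that f' comm p'(3) by blast
qed

lemma projective_lift:
  assumes "P \<in> projectives C E" "conflation i p X Y Z" "f \<in> Hom C P Z"
  obtains g where "g \<in> Hom C P Y" "p \<bullet> g = f"
proof -
  have "p \<in> Range E" "Cod C p = Z" "Dom C p = Y" using assms(2) by (auto simp: conflation_def Hom_def)
  then show thesis using assms that unfolding projectives_def by blast
qed

lemma retraction_of_section:
  assumes c: "conflation i p X Y Z" and s: "s \<in> Hom C Z Y" "p \<bullet> s = Idn C Z"
  obtains r where "r \<in> Hom C Y X" "r \<bullet> i = Idn C X" "r \<bullet> s = Zero C Z X"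
    "Add C (s \<bullet> p) (i \<bullet> r) = Idn C Y"
proof -
  note i = conflationD(1)[OF c] and p = conflationD(2)[OF c] and o = conflationD(3-5)[OF c]
  have sp: "s \<bullet> p \<in> Hom C Y Y" using Cmp_in[OF p s(1)] .
  have "p \<bullet> Idn C Y = p \<bullet> (s \<bullet> p)"
    using Idn_right[OF p] Cmp_assoc[OF p s(1) p] s(2) Idn_left[OF p] by simp
  then obtain r where r: "r \<in> Hom C Y X" "Idn C Y = Add C (s \<bullet> p) (i \<bullet> r)"
    using kernel_diff[OF c Idn_in[OF o(2)] sp] by blast
  have ir: "i \<bullet> r \<in> Hom C Y Y" using Cmp_in[OF r(1) i] .
  have ri: "r \<bullet> i \<in> Hom C X X" and rs: "r \<bullet> s \<in> Hom C Z X" using Cmp_in[OF i r(1)] Cmp_in[OF s(1) r(1)] .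
  have "i = Add C ((s \<bullet> p) \<bullet> i) ((i \<bullet> r) \<bullet> i)"
    using Idn_left[OF i] Cmp_Add_left[OF i sp ir] r(2) by simp
  also have "(s \<bullet> p) \<bullet> i = Zero C X Y"
    using Cmp_assoc[OF i p s(1)] defl_infl_zero[OF c] Cmp_Zero_right[OF s(1) o(1)] by simp
  also have "(i \<bullet> r) \<bullet> i = i \<bullet> (r \<bullet> i)" using Cmp_assoc[OF i r(1) i] by simp
  also have "Add C (Zero C X Y) (i \<bullet> (r \<bullet> i)) = i \<bullet> (r \<bullet> i)"
    using Add_Zero_left[OF Cmp_in[OF ri i]] .
  finally have "r \<bullet> i = Idn C X" using infl_cancel[OF c ri Idn_in[OF o(1)]] Idn_right[OF i] by simp
  moreover have "Add C s (i \<bullet> (r \<bullet> s)) = s"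
    using Idn_left[OF s(1)] Cmp_Add_left[OF s(1) sp ir] r(2) Cmp_assoc[OF s(1) p s(1)] s(2) Idn_right[OF s(1)]
      Cmp_assoc[OF s(1) r(1) i] by simp
  then have "i \<bullet> (r \<bullet> s) = i \<bullet> Zero C Z X"
    using Add_eq_self[OF s(1) Cmp_in[OF rs i]] Cmp_Zero_right[OF i o(3)] by simp
  then have "r \<bullet> s = Zero C Z X" using infl_cancel[OF c rs Zero_in[OF o(3,1)]] by simp
  ultimately show thesis using that r by simp
qed

text \<open>A morphism of conflations that is the identity on the third objects is a pushout square; only the
  component \<open>u\<close> of the induced morphism at \<open>Y'\<close> is of interest. Push \<open>j\<close> out along \<open>h\<close>. Over \<open>Z\<close> there are
  two morphisms \<open>Y \<rightarrow> M\<close> that agree on \<open>X\<close>, through \<open>Y'\<close> and through \<open>W\<close>. Their difference is \<open>s p\<close> for a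
  section \<open>s\<close> of the new conflation, and the corresponding retraction produces \<open>u\<close>.\<close>

lemma extend_along_conflation_map:
  assumes c: "conflation i p X Y Z" and c': "conflation j q X' Y' Z"
    and k: "k \<in> Hom C Y Y'" "q \<bullet> k = p" and x: "x \<in> Hom C X X'" "k \<bullet> i = j \<bullet> x"
    and h: "h \<in> Hom C X' W" and b: "b \<in> Hom C Y W" and eq: "h \<bullet> x = b \<bullet> i"
  obtains u where "u \<in> Hom C Y' W" "u \<bullet> j = h"
proof -
  note i = conflationD(1)[OF c] and j = conflationD(1)[OF c'] and p = conflationD(2)[OF c]
  obtain M j' h' q' where c'': "conflation j' q' W M Z" and h': "h' \<in> Hom C Y' M"
    and po: "j' \<bullet> h = h' \<bullet> j" "q' \<bullet> h' = q" using conflation_pushout[OF c' h] by metis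
  note j' = conflationD(1)[OF c''] and q' = conflationD(2)[OF c'']
  have hk: "h' \<bullet> k \<in> Hom C Y M" and jb: "j' \<bullet> b \<in> Hom C Y M" using Cmp_in[OF k(1) h'] Cmp_in[OF b j'] .
  have "(h' \<bullet> k) \<bullet> i = h' \<bullet> (j \<bullet> x)" using Cmp_assoc[OF i k(1) h'] x(2) by simp
  also have "\<dots> = j' \<bullet> (h \<bullet> x)" using Cmp_assoc[OF x(1) j h'] Cmp_assoc[OF x(1) h j'] po(1) by simp
  also have "\<dots> = (j' \<bullet> b) \<bullet> i" using Cmp_assoc[OF i b j'] eq by simp
  finally obtain s where s: "s \<in> Hom C Z M" "h' \<bullet> k = Add C (j' \<bullet> b) (s \<bullet> p)"
    using cokernel_diff[OF c hk jb] by blast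
  have "p = q' \<bullet> (h' \<bullet> k)" using Cmp_assoc[OF k(1) h' q'] po(2) k(2) by simp
  also have "\<dots> = Add C (q' \<bullet> (j' \<bullet> b)) (q' \<bullet> (s \<bullet> p))" using s(2) Cmp_Add_right[OF jb Cmp_in[OF p s(1)] q'] by simp
  also have "q' \<bullet> (j' \<bullet> b) = Zero C Y Z"
    using Cmp_assoc[OF b j' q'] defl_infl_zero[OF c''] Cmp_Zero_left[OF b conflationD(5)[OF c]] by simp
  also have "Add C (Zero C Y Z) (q' \<bullet> (s \<bullet> p)) = (q' \<bullet> s) \<bullet> p"
    using Add_Zero_left[OF Cmp_in[OF Cmp_in[OF p s(1)] q']] Cmp_assoc[OF p s(1) q'] by simp
  finally have "q' \<bullet> s = Idn C Z"
    using defl_cancel[OF c Cmp_in[OF s(1) q'] Idn_in[OF conflationD(5)[OF c]]] Idn_left[OF p] by simp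
  then obtain r where r: "r \<in> Hom C M W" "r \<bullet> j' = Idn C W" using retraction_of_section[OF c'' s(1)] by blast
  have "(r \<bullet> h') \<bullet> j = h"
    using Cmp_assoc[OF j h' r(1)] po(1) Cmp_assoc[OF h j' r(1)] r(2) Idn_left[OF h] by simp
  then show thesis using that Cmp_in[OF h' r(1)] by blast
qed

end

section \<open>Syzygies and cotorsion pairs\<close>

locale cotorsion_setting = exact_category K C E
  for K :: "('k, 'r) ring_scheme" (structure) and C :: "('o, 'm, 'k, 'z) lincat_scheme" (structure)
    and E :: "('m \<times> 'm) set" +
  fixes S T :: "'o set"
  assumes cotorsion: "cotorsion_pair C E S T"
    and S_subset_T: "S \<subseteq> T"
    and projectives: "enough_projectives C E"
begin

abbreviation "Proj \<equiv> projectives C E"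
abbreviation "Syz \<equiv> syzygies C E S"

lemma T_Obj: "X \<in> T \<Longrightarrow> X \<in> Obj C" and S_Obj: "X \<in> S \<Longrightarrow> X \<in> Obj C"
  using cotorsion by (auto simp: cotorsion_pair_def additive_summand_closed_def)

text \<open>All extensions of \<open>Z\<close> by \<open>X\<close> are equivalent, and the only class is that of the split ones.\<close>

lemma conflation_splits:
  assumes c: "conflation i p X Y Z" and X: "X \<in> T" and Z: "Z \<in> S"
  obtains r where "r \<in> Hom C Y X" "r \<bullet> i = Idn C X"
proof -
  note i = conflationD(1)[OF c] and p = conflationD(2)[OF c] and o = conflationD(3-5)[OF c]
  have ext: "(i, p) \<in> extensions C E Z X" using c by (auto simp: extensions_def conflation_def Hom_def)
  have "(i, p) \<in> ext_rel C E Z X `` {(i, p)}"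
    using ext i p Idn_in[OF o(2)] iso_Idn[OF o(2)] Idn_left[OF i] Idn_right[OF p]
    by (auto simp: ext_rel_def Hom_def)
  moreover have "ext_rel C E Z X `` {(i, p)} \<in> Ext1 C E Z X" unfolding Ext1_def using ext by (rule quotientI)
  moreover have "Ext1 C E Z X = {split_extensions C E Z X}" using cotorsion X Z by (simp add: cotorsion_pair_def)
  ultimately have "(i, p) \<in> split_extensions C E Z X" by (metis singletonD)
  then obtain j r where "biproduct C X Z (Cod C i) i j r p" by (auto simp: split_extensions_def)
  then show thesis using that i by (auto simp: biproduct_def Hom_def)
qed

text \<open>Push the conflation out along \<open>a\<close> and split the result.\<close>

lemma extend_to_T:
  assumes c: "conflation i p X Y Z" and Z: "Z \<in> S" and W: "W \<in> T" and a: "a \<in> Hom C X W"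
  obtains b where "b \<in> Hom C Y W" "b \<bullet> i = a"
proof -
  obtain M i' f' p' where c': "conflation i' p' W M Z" and f': "f' \<in> Hom C Y M"
    and po: "i' \<bullet> a = f' \<bullet> i" using conflation_pushout[OF c a] by metis
  obtain r where r: "r \<in> Hom C M W" "r \<bullet> i' = Idn C W" using conflation_splits[OF c' W Z] .
  have "(r \<bullet> f') \<bullet> i = a"
    using Cmp_assoc[OF conflationD(1)[OF c] f' r(1)] Cmp_assoc[OF a conflationD(1)[OF c'] r(1)] po r(2) Idn_left[OF a]
    by simp
  then show thesis using that Cmp_in[OF f' r(1)] by blast
qed

text \<open>A projective \<open>P\<close> is a direct summand of the object of \<open>S\<close> that covers it.\<close>

lemma projective_in_T: assumes P: "P \<in> Proj" shows "P \<in> T"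
proof -
  have PO: "P \<in> Obj C" using P by (simp add: projectives_def)
  obtain X Y where XY: "X \<in> T" "Y \<in> S" "ses C E X Y P" using cotorsion PO by (auto simp: cotorsion_pair_def)
  then obtain i p where c: "conflation i p X Y P" by (auto simp: ses_def conflation_def)
  note i = conflationD(1)[OF c] and p = conflationD(2)[OF c]
  obtain s where s: "s \<in> Hom C P Y" "p \<bullet> s = Idn C P" using projective_lift[OF P c Idn_in[OF PO]] .
  obtain r where r: "r \<in> Hom C Y X" "r \<bullet> i = Idn C X" "r \<bullet> s = Zero C P X"
    "Add C (s \<bullet> p) (i \<bullet> r) = Idn C Y" using retraction_of_section[OF c s] .
  have "biproduct C P X Y s i p r"
    unfolding biproduct_def using s r i p defl_infl_zero[OF c] by simp
  moreover have "additive_summand_closed C S" using cotorsion by (simp add: cotorsion_pair_def)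
  ultimately have "P \<in> S" using XY(2) unfolding additive_summand_closed_def by blast
  then show ?thesis using S_subset_T by blast
qed

lemma deflation_from_projective:
  assumes "X \<in> Obj C"
  obtains P A i p where "P \<in> Proj" "conflation i p A P X"
proof -
  obtain P p where P: "P \<in> Proj" "p \<in> Hom C P X" "p \<in> Range E"
    using projectives assms unfolding enough_projectives_def by blast
  then obtain i where "(i, p) \<in> E" by blast
  then have "conflation i p (Dom C i) (Cod C i) (Cod C p)" by (rule conflation_of_E)
  moreover have "Cod C i = P" "Cod C p = X"
    using conflationD(2)[OF calculation] P(2) by (auto simp: Hom_def)
  ultimately show thesis using that P(1) by blast
qed

lemma syzygyE:
  assumes "A \<in> Syz"
  obtains i p P Z where "P \<in> Proj" "Z \<in> S" "conflation i p A P Z"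
  using assms by (auto simp: syzygies_def ses_def conflation_def)

lemma syzygyI: "\<lbrakk>conflation i p A P Z; P \<in> Proj; Z \<in> S\<rbrakk> \<Longrightarrow> A \<in> Syz"
  using conflationD(3) by (auto simp: syzygies_def ses_def conflation_def)

lemma syzygy_Obj: "A \<in> Syz \<Longrightarrow> A \<in> Obj C"
  by (simp add: syzygies_def)

text \<open>Use the conflation \<open>P \<rightarrow> P \<rightarrow> 0\<close>; the zero object belongs to \<open>S\<close>.\<close>

lemma projective_syzygy: assumes "P \<in> Proj" shows "P \<in> Syz"
proof -
  have PO: "P \<in> Obj C" using assms by (simp add: projectives_def)
  obtain Z where Z: "Z \<in> S" "zero_object C Z"
    using cotorsion by (auto simp: cotorsion_pair_def additive_summand_closed_def)
  have ZO: "Z \<in> Obj C" using Z(2) by (simp add: zero_object_def)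
  have uz: "f = g" if "f \<in> Hom C Z Z" "g \<in> Hom C Z Z" for f g
    using Z(2) ZO that by (auto simp: zero_object_def)
  have z: "Zero C P Z \<in> Hom C P Z" "Zero C Z P \<in> Hom C Z P" using Zero_in PO ZO by auto
  have "Add C (Idn C P \<bullet> Idn C P) (Zero C Z P \<bullet> Zero C P Z) = Idn C P"
    using Cmp_Zero_left[OF z(1) PO] Idn_left[OF Idn_in[OF PO]] Add_Zero_right[OF Idn_in[OF PO]] by simp
  moreover have "Zero C P Z \<bullet> Zero C Z P = Idn C Z" using uz[OF Cmp_in[OF z(2,1)] Idn_in[OF ZO]] .
  ultimately have "biproduct C P Z P (Idn C P) (Zero C Z P) (Idn C P) (Zero C P Z)"
    unfolding biproduct_def using Idn_in[OF PO] z Idn_left[OF z(2)] Idn_left[OF Idn_in[OF PO]] Idn_right[OF z(1)] by simp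
  then have "conflation (Idn C P) (Zero C P Z) P P Z"
    using split_exact Idn_in[OF PO] z(1) by (auto simp: conflation_def)
  then show ?thesis using syzygyI assms Z(1) by blast
qed

lemma T_approximation:
  assumes "X \<in> Obj C" obtains j q Y Z where "conflation j q X Y Z" "Y \<in> T" "Z \<in> S"
proof -
  have "\<exists>Y \<in> T. \<exists>Z \<in> S. ses C E X Y Z" using cotorsion assms by (simp add: cotorsion_pair_def)
  then show thesis using that unfolding ses_def conflation_def by blast
qed

lemma S_approximation:
  assumes "X \<in> Obj C" obtains m n Y Z where "conflation m n Y Z X" "Y \<in> T" "Z \<in> S"
proof -
  have "\<exists>Y \<in> T. \<exists>Z \<in> S. ses C E Y Z X" using cotorsion assms by (simp add: cotorsion_pair_def)
  then show thesis using that unfolding ses_def conflation_def by blast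
qed

sublocale linear_quotient K C T
proof
  have T: "additive_summand_closed C T" using cotorsion by (simp add: cotorsion_pair_def)
  show "factors_through C T (Zero C X Y)" if X: "X \<in> Obj C" and Y: "Y \<in> Obj C" for X Y
  proof -
    obtain Z where Z: "Z \<in> T" using T by (auto simp: additive_summand_closed_def)
    have z: "Zero C X Z \<in> Hom C X Z" "Zero C Z Y \<in> Hom C Z Y" using Zero_in X Y T_Obj[OF Z] by auto
    show ?thesis
      using factors_through_Hom[OF Zero_in[OF X Y]] Z z Cmp_Zero_left[OF z(1) Y] by metis
  qed
  fix f g X Y assume f: "f \<in> Hom C X Y" and g: "g \<in> Hom C X Y"
    and "factors_through C T f" "factors_through C T g"
  then obtain M a b N c d where M: "M \<in> T" "a \<in> Hom C X M" "b \<in> Hom C M Y" "f = b \<bullet> a"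
    and N: "N \<in> T" "c \<in> Hom C X N" "d \<in> Hom C N Y" "g = d \<bullet> c"
    using factors_through_Hom by meson
  obtain W i j p q where W: "biproduct C M N W i j p q" using ex_biproduct T_Obj M(1) N(1) by blast
  have "W \<in> T" using T W M(1) N(1) unfolding additive_summand_closed_def by blast
  have w: "i \<in> Hom C M W" "j \<in> Hom C N W" "p \<in> Hom C W M" "q \<in> Hom C W N"
    "p \<bullet> i = Idn C M" "q \<bullet> j = Idn C N" "q \<bullet> i = Zero C M N" "p \<bullet> j = Zero C N M"
    using W by (simp_all add: biproduct_def)
  have XO: "X \<in> Obj C" and YO: "Y \<in> Obj C" using Hom_Dom[OF f] Hom_Cod[OF f] .
  define u where "u = Add C (b \<bullet> p) (d \<bullet> q)"
  have bp: "b \<bullet> p \<in> Hom C W Y" and dq: "d \<bullet> q \<in> Hom C W Y" using Cmp_in w M N by blast+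
  have ia: "i \<bullet> a \<in> Hom C X W" and jc: "j \<bullet> c \<in> Hom C X W" using Cmp_in w M N by blast+
  have u: "u \<in> Hom C W Y" using Add_in[OF bp dq] by (simp add: u_def)
  have "u \<bullet> i = b"
    using Cmp_Add_left[OF w(1) bp dq] Cmp_assoc[OF w(1,3) M(3)] Cmp_assoc[OF w(1,4) N(3)] w(5,7) Idn_right[OF M(3)]
      Cmp_Zero_right[OF N(3) T_Obj[OF M(1)]] Add_Zero_right[OF M(3)] by (simp add: u_def)
  moreover have "u \<bullet> j = d"
    using Cmp_Add_left[OF w(2) bp dq] Cmp_assoc[OF w(2,3) M(3)] Cmp_assoc[OF w(2,4) N(3)] w(6,8) Idn_right[OF N(3)]
      Cmp_Zero_right[OF M(3) T_Obj[OF N(1)]] Add_Zero_left[OF N(3)] by (simp add: u_def)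
  ultimately have "u \<bullet> Add C (i \<bullet> a) (j \<bullet> c) = Add C f g"
    using Cmp_Add_right[OF ia jc u] Cmp_assoc[OF M(2) w(1) u] Cmp_assoc[OF N(2) w(2) u] M(4) N(4) by simp
  then show "factors_through C T (Add C f g)"
    using factors_through_Hom[OF Add_in[OF f g]] \<open>W \<in> T\<close> u Add_in[OF ia jc] by metis
qed

text \<open>A morphism from \<open>A\<close> to \<open>T\<close> extends to \<open>P\<close> because \<open>Z\<close> lies in \<open>S\<close>, and \<open>P\<close> itself lies in \<open>T\<close>. So the morphisms
  \<open>A \<rightarrow> X\<close> modulo \<open>T\<close> are the extensions of \<open>Z\<close> by \<open>X\<close>.\<close>

lemma factors_iff_extends:
  assumes c: "conflation i p A P Z" and P: "P \<in> Proj" and Z: "Z \<in> S" and a: "a \<in> Hom C A X"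
  shows "factors_through C T a \<longleftrightarrow> (\<exists>b \<in> Hom C P X. a = b \<bullet> i)"
proof
  assume "factors_through C T a"
  then obtain W u v where W: "W \<in> T" "u \<in> Hom C A W" "v \<in> Hom C W X" "a = v \<bullet> u"
    using factors_through_Hom[OF a] by blast
  obtain b where b: "b \<in> Hom C P W" "b \<bullet> i = u" using extend_to_T[OF c Z W(1,2)] .
  have "a = (v \<bullet> b) \<bullet> i" using Cmp_assoc[OF conflationD(1)[OF c] b(1) W(3)] b(2) W(4) by simp
  then show "\<exists>b \<in> Hom C P X. a = b \<bullet> i" using Cmp_in[OF b(1) W(3)] by blast
next
  assume "\<exists>b \<in> Hom C P X. a = b \<bullet> i"
  then show "factors_through C T a"
    using factors_through_Hom[OF a] projective_in_T[OF P] conflationD(1)[OF c] by blast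
qed

end

context cotorsion_setting
begin

abbreviation eqT (infix \<open>\<simeq>\<close> 50) where "f \<simeq> g \<equiv> equal_mod T f g"

lemma eqm_extends:
  assumes c: "conflation i p A P Z" and P: "P \<in> Proj" and a: "a \<in> Hom C A X" "a' \<in> Hom C A X"
    and b: "b \<in> Hom C P X" and eq: "a = Add C a' (b \<bullet> i)"
  shows "a \<simeq> a'"
proof -
  note bi = Cmp_in[OF conflationD(1)[OF c] b]
  have "factors_through C T (b \<bullet> i)"
    using factors_through_Hom[OF bi] projective_in_T[OF P] conflationD(1)[OF c] b by blast
  then show ?thesis using eqmI[OF a bi _ eq] by simp
qed


text \<open>Objects of \<open>S\<close> lift along deflations with kernel in \<open>T\<close>: lift to \<open>u : P' \<rightarrow> Y\<close> by projectivity, then correct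
  \<open>u\<close> by a map that factors through \<open>N\<close> until it vanishes on \<open>A'\<close>, which is possible because \<open>A' \<rightarrow> N\<close> extends to \<open>P'\<close>.\<close>

lemma lift_from_S:
  assumes c': "conflation i' p' A' P' Z'" and P': "P' \<in> Proj" and Z': "Z' \<in> S"
    and c: "conflation m n N Y M" and N: "N \<in> T" and t: "t \<in> Hom C Z' M"
  obtains t' where "t' \<in> Hom C Z' Y" "n \<bullet> t' = t"
proof -
  note i' = conflationD(1)[OF c'] and p' = conflationD(2)[OF c'] and m = conflationD(1)[OF c] and n = conflationD(2)[OF c]
  obtain u where u: "u \<in> Hom C P' Y" "n \<bullet> u = t \<bullet> p'" using projective_lift[OF P' c Cmp_in[OF p' t]] .
  have "n \<bullet> (u \<bullet> i') = Zero C A' M"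
    using Cmp_assoc[OF i' u(1) n] u(2) Cmp_assoc[OF i' p' t] defl_infl_zero[OF c'] Cmp_Zero_right[OF t conflationD(3)[OF c']]
    by simp
  then obtain v where v: "v \<in> Hom C A' N" "m \<bullet> v = u \<bullet> i'" using kernel_factor[OF c Cmp_in[OF i' u(1)]] by blast
  obtain w where w: "w \<in> Hom C P' N" "w \<bullet> i' = v" using extend_to_T[OF c' Z' N v(1)] .
  have mw: "m \<bullet> w \<in> Hom C P' Y" using Cmp_in[OF w(1) m] .
  have "u \<bullet> i' = (m \<bullet> w) \<bullet> i'" using Cmp_assoc[OF i' w(1) m] w(2) v(2) by simp
  then obtain t' where t': "t' \<in> Hom C Z' Y" "u = Add C (m \<bullet> w) (t' \<bullet> p')" using cokernel_diff[OF c' u(1) mw] by blast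
  have tp: "t' \<bullet> p' \<in> Hom C P' Y" using Cmp_in[OF p' t'(1)] .
  have "n \<bullet> (m \<bullet> w) = Zero C P' M"
    using Cmp_assoc[OF w(1) m n] defl_infl_zero[OF c] Cmp_Zero_left[OF w(1) conflationD(5)[OF c]] by simp
  then have "n \<bullet> (t' \<bullet> p') = t \<bullet> p'"
    using u(2) t'(2) Cmp_Add_right[OF mw tp n] Add_Zero_left[OF Cmp_in[OF tp n]] by simp
  then have "n \<bullet> t' = t" using defl_cancel[OF c' Cmp_in[OF t'(1) n] t] Cmp_assoc[OF p' t'(1) n] by simp
  then show thesis using that t'(1) by blast
qed

lemma factors_eqm: assumes "a \<simeq> b" "a \<in> Hom C X Y" "b \<in> Hom C X Y"
  shows "factors_through C T a \<longleftrightarrow> factors_through C T b"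
  using eqm_Zero_iff[OF assms(2)] eqm_Zero_iff[OF assms(3)] eqm_trans eqm_sym assms(1) by blast

text \<open>The sequence \<open>A1 \<rightarrow> A \<rightarrow> X\<close> becomes right exact on morphisms out of syzygies once these are taken modulo \<open>T\<close>.
  This is the predicate \<open>presents\<close> for the quotient by \<open>T\<close>, expressed through representatives.\<close>

definition presented_mod_T :: "'o \<Rightarrow> 'o \<Rightarrow> 'o \<Rightarrow> 'm \<Rightarrow> 'm \<Rightarrow> bool" where
  "presented_mod_T X A A\<^sub>1 g x \<longleftrightarrow> A \<in> Syz \<and> A\<^sub>1 \<in> Syz \<and> g \<in> Hom C A\<^sub>1 A \<and> x \<in> Hom C A X \<and>
     factors_through C T (x \<bullet> g) \<and>
     (\<forall>A' \<in> Syz. (\<forall>a \<in> Hom C A' X. \<exists>b \<in> Hom C A' A. a \<simeq> x \<bullet> b) \<and>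
       (\<forall>b \<in> Hom C A' A. factors_through C T (x \<bullet> b) \<longrightarrow> (\<exists>c \<in> Hom C A' A\<^sub>1. b \<simeq> g \<bullet> c)))"


text \<open>Projectivity lifts \<open>t\<close> to the middle terms, and the lift restricts to the kernels.\<close>

lemma map_of_conflations:
  assumes c: "conflation i p A P Z" and P: "P \<in> Proj" and c': "conflation j q X Y W" and t: "t \<in> Hom C Z W"
  obtains l a where "l \<in> Hom C P Y" "q \<bullet> l = t \<bullet> p" "a \<in> Hom C A X" "j \<bullet> a = l \<bullet> i"
proof -
  note i = conflationD(1)[OF c] and p = conflationD(2)[OF c] and q = conflationD(2)[OF c']
  obtain l where l: "l \<in> Hom C P Y" "q \<bullet> l = t \<bullet> p" using projective_lift[OF P c' Cmp_in[OF p t]] .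
  have "q \<bullet> (l \<bullet> i) = Zero C A W"
    using Cmp_assoc[OF i l(1) q] l(2) Cmp_assoc[OF i p t] defl_infl_zero[OF c] Cmp_Zero_right[OF t conflationD(3)[OF c]]
    by simp
  then obtain a where "a \<in> Hom C A X" "j \<bullet> a = l \<bullet> i" using kernel_factor[OF c' Cmp_in[OF i l(1)]] by blast
  then show thesis using that l by blast
qed

text \<open>The criterion for equality modulo \<open>T\<close> behind the exactness claims below: two morphisms \<open>A \<rightarrow> X\<close> that are restrictions of
  morphisms \<open>P \<rightarrow> Y\<close> with the same image in \<open>W\<close> differ by a morphism that extends to \<open>P\<close>.\<close>

lemma eqm_of_agreement:
  assumes c: "conflation i p A P Z" and P: "P \<in> Proj" and c': "conflation j q X Y W"
    and v: "v \<in> Hom C P Y" and w: "w \<in> Hom C P Y" and eq: "q \<bullet> v = q \<bullet> w"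
    and a: "a \<in> Hom C A X" "j \<bullet> a = v \<bullet> i" and b: "b \<in> Hom C A X" "j \<bullet> b = w \<bullet> i"
  shows "a \<simeq> b"
proof -
  note i = conflationD(1)[OF c] and j = conflationD(1)[OF c']
  obtain f where f: "f \<in> Hom C P X" "v = Add C w (j \<bullet> f)" using kernel_diff[OF c' v w eq] .
  note fi = Cmp_in[OF i f(1)]
  have "j \<bullet> a = j \<bullet> Add C b (f \<bullet> i)"
    using a(2) b(2) f(2) Cmp_Add_left[OF i w Cmp_in[OF f(1) j]] Cmp_assoc[OF i f(1) j] Cmp_Add_right[OF b(1) fi j] by simp
  then have "a = Add C b (f \<bullet> i)" using infl_cancel[OF c' a(1) Add_in[OF b(1) fi]] by simp
  then show ?thesis using eqm_extends[OF c P a(1) b(1) f(1)] by simp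
qed

text \<open>Start from conflations \<open>X \<rightarrow> M \<rightarrow> Z\<close> and \<open>N \<rightarrow> Z1 \<rightarrow> M\<close> with \<open>M\<close>, \<open>N\<close> in \<open>T\<close> and \<open>Z\<close>, \<open>Z1\<close> in \<open>S\<close>. Take conflations
  \<open>A \<rightarrow> P \<rightarrow> Z\<close> and \<open>A1 \<rightarrow> P1 \<rightarrow> Z1\<close> with \<open>P\<close>, \<open>P1\<close> projective. By projectivity the first maps to
  \<open>X \<rightarrow> M \<rightarrow> Z\<close> over the identity and the second maps to the first over \<open>Z1 \<rightarrow> M \<rightarrow> Z\<close>, inducing \<open>x : A \<rightarrow> X\<close>
  and \<open>g : A1 \<rightarrow> A\<close>. By the conflation \<open>A \<rightarrow> X \<oplus> P \<rightarrow> M\<close>, the kernel of \<open>x\<close> on morphisms from \<open>A'\<close> consists of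
  what comes from morphisms \<open>Z' \<rightarrow> M\<close>. These lift to \<open>Z1\<close>, so that the kernel is the image of \<open>g\<close>. The second claim says that \<open>x\<close> is an epimorphism modulo \<open>T\<close>.\<close>

lemma presentation_of_object:
  assumes X: "X \<in> Obj C"
  obtains A A\<^sub>1 g x where "presented_mod_T X A A\<^sub>1 g x"
    "\<And>Y h. \<lbrakk>h \<in> Hom C X Y; factors_through C T (h \<bullet> x)\<rbrakk> \<Longrightarrow> factors_through C T h"
proof -
  obtain j q M Z where c: "conflation j q X M Z" and M: "M \<in> T" and Z: "Z \<in> S" using T_approximation[OF X] .
  note j = conflationD(1)[OF c] and q = conflationD(2)[OF c]
  obtain P A i p where P: "P \<in> Proj" and cA: "conflation i p A P Z" using deflation_from_projective[OF S_Obj[OF Z]] .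
  note i = conflationD(1)[OF cA] and p = conflationD(2)[OF cA] and AO = conflationD(3)[OF cA]
  have A: "A \<in> Syz" using syzygyI[OF cA P Z] .
  obtain k x where k: "k \<in> Hom C P M" "q \<bullet> k = p" and x: "x \<in> Hom C A X" "j \<bullet> x = k \<bullet> i"
    using map_of_conflations[OF cA P c Idn_in[OF S_Obj[OF Z]]] Idn_left[OF p] by metis
  obtain m n N Z\<^sub>1 where cN: "conflation m n N Z\<^sub>1 M" and N: "N \<in> T" and Z1: "Z\<^sub>1 \<in> S"
    using S_approximation[OF T_Obj[OF M]] .
  note n = conflationD(2)[OF cN]
  obtain P\<^sub>1 A\<^sub>1 i\<^sub>1 p\<^sub>1 where P1: "P\<^sub>1 \<in> Proj" and cA1: "conflation i\<^sub>1 p\<^sub>1 A\<^sub>1 P\<^sub>1 Z\<^sub>1"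
    using deflation_from_projective[OF S_Obj[OF Z1]] .
  note i1 = conflationD(1)[OF cA1] and p1 = conflationD(2)[OF cA1]
  have A1: "A\<^sub>1 \<in> Syz" using syzygyI[OF cA1 P1 Z1] .
  have qn: "q \<bullet> n \<in> Hom C Z\<^sub>1 Z" using Cmp_in[OF n q] .
  obtain d g where d: "d \<in> Hom C P\<^sub>1 P" "p \<bullet> d = (q \<bullet> n) \<bullet> p\<^sub>1"
    and g: "g \<in> Hom C A\<^sub>1 A" "i \<bullet> g = d \<bullet> i\<^sub>1" using map_of_conflations[OF cA1 P1 cA qn] .
  \<comment> \<open>Over \<open>Z\<close> the morphisms \<open>k d\<close> and \<open>n p1\<close> agree, and they restrict to \<open>j x g\<close> and to zero on \<open>A1\<close>.\<close>
  have xg: "factors_through C T (x \<bullet> g)"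
  proof -
    note xg0 = Cmp_in[OF g(1) x(1)] and A1O = conflationD(3)[OF cA1]
    have np: "n \<bullet> p\<^sub>1 \<in> Hom C P\<^sub>1 M" and kd: "k \<bullet> d \<in> Hom C P\<^sub>1 M" using Cmp_in[OF p1 n] Cmp_in[OF d(1) k(1)] .
    have "q \<bullet> (k \<bullet> d) = q \<bullet> (n \<bullet> p\<^sub>1)"
      using Cmp_assoc[OF d(1) k(1) q] Cmp_assoc[OF p1 n q] k(2) d(2) by simp
    moreover have "j \<bullet> (x \<bullet> g) = (k \<bullet> d) \<bullet> i\<^sub>1"
      using Cmp_assoc[OF g(1) x(1) j] x(2) Cmp_assoc[OF g(1) i k(1)] g(2) Cmp_assoc[OF i1 d(1) k(1)] by simp
    moreover have "j \<bullet> Zero C A\<^sub>1 X = (n \<bullet> p\<^sub>1) \<bullet> i\<^sub>1"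
      using Cmp_assoc[OF i1 p1 n] defl_infl_zero[OF cA1] Cmp_Zero_right[OF n A1O] Cmp_Zero_right[OF j A1O] by simp
    ultimately have "x \<bullet> g \<simeq> Zero C A\<^sub>1 X"
      using eqm_of_agreement[OF cA1 P1 c kd np _ xg0 _ Zero_in[OF A1O X]] by blast
    then show ?thesis using eqm_Zero_iff[OF xg0] by simp
  qed
  have onto: "\<exists>a' \<in> Hom C A' A. a \<simeq> x \<bullet> a'" if A': "A' \<in> Syz" and a: "a \<in> Hom C A' X" for A' a
  proof -
    obtain i' p' P' Z' where P': "P' \<in> Proj" and Z': "Z' \<in> S" and c': "conflation i' p' A' P' Z'" using syzygyE[OF A'] .
    note i' = conflationD(1)[OF c'] and p' = conflationD(2)[OF c']
    obtain b where b: "b \<in> Hom C P' M" "b \<bullet> i' = j \<bullet> a" using extend_to_T[OF c' Z' M Cmp_in[OF a j]] .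
    have qb: "q \<bullet> b \<in> Hom C P' Z" using Cmp_in[OF b(1) q] .
    obtain e where e: "e \<in> Hom C P' P" "p \<bullet> e = q \<bullet> b" using projective_lift[OF P' cA qb] .
    have "p \<bullet> (e \<bullet> i') = Zero C A' Z"
      using Cmp_assoc[OF i' e(1) p] e(2) Cmp_assoc[OF i' b(1) q] b(2) Cmp_assoc[OF a j q] defl_infl_zero[OF c]
        Cmp_Zero_left[OF a S_Obj[OF Z]] by simp
    then obtain a' where a': "a' \<in> Hom C A' A" "i \<bullet> a' = e \<bullet> i'"
      using kernel_factor[OF cA Cmp_in[OF i' e(1)]] by blast
    have ke: "k \<bullet> e \<in> Hom C P' M" using Cmp_in[OF e(1) k(1)] .
    have "q \<bullet> b = q \<bullet> (k \<bullet> e)" using Cmp_assoc[OF e(1) k(1) q] k(2) e(2) by simp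
    moreover have "j \<bullet> (x \<bullet> a') = (k \<bullet> e) \<bullet> i'"
      using Cmp_assoc[OF i' e(1) k(1)] a'(2) Cmp_assoc[OF a'(1) i k(1)] x(2) Cmp_assoc[OF a'(1) x(1) j] by simp
    ultimately have "a \<simeq> x \<bullet> a'"
      using eqm_of_agreement[OF c' P' c b(1) ke _ a b(2)[symmetric] Cmp_in[OF a'(1) x(1)]] by blast
    then show ?thesis using a'(1) by blast
  qed
  have ker: "\<exists>b \<in> Hom C A' A\<^sub>1. a \<simeq> g \<bullet> b"
    if A': "A' \<in> Syz" and a: "a \<in> Hom C A' A" and null: "factors_through C T (x \<bullet> a)" for A' a
  proof -
    obtain i' p' P' Z' where P': "P' \<in> Proj" and Z': "Z' \<in> S" and c': "conflation i' p' A' P' Z'" using syzygyE[OF A'] .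
    note i' = conflationD(1)[OF c'] and p' = conflationD(2)[OF c']
    obtain f where f: "f \<in> Hom C P' X" "x \<bullet> a = f \<bullet> i'"
      using factors_iff_extends[OF c' P' Z' Cmp_in[OF a x(1)]] null by blast
    obtain e where e: "e \<in> Hom C P' P" "e \<bullet> i' = i \<bullet> a"
      using extend_to_T[OF c' Z' projective_in_T[OF P] Cmp_in[OF a i]] .
    have ke: "k \<bullet> e \<in> Hom C P' M" and jf: "j \<bullet> f \<in> Hom C P' M" using Cmp_in[OF e(1) k(1)] Cmp_in[OF f(1) j] .
    have "(k \<bullet> e) \<bullet> i' = (j \<bullet> f) \<bullet> i'"
      using Cmp_assoc[OF i' e(1) k(1)] e(2) Cmp_assoc[OF a i k(1)] x(2) Cmp_assoc[OF a x(1) j] f(2) Cmp_assoc[OF i' f(1) j]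
      by simp
    then obtain t where t: "t \<in> Hom C Z' M" "k \<bullet> e = Add C (j \<bullet> f) (t \<bullet> p')"
      using cokernel_diff[OF c' ke jf] by blast
    have tp': "t \<bullet> p' \<in> Hom C P' M" using Cmp_in[OF p' t(1)] .
    have "p \<bullet> e = q \<bullet> (k \<bullet> e)" using Cmp_assoc[OF e(1) k(1) q] k(2) by simp
    also have "\<dots> = Add C (q \<bullet> (j \<bullet> f)) (q \<bullet> (t \<bullet> p'))" using t(2) Cmp_Add_right[OF jf tp' q] by simp
    also have "q \<bullet> (j \<bullet> f) = Zero C P' Z"
      using Cmp_assoc[OF f(1) j q] defl_infl_zero[OF c] Cmp_Zero_left[OF f(1) S_Obj[OF Z]] by simp
    also have "Add C (Zero C P' Z) (q \<bullet> (t \<bullet> p')) = q \<bullet> (t \<bullet> p')" using Add_Zero_left[OF Cmp_in[OF tp' q]] .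
    finally have pe: "p \<bullet> e = q \<bullet> (t \<bullet> p')" .
    \<comment> \<open>The morphism \<open>t : Z' \<rightarrow> M\<close> is the obstruction to lifting \<open>a\<close>. It lifts to \<open>Z1\<close>, and from there \<open>P' \<rightarrow> Z1\<close> lifts to \<open>P1\<close>.\<close>
    obtain t' where t': "t' \<in> Hom C Z' Z\<^sub>1" "n \<bullet> t' = t" using lift_from_S[OF c' P' Z' cN N t(1)] .
    obtain l b where l: "l \<in> Hom C P' P\<^sub>1" "p\<^sub>1 \<bullet> l = t' \<bullet> p'"
      and b: "b \<in> Hom C A' A\<^sub>1" "i\<^sub>1 \<bullet> b = l \<bullet> i'" using map_of_conflations[OF c' P' cA1 t'(1)] .
    have dl: "d \<bullet> l \<in> Hom C P' P" using Cmp_in[OF l(1) d(1)] .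
    have "p \<bullet> (d \<bullet> l) = (q \<bullet> n) \<bullet> (t' \<bullet> p')"
      using Cmp_assoc[OF l(1) d(1) p] d(2) Cmp_assoc[OF l(1) p1 qn] l(2) by simp
    also have "\<dots> = q \<bullet> (t \<bullet> p')"
      using Cmp_assoc[OF Cmp_in[OF p' t'(1)] n q] Cmp_assoc[OF p' t'(1) n] t'(2) by simp
    finally have "p \<bullet> e = p \<bullet> (d \<bullet> l)" using pe by simp
    moreover have "i \<bullet> (g \<bullet> b) = (d \<bullet> l) \<bullet> i'"
      using Cmp_assoc[OF i' l(1) d(1)] b(2) Cmp_assoc[OF b(1) i1 d(1)] g(2) Cmp_assoc[OF b(1) g(1) i] by simp
    ultimately have "a \<simeq> g \<bullet> b"
      using eqm_of_agreement[OF c' P' cA e(1) dl _ a e(2)[symmetric] Cmp_in[OF b(1) g(1)]] by blast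
    then show ?thesis using b(1) by blast
  qed
  have "presented_mod_T X A A\<^sub>1 g x"
    unfolding presented_mod_T_def using A A1 g(1) x(1) xg onto ker by blast
  moreover have "factors_through C T h"
    if h: "h \<in> Hom C X Y" and hx: "factors_through C T (h \<bullet> x)" for Y h
  proof -
    obtain b where b: "b \<in> Hom C P Y" "h \<bullet> x = b \<bullet> i"
      using factors_iff_extends[OF cA P Z Cmp_in[OF x(1) h]] hx by blast
    \<comment> \<open>The square formed by \<open>A\<close>, \<open>P\<close>, \<open>X\<close> and \<open>M\<close> is a pushout, and \<open>h\<close> agrees on \<open>A\<close> with a morphism from \<open>P\<close>.\<close>
    obtain u where "u \<in> Hom C M Y" "u \<bullet> j = h"
      using extend_along_conflation_map[OF cA c k x(1) x(2)[symmetric] h b] .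
    then show ?thesis using factors_through_Hom[OF h] M j by blast
  qed
  ultimately show thesis using that by blast
qed

text \<open>\<open>W\<close> is the pushout of \<open>g\<close> along the inflation \<open>A1 \<rightarrow> P1\<close>. A morphism \<open>y\<close> with \<open>y g\<close> zero modulo \<open>T\<close> has \<open>y g\<close> extended to
  \<open>P1\<close>, which is the datum needed to define \<open>h\<close> on the pushout. The conflation \<open>A \<rightarrow> W \<rightarrow> Z1\<close> gives right
  exactness: here \<open>Z1\<close> lies in \<open>S\<close>, hence in \<open>T\<close>, so every morphism from a syzygy to \<open>W\<close> comes from \<open>A\<close> modulo \<open>T\<close>.\<close>

lemma weak_cokernel_of_syzygies:
  assumes A: "A \<in> Syz" and A1: "A\<^sub>1 \<in> Syz" and g: "g \<in> Hom C A\<^sub>1 A"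
  obtains W i where "presented_mod_T W A A\<^sub>1 g i"
    "\<And>Y y. \<lbrakk>y \<in> Hom C A Y; factors_through C T (y \<bullet> g)\<rbrakk> \<Longrightarrow> \<exists>h \<in> Hom C W Y. h \<bullet> i = y"
proof -
  obtain i\<^sub>1 p\<^sub>1 P\<^sub>1 Z\<^sub>1 where P1: "P\<^sub>1 \<in> Proj" and Z1: "Z\<^sub>1 \<in> S" and c1: "conflation i\<^sub>1 p\<^sub>1 A\<^sub>1 P\<^sub>1 Z\<^sub>1" using syzygyE[OF A1] .
  note i1 = conflationD(1)[OF c1] and p1 = conflationD(2)[OF c1]
  obtain W i f r where c: "conflation i r A W Z\<^sub>1" and f: "f \<in> Hom C P\<^sub>1 W" and comm: "i \<bullet> g = f \<bullet> i\<^sub>1" and rf: "r \<bullet> f = p\<^sub>1"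
    and up: "\<And>Y u v. \<lbrakk>u \<in> Hom C A Y; v \<in> Hom C P\<^sub>1 Y; u \<bullet> g = v \<bullet> i\<^sub>1\<rbrakk> \<Longrightarrow> \<exists>h \<in> Hom C W Y. h \<bullet> i = u \<and> h \<bullet> f = v"
    using conflation_pushout[OF c1 g] by metis
  note i = conflationD(1)[OF c] and r = conflationD(2)[OF c]
  have onto: "\<exists>a' \<in> Hom C A' A. a \<simeq> i \<bullet> a'" if A': "A' \<in> Syz" and a: "a \<in> Hom C A' W" for A' a
  proof -
    obtain i' p' P' Z' where P': "P' \<in> Proj" and Z': "Z' \<in> S" and c': "conflation i' p' A' P' Z'" using syzygyE[OF A'] .
    note i' = conflationD(1)[OF c']
    have "Z\<^sub>1 \<in> T" using Z1 S_subset_T by blast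
    then obtain b where b: "b \<in> Hom C P' Z\<^sub>1" "b \<bullet> i' = r \<bullet> a" using extend_to_T[OF c' Z' _ Cmp_in[OF a r]] by blast
    obtain b' where b': "b' \<in> Hom C P' W" "r \<bullet> b' = b" using projective_lift[OF P' c b(1)] .
    note bi = Cmp_in[OF i' b'(1)]
    have "r \<bullet> a = r \<bullet> (b' \<bullet> i')" using Cmp_assoc[OF i' b'(1) r] b'(2) b(2) by simp
    then obtain a' where a': "a' \<in> Hom C A' A" "a = Add C (b' \<bullet> i') (i \<bullet> a')" using kernel_diff[OF c a bi] by blast
    note ia' = Cmp_in[OF a'(1) i]
    have "a = Add C (i \<bullet> a') (b' \<bullet> i')" using a'(2) Add_comm[OF bi ia'] by simp
    then show ?thesis using eqm_extends[OF c' P' a ia' b'(1)] a'(1) by blast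
  qed
  have ker: "\<exists>b \<in> Hom C A' A\<^sub>1. a \<simeq> g \<bullet> b"
    if A': "A' \<in> Syz" and a: "a \<in> Hom C A' A" and null: "factors_through C T (i \<bullet> a)" for A' a
  proof -
    obtain i' p' P' Z' where P': "P' \<in> Proj" and Z': "Z' \<in> S" and c': "conflation i' p' A' P' Z'" using syzygyE[OF A'] .
    note i' = conflationD(1)[OF c'] and p' = conflationD(2)[OF c']
    obtain e where e: "e \<in> Hom C P' W" "i \<bullet> a = e \<bullet> i'"
      using factors_iff_extends[OF c' P' Z' Cmp_in[OF a i]] null by blast
    have "(r \<bullet> e) \<bullet> i' = Zero C A' Z\<^sub>1"
      using Cmp_assoc[OF i' e(1) r] e(2) Cmp_assoc[OF a i r] defl_infl_zero[OF c] Cmp_Zero_left[OF a S_Obj[OF Z1]] by simp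
    then obtain t where t: "t \<in> Hom C Z' Z\<^sub>1" "t \<bullet> p' = r \<bullet> e"
      using cokernel_factor[OF c' Cmp_in[OF e(1) r]] by blast
    obtain l b where l: "l \<in> Hom C P' P\<^sub>1" "p\<^sub>1 \<bullet> l = t \<bullet> p'"
      and b: "b \<in> Hom C A' A\<^sub>1" "i\<^sub>1 \<bullet> b = l \<bullet> i'" using map_of_conflations[OF c' P' c1 t(1)] .
    have fl: "f \<bullet> l \<in> Hom C P' W" using Cmp_in[OF l(1) f] .
    have "r \<bullet> e = r \<bullet> (f \<bullet> l)" using Cmp_assoc[OF l(1) f r] rf l(2) t(2) by simp
    moreover have "i \<bullet> (g \<bullet> b) = (f \<bullet> l) \<bullet> i'"
      using Cmp_assoc[OF i' l(1) f] b(2) Cmp_assoc[OF b(1) i1 f] comm Cmp_assoc[OF b(1) g i] by simp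
    ultimately have "a \<simeq> g \<bullet> b"
      using eqm_of_agreement[OF c' P' c e(1) fl _ a e(2) Cmp_in[OF b(1) g]] by blast
    then show ?thesis using b(1) by blast
  qed
  have "factors_through C T (i \<bullet> g)"
    using factors_through_Hom[OF Cmp_in[OF g i]] projective_in_T[OF P1] i1 f comm by blast
  then have "presented_mod_T W A A\<^sub>1 g i"
    unfolding presented_mod_T_def using A A1 g i onto ker by blast
  moreover have "\<exists>h \<in> Hom C W Y. h \<bullet> i = y"
    if y: "y \<in> Hom C A Y" and null: "factors_through C T (y \<bullet> g)" for Y y
  proof -
    obtain v where "v \<in> Hom C P\<^sub>1 Y" "y \<bullet> g = v \<bullet> i\<^sub>1"
      using factors_iff_extends[OF c1 P1 Z1 Cmp_in[OF g y]] null by blast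
    then show ?thesis using up[OF y] by blast
  qed
  ultimately show thesis using that by blast
qed

text \<open>Push \<open>j : X \<rightarrow> M\<close> out along \<open>f\<close> to get \<open>j' : Y \<rightarrow> N\<close>. Then \<open>j' f\<close> factors through \<open>M\<close>, so \<open>j'\<close> vanishes modulo \<open>T\<close> by
  hypothesis. Thus \<open>j' a\<close> extends to \<open>v : P \<rightarrow> N\<close>, and \<open>v\<close> is a sum of morphisms through \<open>M\<close> and \<open>Y\<close>. Restricted
  to \<open>A\<close>, the part through \<open>M\<close> comes from \<open>b : A \<rightarrow> X\<close> and the part through \<open>Y\<close> factors through \<open>P\<close>.\<close>

lemma lift_along_quotient_epi:
  assumes f: "f \<in> Hom C X Y"
    and epi: "\<And>W u. \<lbrakk>u \<in> Hom C Y W; factors_through C T (u \<bullet> f)\<rbrakk> \<Longrightarrow> factors_through C T u"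
    and A: "A \<in> Syz" and a: "a \<in> Hom C A Y"
  shows "\<exists>b \<in> Hom C A X. a \<simeq> f \<bullet> b"
proof -
  obtain j q M Z where c: "conflation j q X M Z" and M: "M \<in> T" and Z: "Z \<in> S" using T_approximation[OF Hom_Dom[OF f]] .
  note j = conflationD(1)[OF c] and q = conflationD(2)[OF c]
  obtain N j' f' q' where c': "conflation j' q' Y N Z" and f': "f' \<in> Hom C M N" and comm: "j' \<bullet> f = f' \<bullet> j" and qf: "q' \<bullet> f' = q"
    using conflation_pushout[OF c f] by metis
  note j' = conflationD(1)[OF c'] and q' = conflationD(2)[OF c']
  have "factors_through C T (j' \<bullet> f)" using factors_through_Hom[OF Cmp_in[OF f j']] M j f' comm by blast
  then have "factors_through C T (j' \<bullet> a)" using factors_Cmp_right[OF epi[OF j'] j' a] by blast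
  moreover obtain i p P Z' where P: "P \<in> Proj" and Z': "Z' \<in> S" and cA: "conflation i p A P Z'" using syzygyE[OF A] .
  ultimately obtain v where v: "v \<in> Hom C P N" "j' \<bullet> a = v \<bullet> i"
    using factors_iff_extends[OF cA P Z' Cmp_in[OF a j']] by blast
  note i = conflationD(1)[OF cA] and AO = conflationD(3)[OF cA]
  obtain t where t: "t \<in> Hom C P M" "q \<bullet> t = q' \<bullet> v" using projective_lift[OF P c Cmp_in[OF v(1) q']] .
  have ft: "f' \<bullet> t \<in> Hom C P N" using Cmp_in[OF t(1) f'] .
  have qv: "q' \<bullet> v = q' \<bullet> (f' \<bullet> t)" using Cmp_assoc[OF t(1) f' q'] qf t(2) by simp
  have "q \<bullet> (t \<bullet> i) = (q' \<bullet> v) \<bullet> i" using Cmp_assoc[OF i t(1) q] t(2) by simp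
  also have "\<dots> = (q' \<bullet> j') \<bullet> a" using Cmp_assoc[OF i v(1) q'] v(2) Cmp_assoc[OF a j' q'] by simp
  also have "\<dots> = Zero C A Z" using defl_infl_zero[OF c'] Cmp_Zero_left[OF a S_Obj[OF Z]] by simp
  finally obtain b where b: "b \<in> Hom C A X" "j \<bullet> b = t \<bullet> i"
    using kernel_factor[OF c Cmp_in[OF i t(1)]] by blast
  have "j' \<bullet> (f \<bullet> b) = (f' \<bullet> t) \<bullet> i"
    using Cmp_assoc[OF i t(1) f'] b(2) Cmp_assoc[OF b(1) j f'] comm Cmp_assoc[OF b(1) f j'] by simp
  then have "a \<simeq> f \<bullet> b" using eqm_of_agreement[OF cA P c' v(1) ft qv a v(2) Cmp_in[OF b(1) f]] by simp
  then show ?thesis using b(1) by blast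
qed

end

section \<open>The quotient of the syzygies inside the quotient by \<open>T\<close>\<close>

context cotorsion_setting
begin

abbreviation "syzygy_quotient \<equiv> quot_cat (full_sub C Syz) Proj"
abbreviation "syzygy_rel \<equiv> quot_rel (full_sub C Syz) Proj"

text \<open>Projectives are syzygies, so a factorisation through a projective stays among the syzygies.\<close>

lemma factors_through_syzygies:
  assumes A: "A \<in> Syz" and B: "B \<in> Syz" and n: "n \<in> Hom C A B"
  shows "factors_through (full_sub C Syz) Proj n \<longleftrightarrow> factors_through C T n"
proof -
  have eq: "factors_through (full_sub C Syz) Proj n \<longleftrightarrow> (\<exists>P \<in> Proj. \<exists>a \<in> Hom C A P. \<exists>b \<in> Hom C P B. n = b \<bullet> a)"
    using n A B projective_syzygy by (auto simp: factors_through_def full_sub_simps Hom_full_sub HomD)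
  obtain i p P Z where P: "P \<in> Proj" "Z \<in> S" and c: "conflation i p A P Z" using syzygyE[OF A] .
  show ?thesis unfolding eq
    using factors_iff_extends[OF c P n] factors_through_Hom[OF n] projective_in_T P(1) conflationD(1)[OF c] by blast
qed

lemma syzygy_rel_iff:
  assumes A: "A \<in> Syz" and B: "B \<in> Syz" and f: "f \<in> Hom C A B"
  shows "(f, g) \<in> syzygy_rel \<longleftrightarrow> (f, g) \<in> quot_rel C T"
proof -
  have d: "Dom C f = A" "Cod C f = B" "f \<in> Arr C" using f by (auto simp: Hom_def)
  have m: "hom_module (full_sub C Syz) A B = hom_module C A B"
    using A B by (simp add: hom_module_def Hom_full_sub full_sub_lincat_simps)
  have "factors_through (full_sub C Syz) Proj (f \<ominus>\<^bsub>hom_module C A B\<^esub> g)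
      \<longleftrightarrow> factors_through C T (f \<ominus>\<^bsub>hom_module C A B\<^esub> g)" if "g \<in> Hom C A B"
    using factors_through_syzygies[OF A B hom_module_minus_in[OF f that]] .
  moreover have "f \<in> Arr (full_sub C Syz)" using A B d by (simp add: full_sub_def)
  ultimately show ?thesis
    using d A B m by (auto simp: quot_rel_def full_sub_simps Hom_full_sub)
qed

lemma syzygy_class:
  assumes "A \<in> Syz" "B \<in> Syz" "f \<in> Hom C A B" shows "syzygy_rel `` {f} = cls f"
  using syzygy_rel_iff[OF assms] by (auto simp: cls_def)

lemma cls_Hom: "\<lbrakk>f \<in> Hom C X Y; g \<in> cls f\<rbrakk> \<Longrightarrow> g \<in> Hom C X Y"
  by (auto simp: mem_cls equal_mod_def Hom_def)

text \<open>Since the two congruences coincide on morphisms between syzygies, so do their classes.\<close>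

lemma Hom_syzygy_quotient:
  "Hom syzygy_quotient A B = (if A \<in> Syz \<and> B \<in> Syz then Hom Q A B else {})"
proof (intro Set.set_eqI iffI)
  fix c assume c: "c \<in> Hom syzygy_quotient A B"
  then have "c \<in> Arr (full_sub C Syz) // syzygy_rel" "the_elem (Dom C ` c) = A" "the_elem (Cod C ` c) = B"
    by (auto simp: Hom_def quot_cat_def full_sub_simps)
  then obtain f where f: "f \<in> Arr C" "Dom C f \<in> Syz" "Cod C f \<in> Syz" "c = syzygy_rel `` {f}"
    by (auto simp: full_sub_def elim!: quotientE)
  have fH: "f \<in> Hom C (Dom C f) (Cod C f)" using f(1) by (rule Arr_Hom)
  have cf: "c = cls f" using syzygy_class[OF f(2,3) fH] f(4) by simp
  then have "Dom C f = A" "Cod C f = B"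
    using image_cls[OF fH] \<open>the_elem (Dom C ` c) = A\<close> \<open>the_elem (Cod C ` c) = B\<close> by auto
  then show "c \<in> (if A \<in> Syz \<and> B \<in> Syz then Hom Q A B else {})"
    using cf cls_in[OF fH] f(2,3) by simp
next
  fix c assume c: "c \<in> (if A \<in> Syz \<and> B \<in> Syz then Hom Q A B else {})"
  then have AB: "A \<in> Syz" "B \<in> Syz" by (auto split: if_splits)
  then have cQ: "c \<in> Hom Q A B" using c by simp
  obtain f where f: "f \<in> Hom C A B" "c = cls f" using cls_cases[OF cQ] .
  have "f \<in> Arr (full_sub C Syz)" using f AB by (auto simp: Hom_def full_sub_def)
  then have "cls f \<in> Arr (full_sub C Syz) // syzygy_rel"
    using quotientI[of f "Arr (full_sub C Syz)" syzygy_rel] syzygy_class[OF AB f(1)] by simp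
  then show "c \<in> Hom syzygy_quotient A B"
    using image_cls[OF f(1)] f(2) by (simp add: Hom_def quot_cat_def full_sub_simps)
qed

text \<open>A class of morphisms is encoded by the image under \<open>u\<close> of a chosen representative; this is injective
  because classes are disjoint.\<close>

lemma quotient_is_restricted_hom:
  fixes u :: "'m \<Rightarrow> 'v"
  assumes u: "inj u"
  shows "restricted_hom K Q syzygy_quotient (\<lambda>c. u (SOME f. f \<in> c))"
proof (intro restricted_hom.intro restricted_hom_axioms.intro linear_category_quot)
  show "A \<in> Obj Q" if "A \<in> Obj syzygy_quotient" for A
    using that syzygy_Obj by (simp add: quot_cat_def full_sub_simps)
  have Obj: "Obj syzygy_quotient = Syz" by (simp add: quot_cat_def full_sub_simps)
  show "Hom syzygy_quotient A B = Hom Q A B"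
    if "A \<in> Obj syzygy_quotient" "B \<in> Obj syzygy_quotient" for A B
    using that by (simp add: Hom_syzygy_quotient Obj)
  show "Dom syzygy_quotient c \<in> Obj syzygy_quotient \<and> Cod syzygy_quotient c \<in> Obj syzygy_quotient"
    if "c \<in> Arr syzygy_quotient" for c
    using Arr_Hom[OF that] unfolding Hom_syzygy_quotient Obj by (auto split: if_splits)
  show "Idn syzygy_quotient A = Idn Q A" if "A \<in> Obj syzygy_quotient" for A
  proof -
    have A: "A \<in> Syz" using that by (simp add: Obj)
    have "Idn syzygy_quotient A = syzygy_rel `` {Idn C A}" by (simp add: quot_cat_def full_sub_simps)
    then show ?thesis using syzygy_class[OF A A Idn_in[OF syzygy_Obj[OF A]]] quot_Idn[of A] by simp
  qed
  have pairs: "A \<in> Syz \<and> B \<in> Syz \<and> (\<exists>f \<in> Hom C A B. c = cls f)" if "c \<in> Hom syzygy_quotient A B" for c A B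
  proof -
    have "A \<in> Syz \<and> B \<in> Syz" "c \<in> Hom Q A B"
      using that unfolding Hom_syzygy_quotient by (auto split: if_splits)
    then show ?thesis using cls_cases[of c A B] by blast
  qed
  show "d \<cdot>\<^bsub>syzygy_quotient\<^esub> c = d \<cdot>\<^bsub>Q\<^esub> c"
    if c: "c \<in> Hom syzygy_quotient A B" and d: "d \<in> Hom syzygy_quotient B X" for c d A B X
  proof -
    obtain f g where f: "f \<in> Hom C A B" "c = cls f" and g: "g \<in> Hom C B X" "d = cls g" using pairs[OF c] pairs[OF d] by blast
    have "syzygy_rel `` {g' \<bullet> f'} = quot_rel C T `` {g' \<bullet> f'}" if "f' \<in> c" "g' \<in> d" for f' g'
      using syzygy_class[OF _ _ Cmp_in[OF cls_Hom[OF f(1)] cls_Hom[OF g(1)]]] pairs[OF c] pairs[OF d] that f g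
      by (simp add: cls_def)
    then show ?thesis by (simp add: quot_cat_def full_sub_simps)
  qed
  show "Add syzygy_quotient c d = Add Q c d"
    if c: "c \<in> Hom syzygy_quotient A B" and d: "d \<in> Hom syzygy_quotient A B" for c d A B
  proof -
    obtain f g where f: "f \<in> Hom C A B" "c = cls f" and g: "g \<in> Hom C A B" "d = cls g" using pairs[OF c] pairs[OF d] by blast
    have "syzygy_rel `` {Add C f' g'} = quot_rel C T `` {Add C f' g'}" if "f' \<in> c" "g' \<in> d" for f' g'
      using syzygy_class[OF _ _ Add_in[OF cls_Hom[OF f(1)] cls_Hom[OF g(1)]]] pairs[OF c] that f g
      by (simp add: cls_def)
    then show ?thesis by (simp add: quot_cat_def full_sub_def)
  qed
  show "Scal syzygy_quotient k c = Scal Q k c"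
    if k: "k \<in> carrier K" and c: "c \<in> Hom syzygy_quotient A B" for k c A B
  proof -
    obtain f where f: "f \<in> Hom C A B" "c = cls f" using pairs[OF c] by blast
    have "syzygy_rel `` {Scal C k f'} = quot_rel C T `` {Scal C k f'}" if "f' \<in> c" for f'
      using syzygy_class[OF _ _ Scal_in[OF k cls_Hom[OF f(1)]]] pairs[OF c] that f by (simp add: cls_def)
    then show ?thesis by (simp add: quot_cat_def full_sub_def)
  qed
  show "inj_on (\<lambda>c. u (SOME f. f \<in> c)) (Arr Q)"
  proof (rule inj_onI)
    fix c d assume c: "c \<in> Arr Q" and d: "d \<in> Arr Q"
      and eq: "u (SOME f. f \<in> c) = u (SOME f. f \<in> d)"
    obtain f where f: "f \<in> Hom C (Dom Q c) (Cod Q c)" "c = cls f" using cls_cases[OF Arr_Hom[OF c]] .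
    obtain g where g: "g \<in> Hom C (Dom Q d) (Cod Q d)" "d = cls g" using cls_cases[OF Arr_Hom[OF d]] .
    have "(SOME f. f \<in> c) \<in> c" using someI[of "\<lambda>h. h \<in> c" f] eqm_refl[OF f(1)] f(2) by (simp add: mem_cls)
    moreover have "(SOME f. f \<in> d) \<in> d" using someI[of "\<lambda>h. h \<in> d" g] eqm_refl[OF g(1)] g(2) by (simp add: mem_cls)
    moreover have "(SOME f. f \<in> c) = (SOME f. f \<in> d)" using injD[OF u eq] .
    ultimately have "equal_mod T f (SOME f. f \<in> c)" "equal_mod T g (SOME f. f \<in> c)" using f(2) g(2) by (simp_all add: mem_cls)
    then have "cls f = cls g" using cls_eqI eqm_trans eqm_sym by blast
    then show "c = d" using f g by simp
  qed
qed

lemma quotient_is_presented: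
  fixes u :: "'m \<Rightarrow> 'v"
  assumes u: "inj u"
  shows "presented_category K Q syzygy_quotient (\<lambda>c. u (SOME f. f \<in> c))"
proof -
  define e where "e = (\<lambda>c. u (SOME f. f \<in> c))"
  have R: "restricted_hom K Q syzygy_quotient e" unfolding e_def using quotient_is_restricted_hom[OF u] .
  interpret R: restricted_hom K Q syzygy_quotient e by (rule R)
  have Obj: "Obj syzygy_quotient = Syz" by (simp add: quot_cat_def full_sub_simps)
  have zero: "cls f = Zero Q X Y \<longleftrightarrow> factors_through C T f" if f: "f \<in> Hom C X Y" for f X Y
    unfolding quot_Zero using cls_eq_Hom[OF f Zero_in[OF Hom_Dom[OF f] Hom_Cod[OF f]]] eqm_Zero_iff[OF f] by simp
  have pres: "R.presents X A A\<^sub>1 (cls g) (cls x)" if p: "presented_mod_T X A A\<^sub>1 g x" for X A A\<^sub>1 g x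
  proof -
    have A: "A \<in> Syz" "A\<^sub>1 \<in> Syz" and g: "g \<in> Hom C A\<^sub>1 A" and x: "x \<in> Hom C A X"
      and null: "factors_through C T (x \<bullet> g)"
      and onto: "\<And>A' a. \<lbrakk>A' \<in> Syz; a \<in> Hom C A' X\<rbrakk> \<Longrightarrow> \<exists>b \<in> Hom C A' A. equal_mod T a (x \<bullet> b)"
      and ker: "\<And>A' b. \<lbrakk>A' \<in> Syz; b \<in> Hom C A' A; factors_through C T (x \<bullet> b)\<rbrakk>
        \<Longrightarrow> \<exists>c \<in> Hom C A' A\<^sub>1. equal_mod T b (g \<bullet> c)"
      using p by (auto simp: presented_mod_T_def)
    show ?thesis
      unfolding R.presents_def Obj
    proof (intro conjI ballI)
      show "A \<in> Syz" "A\<^sub>1 \<in> Syz" "cls g \<in> Hom Q A\<^sub>1 A" "cls x \<in> Hom Q A X"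
        using A cls_in[OF g] cls_in[OF x] by simp_all
    next
      fix A' a assume A': "A' \<in> Syz" and "a \<in> Hom Q A' X"
      show "\<exists>b \<in> Hom Q A' A. a = cls x \<cdot>\<^bsub>Q\<^esub> b"
      proof -
        obtain a\<^sub>0 where a0: "a\<^sub>0 \<in> Hom C A' X" "a = cls a\<^sub>0" using cls_cases[OF \<open>a \<in> Hom Q A' X\<close>] .
        obtain b where b: "b \<in> Hom C A' A" "equal_mod T a\<^sub>0 (x \<bullet> b)" using onto[OF A' a0(1)] by blast
        have "a = cls x \<cdot>\<^bsub>Q\<^esub> cls b" using quot_Cmp[OF b(1) x] cls_eqI[OF b(2)] a0(2) by simp
        then show ?thesis using cls_in[OF b(1)] by blast
      qed
    next
      fix A' b assume A': "A' \<in> Syz" and "b \<in> Hom Q A' A"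
      show "cls x \<cdot>\<^bsub>Q\<^esub> b = Zero Q A' X
          \<longleftrightarrow> (\<exists>c \<in> Hom Q A' A\<^sub>1. b = cls g \<cdot>\<^bsub>Q\<^esub> c)"
      proof -
        obtain b\<^sub>0 where b0: "b\<^sub>0 \<in> Hom C A' A" "b = cls b\<^sub>0" using cls_cases[OF \<open>b \<in> Hom Q A' A\<close>] .
        have xb: "x \<bullet> b\<^sub>0 \<in> Hom C A' X" using Cmp_in[OF b0(1) x] .
        have "cls x \<cdot>\<^bsub>Q\<^esub> b = Zero Q A' X \<longleftrightarrow> factors_through C T (x \<bullet> b\<^sub>0)"
          using quot_Cmp[OF b0(1) x] zero[OF xb] b0(2) by simp
        also have "\<dots> \<longleftrightarrow> (\<exists>c \<in> Hom C A' A\<^sub>1. equal_mod T b\<^sub>0 (g \<bullet> c))"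
        proof
          assume "factors_through C T (x \<bullet> b\<^sub>0)"
          then show "\<exists>c \<in> Hom C A' A\<^sub>1. equal_mod T b\<^sub>0 (g \<bullet> c)" using ker[OF A' b0(1)] by simp
        next
          assume "\<exists>c \<in> Hom C A' A\<^sub>1. equal_mod T b\<^sub>0 (g \<bullet> c)"
          then obtain c where c: "c \<in> Hom C A' A\<^sub>1" "equal_mod T b\<^sub>0 (g \<bullet> c)" by blast
          have "factors_through C T (x \<bullet> (g \<bullet> c))"
            using factors_Cmp_right[OF null Cmp_in[OF g x] c(1)] Cmp_assoc[OF c(1) g x] by simp
          moreover have "equal_mod T (x \<bullet> b\<^sub>0) (x \<bullet> (g \<bullet> c))"
            using eqm_Cmp[OF c(2) eqm_refl[OF x] b0(1) x] .
          ultimately show "factors_through C T (x \<bullet> b\<^sub>0)"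
            using factors_eqm[OF _ xb Cmp_in[OF Cmp_in[OF c(1) g] x]] by blast
        qed
        also have "\<dots> \<longleftrightarrow> (\<exists>c \<in> Hom Q A' A\<^sub>1. b = cls g \<cdot>\<^bsub>Q\<^esub> c)"
        proof
          assume "\<exists>c \<in> Hom C A' A\<^sub>1. equal_mod T b\<^sub>0 (g \<bullet> c)"
          then obtain c where c: "c \<in> Hom C A' A\<^sub>1" "equal_mod T b\<^sub>0 (g \<bullet> c)" by blast
          have "b = cls g \<cdot>\<^bsub>Q\<^esub> cls c" using quot_Cmp[OF c(1) g] cls_eqI[OF c(2)] b0(2) by simp
          then show "\<exists>c \<in> Hom Q A' A\<^sub>1. b = cls g \<cdot>\<^bsub>Q\<^esub> c" using cls_in[OF c(1)] by blast
        next
          assume "\<exists>c \<in> Hom Q A' A\<^sub>1. b = cls g \<cdot>\<^bsub>Q\<^esub> c"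
          then obtain d where d: "d \<in> Hom Q A' A\<^sub>1" "b = cls g \<cdot>\<^bsub>Q\<^esub> d" by blast
          obtain c where c: "c \<in> Hom C A' A\<^sub>1" "d = cls c" using cls_cases[OF d(1)] .
          have "cls b\<^sub>0 = cls (g \<bullet> c)" using d(2) c(2) b0(2) quot_Cmp[OF c(1) g] by simp
          then have "equal_mod T b\<^sub>0 (g \<bullet> c)" using cls_eq_Hom[OF b0(1) Cmp_in[OF c(1) g]] by simp
          then show "\<exists>c \<in> Hom C A' A\<^sub>1. equal_mod T b\<^sub>0 (g \<bullet> c)" using c(1) by blast
        qed
        finally show ?thesis .
      qed
    qed
  qed
  have "presented_category K Q syzygy_quotient e"
  proof (intro presented_category.intro presented_category_axioms.intro R)
    fix X assume "X \<in> Obj Q"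
    then have X: "X \<in> Obj C" by (simp add: quot_Obj)
    obtain A A\<^sub>1 g x where p: "presented_mod_T X A A\<^sub>1 g x"
      and epi: "\<And>Y h. \<lbrakk>h \<in> Hom C X Y; factors_through C T (h \<bullet> x)\<rbrakk> \<Longrightarrow> factors_through C T h"
      using presentation_of_object[OF X] by metis
    have x: "x \<in> Hom C A X" using p by (simp add: presented_mod_T_def)
    have "h = Zero Q X Y"
      if hQ: "h \<in> Hom Q X Y" and hx: "h \<cdot>\<^bsub>Q\<^esub> cls x = Zero Q A Y" for h Y
    proof -
      obtain h\<^sub>0 where h: "h\<^sub>0 \<in> Hom C X Y" "h = cls h\<^sub>0" using cls_cases[OF hQ] .
      then show ?thesis using hx quot_Cmp[OF x h(1)] zero[OF Cmp_in[OF x h(1)]] zero[OF h(1)] epi[OF h(1)] by simp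
    qed
    then show "\<exists>C\<^sub>0 C\<^sub>1 g x. R.presents X C\<^sub>0 C\<^sub>1 g x \<and> (\<forall>Y \<in> Obj Q. \<forall>h \<in> Hom Q X Y.
        h \<cdot>\<^bsub>Q\<^esub> x = Zero Q C\<^sub>0 Y \<longrightarrow> h = Zero Q X Y)"
      using pres[OF p] by blast
  next
    fix A A\<^sub>1 c assume "A \<in> Obj syzygy_quotient" "A\<^sub>1 \<in> Obj syzygy_quotient" and c: "c \<in> Hom Q A\<^sub>1 A"
    then have A: "A \<in> Syz" "A\<^sub>1 \<in> Syz" by (simp_all add: Obj)
    obtain g where g: "g \<in> Hom C A\<^sub>1 A" "c = cls g" using cls_cases[OF c] .
    obtain W i where p: "presented_mod_T W A A\<^sub>1 g i"
      and up: "\<And>Y y. \<lbrakk>y \<in> Hom C A Y; factors_through C T (y \<bullet> g)\<rbrakk> \<Longrightarrow> \<exists>h \<in> Hom C W Y. h \<bullet> i = y"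
      using weak_cokernel_of_syzygies[OF A g(1)] by metis
    have i: "i \<in> Hom C A W" using p by (simp add: presented_mod_T_def)
    have "\<exists>h \<in> Hom Q W Y. h \<cdot>\<^bsub>Q\<^esub> cls i = y"
      if yQ: "y \<in> Hom Q A Y" and yc: "y \<cdot>\<^bsub>Q\<^esub> c = Zero Q A\<^sub>1 Y" for y Y
    proof -
      obtain y\<^sub>0 where y: "y\<^sub>0 \<in> Hom C A Y" "y = cls y\<^sub>0" using cls_cases[OF yQ] .
      have "factors_through C T (y\<^sub>0 \<bullet> g)"
        using yc y g quot_Cmp[OF g(1) y(1)] zero[OF Cmp_in[OF g(1) y(1)]] by simp
      then obtain h where h: "h \<in> Hom C W Y" "h \<bullet> i = y\<^sub>0" using up[OF y(1)] by blast
      then have "cls h \<cdot>\<^bsub>Q\<^esub> cls i = y" using quot_Cmp[OF i h(1)] y(2) by simp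
      then show ?thesis using cls_in[OF h(1)] by blast
    qed
    moreover have "W \<in> Obj Q" using Hom_Cod[OF i] by (simp add: quot_Obj)
    ultimately show "\<exists>W \<in> Obj Q. \<exists>i. R.presents W A A\<^sub>1 c i \<and> (\<forall>Y \<in> Obj Q.
        \<forall>y \<in> Hom Q A Y. y \<cdot>\<^bsub>Q\<^esub> c = Zero Q A\<^sub>1 Y \<longrightarrow>
          (\<exists>h \<in> Hom Q W Y. h \<cdot>\<^bsub>Q\<^esub> i = y))"
      using pres[OF p] g(2) by blast
  next
    fix f X Y A a assume f: "f \<in> Hom Q X Y" and epi: "is_epi Q f"
      and "A \<in> Obj syzygy_quotient" and a: "a \<in> Hom Q A Y"
    then have A: "A \<in> Syz" by (simp add: Obj)
    obtain f\<^sub>0 where f0: "f\<^sub>0 \<in> Hom C X Y" "f = cls f\<^sub>0" using cls_cases[OF f] .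
    obtain a\<^sub>0 where a0: "a\<^sub>0 \<in> Hom C A Y" "a = cls a\<^sub>0" using cls_cases[OF a] .
    have cancel: "factors_through C T v" if v: "v \<in> Hom C Y W" and vf: "factors_through C T (v \<bullet> f\<^sub>0)" for v W
    proof -
      have W: "W \<in> Obj C" and Y: "Y \<in> Obj C" using Hom_Cod[OF v] Hom_Dom[OF v] .
      have z: "Zero C Y W \<in> Hom C Y W" using Zero_in[OF Y W] .
      have "cls v \<cdot>\<^bsub>Q\<^esub> f = cls (Zero C Y W) \<cdot>\<^bsub>Q\<^esub> f"
        using quot_Cmp[OF f0(1) v] quot_Cmp[OF f0(1) z] Cmp_Zero_left[OF f0(1) W] zero[OF Cmp_in[OF f0(1) v]] vf f0(2)
        by (simp add: quot_Zero)
      moreover have "Cod Q f = Y" using f by (simp add: Hom_def)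
      ultimately have "cls v = cls (Zero C Y W)"
        using epi cls_in[OF v] cls_in[OF z] W unfolding is_epi_def quot_Obj by blast
      then show ?thesis using zero[OF v] by (simp add: quot_Zero)
    qed
    have "\<exists>b \<in> Hom C A X. equal_mod T a\<^sub>0 (f\<^sub>0 \<bullet> b)"
      by (rule lift_along_quotient_epi[OF f0(1) _ A a0(1)]) (rule cancel)
    then obtain b where b: "b \<in> Hom C A X" "equal_mod T a\<^sub>0 (f\<^sub>0 \<bullet> b)" by blast
    have "f \<cdot>\<^bsub>Q\<^esub> cls b = a" using quot_Cmp[OF b(1) f0(1)] cls_eqI[OF b(2)] f0(2) a0(2) by simp
    then show "\<exists>b \<in> Hom Q A X. f \<cdot>\<^bsub>Q\<^esub> b = a" using cls_in[OF b(1)] by blast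
  qed
  then show ?thesis by (simp add: e_def)
qed

end

theorem theorem9p3:
  fixes K :: "('k, 'r) ring_scheme"
    and B :: "('o, 'm, 'k, 'z) lincat_scheme"
    and E :: "('m \<times> 'm) set"
    and S T V :: "'o set"
  assumes "exact_category K B E"
    and "krull_schmidt B"
    and "enough_projectives B E"
    and "enough_injectives B E"
    and "twin_cotorsion_pair B E S T V"
    and "\<exists>u :: 'm \<Rightarrow> 'v. inj u"
  shows "equivalent_categories
    (localisation (quot_cat B T) (mono_epis (quot_cat B T)))
    (fp_modules TYPE('v) K (quot_cat (full_sub B (syzygies B E S)) (projectives B E)))"
proof -
  obtain u :: "'m \<Rightarrow> 'v" where u: "inj u" using assms(6) by blast
  interpret exact_category K B E by fact
  interpret cotorsion_setting K B E S T
    by unfold_locales (use assms(3,5) in \<open>auto simp: twin_cotorsion_pair_def\<close>)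
  interpret P: presented_category K "quot_cat B T" "quot_cat (full_sub B (syzygies B E S)) (projectives B E)"
      "\<lambda>c. u (SOME f. f \<in> c)"
    by (rule quotient_is_presented[OF u])
  show ?thesis by (rule P.localisation_at_mono_epis)
qed

end
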